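(* $$m_1(\mathbb{R}^2)\le 0.258795.$$
   Context: A set $A\subseteq\mathbb{R}^n$ is called $1$-avoiding if $\|x-y\|\neq 1$ for all $x,y\in A$ (Euclidean norm). The upper density of a Lebesgue measurable set $A\subseteq\mathbb{R}^n$ is $$\overline{\delta}(A)=\limsup_{r\to\infty}\frac{\lambda(A\cap S(p,r))}{\lambda(S(p,r))},$$ where $\lambda$ is Lebesgue measure and $S(p,r)$ is the $n$-dimensional cube of side $2r$ centered at $p\in\mathbb{R}^n$ (the value does not depend on the choice of $p$). Define $$m_1(\mathbb{R}^n)=\sup\{\overline{\delta}(A): A\subseteq\mathbb{R}^n \text{ is } 1\text{-avoiding and Lebesgue measurable}\}.$$ *)

theory Defs
  imports "HOL-Analysis.Analysis"
begin

definition one_avoiding :: "(real ^ 'n) set \<Rightarrow> bool" where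
  "one_avoiding A \<longleftrightarrow> (\<forall>x\<in>A. \<forall>y\<in>A. norm (x - y) \<noteq> 1)"

definition cube :: "real ^ 'n \<Rightarrow> real \<Rightarrow> (real ^ 'n) set" where
  "cube p r = cbox (\<chi> i. p $ i - r) (\<chi> i. p $ i + r)"

definition upper_density_at :: "real ^ 'n \<Rightarrow> (real ^ 'n) set \<Rightarrow> ereal" where
  "upper_density_at p A =
     Limsup at_top (\<lambda>r::real. ereal (measure lebesgue (A \<inter> cube p r) / measure lebesgue (cube p r)))"

text \<open>The value does not depend on the centre of the cubes; see \<open>upper_density_at_eq\<close> below.\<close>

definition upper_density :: "(real ^ 'n) set \<Rightarrow> ereal" where
  "upper_density A = upper_density_at 0 A"

text \<open>The dimension is passed as an index type: \<open>m1 TYPE('n)\<close> is $m_1(\mathbb{R}^n)$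
  for $n$ the cardinality of \<open>'n\<close>.\<close>

definition m1 :: "'n::finite itself \<Rightarrow> ereal" where
  "m1 _ = (SUP A \<in> {A :: (real ^ 'n) set. one_avoiding A \<and> A \<in> sets lebesgue}. upper_density A)"

lemma measure_cube:
  fixes p :: "real ^ 'n"
  assumes "r \<ge> 0"
  shows "measure lebesgue (cube p r) = (2 * r) ^ CARD('n)"
proof -
  have "cbox (\<chi> i. p $ i - r) (\<chi> i. p $ i + r) \<noteq> {}"
    using assms by (auto simp: interval_ne_empty_cart)
  then show ?thesis
    by (simp add: cube_def content_cbox_cart)
qed

lemma lmeasurable_cube: "cube p r \<in> lmeasurable"
  by (simp add: cube_def)

lemma cube_mono:
  assumes "\<And>i. \<bar>p $ i - q $ i\<bar> \<le> s - r"
  shows "cube p r \<subseteq> cube q s"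
proof
  fix x assume x: "x \<in> cube p r"
  have "q $ i - s \<le> x $ i \<and> x $ i \<le> q $ i + s" for i
  proof -
    have "p $ i - r \<le> x $ i \<and> x $ i \<le> p $ i + r"
      using x by (simp add: cube_def mem_box_cart)
    then show ?thesis using assms[of i] by linarith
  qed
  then show "x \<in> cube q s" by (simp add: cube_def mem_box_cart)
qed

lemma Limsup_le_of_diff_tendsto_0:
  fixes f g :: "real \<Rightarrow> real"
  assumes "((\<lambda>r. f r - g r) \<longlongrightarrow> 0) at_top"
  shows "Limsup at_top (\<lambda>r. ereal (f r)) \<le> Limsup at_top (\<lambda>r. ereal (g r))"
proof (rule ereal_le_epsilon2)
  fix e :: real assume e: "e > 0"
  have "\<forall>\<^sub>F r in at_top. f r - g r < e"
    using order_tendstoD(2)[OF assms e] .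
  then have "Limsup at_top (\<lambda>r. ereal (f r)) \<le> Limsup at_top (\<lambda>r. ereal (g r) + ereal e)"
    by (intro Limsup_mono) (auto elim!: eventually_mono)
  also have "\<dots> = Limsup at_top (\<lambda>r. ereal (g r)) + ereal e"
    by (rule Limsup_add_ereal_right) auto
  finally show "Limsup at_top (\<lambda>r. ereal (f r)) \<le> Limsup at_top (\<lambda>r. ereal (g r)) + ereal e" .
qed

lemma upper_density_at_eq:
  fixes p :: "real ^ 'n"
  assumes A: "A \<in> sets lebesgue"
  shows "upper_density_at p A = upper_density A"
proof -
  define F where "F q r = measure lebesgue (A \<inter> cube q r) / measure lebesgue (cube q r)"
    for q :: "real ^ 'n" and r
  define c where "c = norm p"
  define L where "L r = measure lebesgue (A \<inter> cube 0 (r - c)) / (2 * r) ^ CARD('n)" for r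
  have bnd: "L r \<le> F q r \<and> F q r \<le> L r + (1 - (1 - c / r) ^ CARD('n))"
    if r: "r > c" and q: "\<And>i. \<bar>q $ i\<bar> \<le> c" for r q
  proof -
    have c0: "c \<ge> 0" by (simp add: c_def)
    have sub: "cube 0 (r - c) \<subseteq> cube q r"
      by (rule cube_mono) (use q in auto)
    have m: "A \<inter> cube q' s \<in> lmeasurable" for q' s
      using lmeasurable_cube A by (metis fmeasurable_Int_fmeasurable inf_commute)
    have le1: "measure lebesgue (A \<inter> cube 0 (r - c)) \<le> measure lebesgue (A \<inter> cube q r)"
      by (rule measure_mono_fmeasurable) (use sub m fmeasurableD in auto)
    have "measure lebesgue (A \<inter> cube q r)
        \<le> measure lebesgue ((A \<inter> cube 0 (r - c)) \<union> (cube q r - cube 0 (r - c)))"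
      by (rule measure_mono_fmeasurable)
         (auto intro: m fmeasurableD fmeasurable.Un fmeasurable.Diff lmeasurable_cube)
    also have "\<dots> \<le> measure lebesgue (A \<inter> cube 0 (r - c)) + measure lebesgue (cube q r - cube 0 (r - c))"
      by (rule measure_Un_le) (auto intro: m fmeasurableD fmeasurable.Diff lmeasurable_cube)
    also have "measure lebesgue (cube q r - cube 0 (r - c))
        = (2 * r) ^ CARD('n) - (2 * (r - c)) ^ CARD('n)"
      using r c0 sub
      by (subst measurable_measure_Diff) (auto simp: lmeasurable_cube fmeasurableD measure_cube)
    finally have le2: "measure lebesgue (A \<inter> cube q r) \<le> measure lebesgue (A \<inter> cube 0 (r - c))
        + ((2 * r) ^ CARD('n) - (2 * (r - c)) ^ CARD('n))" .
    have Feq: "F q r = measure lebesgue (A \<inter> cube q r) / (2 * r) ^ CARD('n)"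
      using r c0 by (simp add: F_def measure_cube)
    have "1 - c / r = (2 * (r - c)) / (2 * r)" using r c0 by (simp add: field_simps)
    then have e: "1 - (1 - c / r) ^ CARD('n)
        = ((2 * r) ^ CARD('n) - (2 * (r - c)) ^ CARD('n)) / (2 * r) ^ CARD('n)"
      using r c0 by (simp only: power_divide) (simp add: diff_divide_distrib)
    have pos: "(2 * r) ^ CARD('n) > 0" using r c0 by simp
    show ?thesis
      unfolding Feq L_def e add_divide_distrib[symmetric]
      using le1 le2 pos by (auto intro!: divide_right_mono)
  qed
  have "((\<lambda>r. 1 - (1 - c / r) ^ CARD('n)) \<longlongrightarrow> 1 - (1 - 0) ^ CARD('n)) at_top"
    by (intro tendsto_intros tendsto_divide_0[OF tendsto_const] filterlim_at_top_imp_at_infinity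
        filterlim_ident)
  then have lim: "((\<lambda>r. 1 - (1 - c / r) ^ CARD('n)) \<longlongrightarrow> 0) at_top" by simp
  have ev: "\<forall>\<^sub>F r in at_top. norm (F p r - F 0 r) \<le> 1 - (1 - c / r) ^ CARD('n)"
    using eventually_gt_at_top[of c]
  proof eventually_elim
    case (elim r)
    have "\<bar>p $ i\<bar> \<le> c" for i by (simp add: c_def component_le_norm_cart)
    moreover have "\<bar>(0 :: real ^ 'n) $ i\<bar> \<le> c" for i by (simp add: c_def)
    ultimately show ?case using bnd[OF elim, of p] bnd[OF elim, of 0] by (simp add: abs_le_iff)
  qed
  have d1: "((\<lambda>r. F p r - F 0 r) \<longlongrightarrow> 0) at_top"
    by (rule Lim_null_comparison[OF ev lim])
  have d2: "((\<lambda>r. F 0 r - F p r) \<longlongrightarrow> 0) at_top"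
    using tendsto_minus[OF d1] by simp
  show ?thesis
    unfolding upper_density_def upper_density_at_def F_def[symmetric]
    by (rule antisym[OF Limsup_le_of_diff_tendsto_0[OF d1] Limsup_le_of_diff_tendsto_0[OF d2]])
qed

end

theory Submission
  imports Defs "HOL-Probability.Probability"
begin

text \<open>
  Let \<open>B\<close> be a compact 1-avoiding subset of a large square \<open>Q\<close>, let \<open>\<beta> = |B| / |Q|\<close>, and let \<open>c(r)\<close> be the
  mean, over all unit vectors \<open>u\<close>, of the area of \<open>B \<inter> (B - r u)\<close> (\<open>mean_overlap\<close> below). Then \<open>c(0) = |B|\<close> and
  \<open>c(1) = 0\<close>. Two families of linear inequalities for \<open>c\<close> contradict each other when \<open>\<beta>\<close> is too large.

  Positive definiteness. The autocorrelation of a function \<open>h\<close> is the Fourier transform of a positive measure,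
  and the mean of a plane wave over a circle of radius \<open>r\<close> is a value of the Bessel function \<open>J0\<close>. So if
  \<open>a\<^sub>1 J0(r\<^sub>1 t) + \<dots> + a\<^sub>n J0(r\<^sub>n t) \<ge> 0\<close> for all \<open>t \<ge> 0\<close>, then the same combination of circle means of the
  autocorrelation of \<open>h\<close> is nonnegative (\<open>positive_definite_circle_means\<close>). For \<open>h = 1\<^sub>B - \<beta> 1\<^sub>Q\<close> this says that
  \<open>a\<^sub>1 c(r\<^sub>1) + \<dots> + a\<^sub>n c(r\<^sub>n) \<ge> (a\<^sub>1 + \<dots> + a\<^sub>n) \<beta> |B|\<close> up to an error of the order of the perimeter of \<open>Q\<close>
  (\<open>positivity_of_mean_overlaps\<close>).

  Finite configurations. Take points \<open>p\<^sub>1, \<dots>, p\<^sub>n\<close> and a quadratic form \<open>\<Sum> u\<^sub>i x\<^sub>i + \<Sum> u\<^sub>i\<^sub>j x\<^sub>i x\<^sub>j\<close> which is at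
  most \<open>M\<close> on the indicator vectors of all subsets without two points at distance 1. A congruent copy of the
  configuration meets \<open>B\<close> in such a subset, so integrating over all copies gives
  \<open>|B| \<Sum> u\<^sub>i + \<Sum> u\<^sub>i\<^sub>j c(|p\<^sub>i - p\<^sub>j|) \<le> M |Q|\<close>, again up to the boundary (\<open>block_inequality\<close>). Two
  configurations are used: the 16 points of the Minkowski sum of a unit rhombus with angle 60 degrees and its
  rotation by 30 degrees, with \<open>M = 16\<close>, and an equilateral triangle together with its centre, with \<open>M = 0\<close>.
  All their distances are of the form \<open>sqrt (m + n sqrt 3) / 2\<close>.

  The integer coefficients come from a linear program. They are such that the sum of the two configuration
  inequalities contains each \<open>c(r)\<close> with \<open>r \<noteq> 0, 1\<close> with the coefficient of \<open>J0(r t)\<close> in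
  \<open>witness t = 23.05 + 77 J0(t) + \<dots>\<close>. This function is nonnegative and has value 158.05 at 0. Hence
  \<open>158.05 \<beta>\<^sup>2 \<le> 23.05 \<beta> + (16 - 44 \<beta>) + o(1)\<close> as the square grows (\<open>density_inequality\<close>), which fails for
  \<open>\<beta> = 0.258795\<close>, the left side then exceeding the right side by 0.007.

  That the witness is nonnegative (\<open>witness_nonneg\<close>) is a numerical fact. For a solution of the Bessel
  equation with right-hand side, \<open>sqrt (D\<^sup>2 + D'\<^sup>2)\<close> grows at most at the rate of the right-hand side, divided by \<open>x\<close>. This turns a
  list of polynomials, one on each interval of length 1, that nearly solve the equation and nearly fit
  together, into rigorous values of \<open>J0\<close> up to 167. The witness is then checked on 119 points of \<open>[0, 61]\<close>;
  its second derivative controls it in between, and \<open>x J0(x)\<^sup>2 \<le> 0.64\<close> for \<open>x \<ge> 30\<close> controls it beyond 61.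
\<close>

section \<open>The Bessel function as a circle mean\<close>

definition circle_mean :: "(real \<Rightarrow> real) \<Rightarrow> real" where
  "circle_mean f = integral {0..2*pi} f / (2*pi)"

lemma circle_mean_abs_le:
  assumes "continuous_on {0..2*pi} f" "\<And>\<theta>. \<bar>f \<theta>\<bar> \<le> g \<theta>" "continuous_on {0..2*pi} g"
  shows "\<bar>circle_mean f\<bar> \<le> circle_mean g"
proof -
  have "norm (integral {0..2*pi} f) \<le> integral {0..2*pi} g"
    by (rule integral_norm_bound_integral) (use assms in \<open>auto intro: integrable_continuous_interval\<close>)
  then show ?thesis by (simp add: circle_mean_def divide_right_mono)
qed

lemma circle_mean_const [simp]: "circle_mean (\<lambda>_. c) = c"
  by (simp add: circle_mean_def)

lemma circle_mean_add:
  assumes "continuous_on {0..2*pi} f" "continuous_on {0..2*pi} g"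
  shows "circle_mean (\<lambda>\<theta>. f \<theta> + g \<theta>) = circle_mean f + circle_mean g"
  using assms by (simp add: circle_mean_def integral_add integrable_continuous_interval add_divide_distrib)

lemma circle_mean_cmult: "circle_mean (\<lambda>\<theta>. c * f \<theta>) = c * circle_mean f"
  by (simp add: circle_mean_def)

definition J0 :: "real \<Rightarrow> real" where
  "J0 x = circle_mean (\<lambda>\<theta>. cos (x * cos \<theta>))"
definition J0' :: "real \<Rightarrow> real" where
  "J0' x = circle_mean (\<lambda>\<theta>. - (cos \<theta> * sin (x * cos \<theta>)))"
definition J0'' :: "real \<Rightarrow> real" where
  "J0'' x = circle_mean (\<lambda>\<theta>. - ((cos \<theta>)\<^sup>2 * cos (x * cos \<theta>)))"

lemma circle_mean_has_derivative:
  assumes d: "\<And>x \<theta>. ((\<lambda>x. f x \<theta>) has_real_derivative f' x \<theta>) (at x)"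
    and c: "\<And>x. continuous_on {0..2*pi} (f x)"
    and c': "continuous_on (UNIV \<times> {0..2*pi}) (\<lambda>(x, \<theta>). f' x \<theta>)"
  shows "((\<lambda>x. circle_mean (f x)) has_real_derivative circle_mean (f' x)) (at x)"
proof -
  have "((\<lambda>x. integral (cbox 0 (2*pi)) (f x)) has_field_derivative
     integral (cbox 0 (2*pi)) (f' x)) (at x within UNIV)"
    by (rule leibniz_rule_field_derivative) (use assms in \<open>auto intro: integrable_continuous_interval\<close>)
  then show ?thesis
    unfolding circle_mean_def by (simp add: DERIV_cdivide)
qed

lemma J0_deriv: "(J0 has_real_derivative J0' x) (at x)"
  unfolding J0_def[abs_def] J0'_def
  by (rule circle_mean_has_derivative)
     (auto intro!: derivative_eq_intros continuous_intros simp: case_prod_unfold)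

lemma J0'_deriv: "(J0' has_real_derivative J0'' x) (at x)"
  unfolding J0'_def[abs_def] J0''_def
  by (rule circle_mean_has_derivative)
     (auto intro!: derivative_eq_intros continuous_intros simp: case_prod_unfold power2_eq_square)

lemma J0_0 [simp]: "J0 0 = 1" and J0'_0 [simp]: "J0' 0 = 0"
  by (simp_all add: J0_def J0'_def)

lemma circle_mean_cos_square: "circle_mean (\<lambda>\<theta>. (cos \<theta>)\<^sup>2) = 1/2"
proof -
  have "((\<lambda>\<theta>. (cos \<theta>)\<^sup>2) has_integral ((2*pi + sin (2*pi) * cos (2*pi))/2 - (0 + sin 0 * cos 0)/2)) {0..2*pi}"
  proof (rule fundamental_theorem_of_calculus)
    fix x :: real
    have "((\<lambda>x. (x + sin x * cos x)/2) has_real_derivative (1 + (cos x * cos x - sin x * sin x))/2) (at x)"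
      by (auto intro!: derivative_eq_intros)
    also have "(1 + (cos x * cos x - sin x * sin x))/2 = (cos x)\<^sup>2"
      using sin_cos_squared_add[of x] unfolding power2_eq_square by (simp add: field_simps)
    finally show "((\<lambda>x. (x + sin x * cos x)/2) has_vector_derivative (cos x)\<^sup>2) (at x within {0..2*pi})"
      by (simp add: has_real_derivative_iff_has_vector_derivative has_vector_derivative_at_within)
  qed simp
  then show ?thesis by (simp add: circle_mean_def integral_unique)
qed

lemma abs_J0''_le: "\<bar>J0'' x\<bar> \<le> 1/2"
proof -
  have "\<bar>J0'' x\<bar> \<le> circle_mean (\<lambda>\<theta>. (cos \<theta>)\<^sup>2)"
    unfolding J0''_def
    by (rule circle_mean_abs_le)
       (auto intro!: continuous_intros simp: abs_mult mult_left_le)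
  then show ?thesis by (simp add: circle_mean_cos_square)
qed

lemma abs_J0'_le: "\<bar>J0' x\<bar> \<le> 1"
proof -
  have "\<bar>J0' x\<bar> \<le> circle_mean (\<lambda>\<theta>. 1)"
    unfolding J0'_def
    by (rule circle_mean_abs_le)
       (auto intro!: continuous_intros mult_le_one simp: abs_mult)
  then show ?thesis by simp
qed

text \<open>Integration of the \<open>\<theta>\<close>-derivative of \<open>- sin \<theta> sin (x cos
  \<theta>)\<close> over a full period.\<close>

lemma Bessel_equation: "x * J0'' x + J0' x + x * J0 x = 0"
proof -
  have "((\<lambda>\<theta>. - (cos \<theta> * sin (x * cos \<theta>)) + x * ((sin \<theta>)\<^sup>2 * cos (x * cos \<theta>))) has_integral
      (- (sin (2*pi) * sin (x * cos (2*pi))) - - (sin 0 * sin (x * cos 0)))) {0..2*pi}"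
  proof (rule fundamental_theorem_of_calculus)
    fix t :: real
    have "((\<lambda>\<theta>. - (sin \<theta> * sin (x * cos \<theta>))) has_real_derivative
       - (cos t * sin (x * cos t)) + x * ((sin t)\<^sup>2 * cos (x * cos t))) (at t)"
      by (auto intro!: derivative_eq_intros simp: power2_eq_square)
    then show "((\<lambda>\<theta>. - (sin \<theta> * sin (x * cos \<theta>))) has_vector_derivative
       - (cos t * sin (x * cos t)) + x * ((sin t)\<^sup>2 * cos (x * cos t))) (at t within {0..2*pi})"
      by (simp add: has_real_derivative_iff_has_vector_derivative has_vector_derivative_at_within)
  qed simp
  then have "circle_mean (\<lambda>\<theta>. - (cos \<theta> * sin (x * cos \<theta>)) + x * ((sin \<theta>)\<^sup>2 * cos (x * cos \<theta>))) = 0"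
    by (simp add: circle_mean_def integral_unique)
  moreover have "(\<lambda>\<theta>. - (cos \<theta> * sin (x * cos \<theta>)) + x * ((sin \<theta>)\<^sup>2 * cos (x * cos \<theta>)))
      = (\<lambda>\<theta>. - (cos \<theta> * sin (x * cos \<theta>)) + (x * - ((cos \<theta>)\<^sup>2 * cos (x * cos \<theta>)) + x * cos (x * cos \<theta>)))"
    by (auto simp: sin_squared_eq algebra_simps)
  moreover have "circle_mean (\<lambda>\<theta>. - (cos \<theta> * sin (x * cos \<theta>)) + (x * - ((cos \<theta>)\<^sup>2 * cos (x * cos \<theta>)) + x * cos (x * cos \<theta>)))
      = J0' x + circle_mean (\<lambda>\<theta>. x * - ((cos \<theta>)\<^sup>2 * cos (x * cos \<theta>)) + x * cos (x * cos \<theta>))"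
    unfolding J0'_def by (rule circle_mean_add) (auto intro!: continuous_intros)
  moreover have "circle_mean (\<lambda>\<theta>. x * - ((cos \<theta>)\<^sup>2 * cos (x * cos \<theta>)) + x * cos (x * cos \<theta>))
      = circle_mean (\<lambda>\<theta>. x * - ((cos \<theta>)\<^sup>2 * cos (x * cos \<theta>))) + circle_mean (\<lambda>\<theta>. x * cos (x * cos \<theta>))"
    by (rule circle_mean_add) (auto intro!: continuous_intros)
  ultimately have "J0' x + (x * J0'' x + x * J0 x) = 0"
    by (simp only: J0_def J0''_def circle_mean_cmult)
  then show ?thesis by linarith
qed

text \<open>The derivative of \<open>D\<^sup>2 + D'\<^sup>2\<close> is \<open>2 D' (D + D'')\<close>. In
  this the damping term \<open>D' / x\<close> of the Bessel operator contributes a nonpositive amount, so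
  only the residual can increase the energy. This is what keeps approximation errors from being amplified
  when they are carried over a long interval.\<close>

lemma sqrt_energy_growth:
  fixes D D' D'' :: "real \<Rightarrow> real"
  assumes ab: "a \<le> b" and a0: "0 \<le> a"
    and d: "\<And>x. (D has_real_derivative D' x) (at x)"
    and d': "\<And>x. (D' has_real_derivative D'' x) (at x)"
    and res: "\<And>x. a < x \<Longrightarrow> x < b \<Longrightarrow> \<bar>x * D'' x + D' x + x * D x\<bar> \<le> k * x"
  shows "sqrt ((D b)\<^sup>2 + (D' b)\<^sup>2) \<le> sqrt ((D a)\<^sup>2 + (D' a)\<^sup>2) + k * (b - a)"
proof (cases "a = b")
  case False
  then have ab: "a < b" using ab by simp
  define E where "E x = (D x)\<^sup>2 + (D' x)\<^sup>2" for x
  have E0: "E x \<ge> 0" for x by (simp add: E_def)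
  \<comment> \<open>The shift by \<open>e\<close> avoids the point where the square root is not differentiable.\<close>
  have *: "sqrt (E b + e) \<le> sqrt (E a + e) + k * (b - a)" if e: "e > 0" for e
  proof -
    have dE: "((\<lambda>x. sqrt (E x + e)) has_real_derivative
        (D' x * (D x + D'' x) / sqrt (E x + e))) (at x)" for x
    proof -
      have pos: "E x + e > 0" using E0[of x] e by linarith
      have der: "((\<lambda>x. E x + e) has_real_derivative (2 * D' x * (D x + D'' x))) (at x)"
        unfolding E_def
        by (rule derivative_eq_intros d d' refl | simp add: algebra_simps)+
      show ?thesis
        by (rule DERIV_cong[OF DERIV_chain2[OF DERIV_real_sqrt[OF pos] der]]) (simp add: divide_simps)
    qed
    have "\<exists>y. a < y \<and> y < b \<and> sqrt (E b + e) - sqrt (E a + e)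
        = (b - a) * (D' y * (D y + D'' y) / sqrt (E y + e))"
      by (rule MVT2[OF ab dE])
    then obtain y where y: "a < y" "y < b"
      and eq: "sqrt (E b + e) - sqrt (E a + e) = (b - a) * (D' y * (D y + D'' y) / sqrt (E y + e))"
      by blast
    have y0: "y > 0" using y a0 by linarith
    have pos: "sqrt (E y + e) > 0" using E0[of y] e by simp
    have "y * (D' y * (D y + D'' y)) = D' y * (y * D'' y + D' y + y * D y) - (D' y)\<^sup>2"
      by (simp add: algebra_simps power2_eq_square)
    also have "\<dots> \<le> \<bar>D' y\<bar> * \<bar>y * D'' y + D' y + y * D y\<bar>"
    proof -
      have "D' y * (y * D'' y + D' y + y * D y) \<le> \<bar>D' y\<bar> * \<bar>y * D'' y + D' y + y * D y\<bar>"
        unfolding abs_mult[symmetric] by (rule abs_ge_self)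
      then show ?thesis using zero_le_power2[of "D' y"] by linarith
    qed
    also have "\<dots> \<le> \<bar>D' y\<bar> * (k * y)"
      using res[OF y] by (intro mult_left_mono) auto
    finally have le: "y * (D' y * (D y + D'' y)) \<le> \<bar>D' y\<bar> * (k * y)" .
    have 1: "D' y * (D y + D'' y) \<le> \<bar>D' y\<bar> * k"
    proof -
      have "y * (D' y * (D y + D'' y)) \<le> y * (\<bar>D' y\<bar> * k)"
        using le by (simp only: mult_ac)
      then show ?thesis using y0 mult_le_cancel_left_pos by blast
    qed
    have k0: "k \<ge> 0" using res[OF y] y0 by (metis abs_ge_zero order_trans zero_le_mult_iff not_less)
    have "\<bar>D' y\<bar> \<le> sqrt (E y + e)"
      by (rule real_le_rsqrt) (use e in \<open>auto simp: E_def\<close>)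
    then have "\<bar>D' y\<bar> * k \<le> sqrt (E y + e) * k" using k0 by (rule mult_right_mono)
    then have "D' y * (D y + D'' y) / sqrt (E y + e) \<le> k"
      using 1 pos by (simp add: divide_simps mult.commute)
    then have "(b - a) * (D' y * (D y + D'' y) / sqrt (E y + e)) \<le> (b - a) * k"
      using ab by (intro mult_left_mono) auto
    then show ?thesis using eq by (simp add: mult.commute)
  qed
  have lim: "((\<lambda>e. sqrt (E c + e)) \<longlongrightarrow> sqrt (E c + 0)) (at_right 0)" for c
    by (intro tendsto_intros)
  have "sqrt (E b + 0) \<le> sqrt (E a + 0) + k * (b - a)"
  proof (rule tendsto_le[OF _ tendsto_add[OF lim[of a] tendsto_const] lim[of b]])
    show "\<forall>\<^sub>F e in at_right 0. sqrt (E b + e) \<le> sqrt (E a + e) + k * (b - a)"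
      using eventually_at_right_less[of 0] by eventually_elim (use * in auto)
  qed simp
  then show ?thesis by (simp add: E_def)
qed simp

text \<open>The function \<open>u = sqrt x J0(x)\<close> satisfies \<open>u'' + (1 + 1 / (4 x\<^sup>2)) u
  = 0\<close>, and \<open>u'\<^sup>2 + (1 + 1 / (4 x\<^sup>2)) u\<^sup>2\<close> decreases because the
  coefficient does. The right-hand side is this energy at \<open>a\<close>, written in terms of
  \<open>J0\<close> and its derivative.\<close>

lemma J0_decay:
  assumes a: "0 < a" and x: "a \<le> x"
  shows "x * (J0 x)\<^sup>2 \<le> a * ((J0 a)\<^sup>2 + (J0' a)\<^sup>2) + J0 a * J0' a + (J0 a)\<^sup>2 / (2 * a)"
proof -
  \<comment> \<open>The energy of \<open>sqrt x J0(x)\<close>.\<close>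
  define E where "E x = x * ((J0 x)\<^sup>2 + (J0' x)\<^sup>2) + J0 x * J0' x + (J0 x)\<^sup>2 / (2 * x)" for x
  have "E x \<le> E a"
  proof (rule DERIV_nonpos_imp_nonincreasing[OF x])
    fix y assume y: "a \<le> y" "y \<le> x"
    then have y0: "y > 0" using a by linarith
    have J: "J0'' y = - J0 y - J0' y / y"
      using Bessel_equation[of y] y0 by (simp add: field_simps)
    have J0J0: "((\<lambda>x. (J0 x)\<^sup>2) has_real_derivative 2 * J0 y * J0' y) (at y)"
      using DERIV_power[OF J0_deriv[of y], of 2] by (simp add: mult_ac)
    have J1J1: "((\<lambda>x. (J0' x)\<^sup>2) has_real_derivative 2 * J0' y * J0'' y) (at y)"
      using DERIV_power[OF J0'_deriv[of y], of 2] by (simp add: mult_ac)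
    have J0J1: "((\<lambda>x. J0 x * J0' x) has_real_derivative J0' y * J0' y + J0'' y * J0 y) (at y)"
      by (rule DERIV_mult[OF J0_deriv J0'_deriv])
    have den: "((\<lambda>x. 2 * x) has_real_derivative 2) (at y)"
      using DERIV_cmult_Id[of 2 y] .
    have "(E has_real_derivative
        (1 * ((J0 y)\<^sup>2 + (J0' y)\<^sup>2) + (2 * J0 y * J0' y + 2 * J0' y * J0'' y) * y)
        + (J0' y * J0' y + J0'' y * J0 y)
        + (2 * J0 y * J0' y * (2 * y) - (J0 y)\<^sup>2 * 2) / ((2 * y) * (2 * y))) (at y)"
      unfolding E_def
      by (intro DERIV_add DERIV_mult DERIV_ident DERIV_divide J0J0 J1J1 J0J1 den) (use y0 in simp)
    also have "(1 * ((J0 y)\<^sup>2 + (J0' y)\<^sup>2) + (2 * J0 y * J0' y + 2 * J0' y * J0'' y) * y)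
        + (J0' y * J0' y + J0'' y * J0 y)
        + (2 * J0 y * J0' y * (2 * y) - (J0 y)\<^sup>2 * 2) / ((2 * y) * (2 * y))
        = - ((J0 y)\<^sup>2 / (2 * y\<^sup>2))"
      using y0 by (simp add: J field_simps power2_eq_square)
    finally have "(E has_real_derivative - ((J0 y)\<^sup>2 / (2 * y\<^sup>2))) (at y)" .
    then show "\<exists>z. (E has_real_derivative z) (at y) \<and> z \<le> 0"
      by (intro exI conjI) auto
  qed
  moreover have "x * (J0 x)\<^sup>2 \<le> E x"
  proof -
    have x0: "x > 0" using a x by linarith
    have "E x - x * (J0 x)\<^sup>2 = (x * J0' x + J0 x / 2)\<^sup>2 / x + (J0 x)\<^sup>2 / (4 * x)"
      using x0 by (simp add: E_def field_simps power2_eq_square)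
    also have "\<dots> \<ge> 0" using x0 by simp
    finally show ?thesis by simp
  qed
  ultimately show ?thesis by (simp add: E_def)
qed

section \<open>The Gaussian measure on the complex plane\<close>

definition gauss :: "complex measure" where
  "gauss = distr (std_normal_distribution \<Otimes>\<^sub>M std_normal_distribution) borel (\<lambda>(x, y). Complex x y)"

lemma Complex_measurable [measurable]: "(\<lambda>(x, y). Complex x y) \<in> borel_measurable (borel \<Otimes>\<^sub>M borel)"
proof -
  have "continuous_on UNIV (\<lambda>p. Complex (fst p) (snd p))"
    unfolding complex_eq_iff by (simp add: Complex_eq) (intro continuous_intros)
  then have "(\<lambda>p. Complex (fst p) (snd p)) \<in> borel_measurable borel"
    by (rule borel_measurable_continuous_onI)
  then show ?thesis by (simp add: case_prod_unfold borel_prod)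
qed

text \<open>The complex plane carries Lebesgue measure as a Euclidean space of its own; integrals over it
  are reduced to iterated real integrals by this identification.\<close>

lemma lborel_complex: "(lborel :: complex measure) = distr (lborel \<Otimes>\<^sub>M lborel) borel (\<lambda>(x, y). Complex x y)"
proof (rule lborel_eqI)
  fix l u :: complex assume lu: "\<And>b. b \<in> Basis \<Longrightarrow> l \<bullet> b \<le> u \<bullet> b"
  have le: "Re l \<le> Re u" "Im l \<le> Im u" using lu[of 1] lu[of \<i>] by (auto simp: Basis_complex_def inner_complex_def)
  have m: "(\<lambda>(x, y). Complex x y) \<in> measurable (lborel \<Otimes>\<^sub>M lborel) borel"
    by (simp add: measurable_cong_sets[OF sets_pair_measure_cong[OF sets_lborel sets_lborel] refl])
  have "emeasure (distr (lborel \<Otimes>\<^sub>M lborel) borel (\<lambda>(x, y). Complex x y)) (box l u)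
     = emeasure (lborel \<Otimes>\<^sub>M lborel) ({Re l<..<Re u} \<times> {Im l<..<Im u})"
    by (subst emeasure_distr[OF m])
       (auto intro!: arg_cong2[where f = emeasure] simp: space_pair_measure box_def Basis_complex_def inner_complex_def)
  also have "\<dots> = ennreal (\<Prod>b\<in>Basis. (u - l) \<bullet> b)"
    using le by (subst lborel.emeasure_pair_measure_Times)
      (auto simp: Basis_complex_def inner_complex_def ennreal_mult)
  finally show "emeasure (distr (lborel \<Otimes>\<^sub>M lborel) borel (\<lambda>(x, y). Complex x y)) (box l u)
    = ennreal (\<Prod>b\<in>Basis. (u - l) \<bullet> b)" .
qed simp

lemma prob_space_gauss: "prob_space gauss"
proof -
  interpret S: prob_space std_normal_distribution
    by (rule real_distribution.axioms(1)[OF real_dist_normal_dist])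
  interpret P: pair_prob_space std_normal_distribution std_normal_distribution ..
  show ?thesis unfolding gauss_def
    by (rule P.prob_space_distr) (simp add: measurable_cong_sets[OF sets_pair_measure_cong[OF sets_density sets_density] refl])
qed

lemma sets_gauss [simp, measurable_cong]: "sets gauss = sets borel"
  by (simp add: gauss_def)

lemma space_gauss [simp]: "space gauss = UNIV" by (simp add: gauss_def)

lemma gauss_density:
  "gauss = density lborel (\<lambda>w. ennreal (exp (- (norm w)\<^sup>2 / 2) / (2 * pi)))"
proof -
  have sf: "sigma_finite_measure std_normal_distribution"
    using prob_space_imp_sigma_finite real_distribution.axioms(1)[OF real_dist_normal_dist] by blast
  have m: "(\<lambda>(x, y). Complex x y) \<in> measurable (lborel \<Otimes>\<^sub>M lborel) borel"
    by (simp add: measurable_cong_sets[OF sets_pair_measure_cong[OF sets_lborel sets_lborel] refl])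
  have "std_normal_distribution \<Otimes>\<^sub>M std_normal_distribution
     = density (lborel \<Otimes>\<^sub>M lborel) (\<lambda>(x, y). ennreal (std_normal_density x) * ennreal (std_normal_density y))"
    by (rule pair_measure_density) (auto intro: sf lborel.sigma_finite_measure_axioms)
  also have "(\<lambda>(x, y). ennreal (std_normal_density x) * ennreal (std_normal_density y))
     = (\<lambda>p. (\<lambda>w. ennreal (exp (- (norm w)\<^sup>2 / 2) / (2 * pi))) ((\<lambda>(x, y). Complex x y) p))"
  proof -
    have "std_normal_density x * std_normal_density y = exp (- (norm (Complex x y))\<^sup>2 / 2) / (2 * pi)" for x y
    proof -
      have n: "(norm (Complex x y))\<^sup>2 = x\<^sup>2 + y\<^sup>2" by (simp add: cmod_power2)
      have "exp (- (x\<^sup>2 + y\<^sup>2) / 2) = exp (- x\<^sup>2 / 2) * exp (- y\<^sup>2 / 2)"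
        by (simp add: mult_exp_exp add_divide_distrib)
      then show ?thesis unfolding std_normal_density_def n
        by (simp add: divide_simps)
    qed
    then show ?thesis by (auto simp: ennreal_mult[symmetric])
  qed
  finally show ?thesis
    unfolding gauss_def using m
    by (subst lborel_complex, subst density_distr) auto
qed

text \<open>The Gaussian is its own Fourier transform; this follows from the one-dimensional case by
  Fubini.\<close>

lemma gauss_cos: "(\<integral>w. cos (w \<bullet> u) \<partial>gauss) = exp (- (norm u)\<^sup>2 / 2)"
proof -
  interpret S: prob_space std_normal_distribution
    by (rule real_distribution.axioms(1)[OF real_dist_normal_dist])
  interpret P: pair_prob_space std_normal_distribution std_normal_distribution ..
  let ?N = std_normal_distribution
  have c: "(\<integral>x. cos (x * a) \<partial>?N) = exp (- a\<^sup>2 / 2)" and s: "(\<integral>x. sin (x * a) \<partial>?N) = 0" for a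
  proof -
    have i: "integrable ?N (\<lambda>x. cis (a * x))"
      by (rule S.integrable_const_bound[where B = 1]) (auto simp: norm_cis intro!: borel_measurable_continuous_onI continuous_intros)
    have "char ?N a = complex_of_real (exp (- a\<^sup>2 / 2))" by (simp add: char_std_normal_distribution)
    then have e: "(\<integral>x. cis (a * x) \<partial>?N) = complex_of_real (exp (- a\<^sup>2 / 2))"
      by (simp add: char_def cis_conv_exp)
    show "(\<integral>x. cos (x * a) \<partial>?N) = exp (- a\<^sup>2 / 2)"
      using integral_Re[OF i] e by (simp add: mult.commute)
    show "(\<integral>x. sin (x * a) \<partial>?N) = 0"
      using integral_Im[OF i] e by (simp add: mult.commute)
  qed
  have m: "(\<lambda>(x, y). Complex x y) \<in> measurable (?N \<Otimes>\<^sub>M ?N) borel"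
    by (simp add: measurable_cong_sets[OF sets_pair_measure_cong[OF sets_density sets_density] refl])
  have mf: "(\<lambda>w. cos (w \<bullet> u)) \<in> borel_measurable borel"
    by (intro borel_measurable_continuous_onI continuous_intros)
  have "(\<integral>w. cos (w \<bullet> u) \<partial>gauss) = (\<integral>p. cos ((\<lambda>(x, y). Complex x y) p \<bullet> u) \<partial>(?N \<Otimes>\<^sub>M ?N))"
    unfolding gauss_def by (rule integral_distr[OF m mf])
  also have "\<dots> = (\<integral>p. (\<lambda>(x, y). cos (x * Re u + y * Im u)) p \<partial>(?N \<Otimes>\<^sub>M ?N))"
    by (simp add: case_prod_unfold inner_complex_def)
  also have "\<dots> = (\<integral>x. \<integral>y. cos (x * Re u + y * Im u) \<partial>?N \<partial>?N)"
  proof (rule P.integral_fst[symmetric])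
    show "integrable (?N \<Otimes>\<^sub>M ?N) (\<lambda>(x, y). cos (x * Re u + y * Im u))"
      by (rule P.integrable_const_bound[where B = 1]) (auto simp: case_prod_unfold)
  qed
  also have "\<dots> = (\<integral>x. cos (x * Re u) * exp (- (Im u)\<^sup>2 / 2) \<partial>?N)"
  proof (rule Bochner_Integration.integral_cong[OF refl])
    fix x
    have "(\<integral>y. cos (x * Re u + y * Im u) \<partial>?N)
        = (\<integral>y. cos (x * Re u) * cos (y * Im u) - sin (x * Re u) * sin (y * Im u) \<partial>?N)"
      by (simp add: cos_add)
    also have "\<dots> = cos (x * Re u) * (\<integral>y. cos (y * Im u) \<partial>?N) - sin (x * Re u) * (\<integral>y. sin (y * Im u) \<partial>?N)"
      by (subst Bochner_Integration.integral_diff)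
         (auto intro!: integrable_mult_right S.integrable_const_bound[where B = 1])
    finally show "(\<integral>y. cos (x * Re u + y * Im u) \<partial>?N) = cos (x * Re u) * exp (- (Im u)\<^sup>2 / 2)"
      by (simp add: c s)
  qed
  also have "\<dots> = exp (- (norm u)\<^sup>2 / 2)"
    by (simp add: c cmod_power2 mult_exp_exp add_divide_distrib)
  finally show ?thesis .
qed

section \<open>Averaging over directions\<close>

definition angle :: "real measure" where
  "angle = uniform_measure lborel {0..2*pi}"

lemma sets_angle [simp, measurable_cong]: "sets angle = sets borel"
  by (simp add: angle_def)

lemma space_angle [simp]: "space angle = UNIV" by (simp add: angle_def)

lemma prob_space_angle: "prob_space angle"
  unfolding angle_def by (rule prob_space_uniform_measure) auto

lemma integral_angle:
  assumes c: "continuous_on UNIV f"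
  shows "(\<integral>\<theta>. f \<theta> \<partial>angle) = circle_mean f"
proof -
  have m: "f \<in> borel_measurable lborel" using c by (simp add: borel_measurable_continuous_onI)
  have i: "set_integrable lborel {0..2*pi} f"
    by (rule borel_integrable_atLeastAtMost') (use c continuous_on_subset in blast)
  have A: "angle = density lborel (\<lambda>x. ennreal (indicator {0..2*pi} x / (2*pi)))"
    unfolding angle_def uniform_measure_def
    using divide_ennreal[of 1 "2*pi"]
    by (intro density_cong AE_I2) (auto simp: indicator_def split: if_splits)
  have "(\<integral>\<theta>. f \<theta> \<partial>angle) = (\<integral>\<theta>. (indicator {0..2*pi} \<theta> / (2*pi)) *\<^sub>R f \<theta> \<partial>lborel)"
    unfolding A by (rule integral_density) (use m in auto)
  also have "\<dots> = (\<integral>\<theta>. (indicator {0..2*pi} \<theta> *\<^sub>R f \<theta>) / (2*pi) \<partial>lborel)"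
    by simp
  also have "\<dots> = (LINT \<theta>:{0..2*pi}|lborel. f \<theta>) / (2*pi)"
    unfolding set_lebesgue_integral_def by (rule integral_divide_zero)
  also have "\<dots> = circle_mean f"
    using set_borel_integral_eq_integral(2)[OF i] by (simp add: circle_mean_def)
  finally show ?thesis .
qed

text \<open>The integral over one period, as a function of its starting point, has derivative zero.\<close>

lemma circle_mean_shift:
  assumes c: "continuous_on UNIV f" and p: "\<And>\<theta>. f (\<theta> + 2*pi) = f \<theta>"
  shows "circle_mean (\<lambda>\<theta>. f (\<theta> + a)) = circle_mean f"
proof -
  have ci: "continuous_on S f" for S using c continuous_on_subset by blast
  have int: "f integrable_on {x..y}" for x y by (rule integrable_continuous_interval[OF ci])
  have cg: "continuous_on UNIV (\<lambda>x. f x)" using c .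
  define F where "F a = integral {a..a + 2*pi} f" for a
  have "F a = F 0" for a
  proof -
    let ?l = "min a 0 - 1" let ?u = "max a 0 + 2*pi + 1"
    have G: "((\<lambda>x. integral {?l..x} f) has_real_derivative f x) (at x)" if "?l < x" "x < ?u" for x
    proof -
      have "((\<lambda>x. integral {?l..x} f) has_real_derivative f x) (at x within {?l..?u})"
        by (rule integral_has_real_derivative[OF ci]) (use that in simp)
      then show ?thesis using at_within_Icc_at[OF that] by simp
    qed
    have Feq: "F x = integral {?l..x + 2*pi} f - integral {?l..x} f" if "?l < x" for x
    proof -
      have "integral {?l..x} f + integral {x..x + 2*pi} f = integral {?l..x + 2*pi} f"
        by (rule Henstock_Kurzweil_Integration.integral_combine[OF _ _ int]) (use that pi_ge_zero in linarith)+
      then show ?thesis by (simp add: F_def)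
    qed
    define H where "H x = integral {?l..x + 2*pi} f - integral {?l..x} f" for x
    have dH: "(H has_real_derivative 0) (at x)" if "min a 0 \<le> x" "x \<le> max a 0" for x
    proof -
      have 1: "((\<lambda>x. integral {?l..x + 2*pi} f) has_real_derivative f (x + 2*pi) * 1) (at x)"
      proof (rule DERIV_chain2[OF G])
        show "?l < x + 2*pi" "x + 2*pi < ?u" using that pi_gt_zero by linarith+
        show "((\<lambda>x. x + 2*pi) has_real_derivative 1) (at x)"
          by (auto intro!: derivative_eq_intros)
      qed
      have 2: "((\<lambda>x. integral {?l..x} f) has_real_derivative f x) (at x)"
        by (rule G) (use that pi_gt_zero in linarith)+
      show ?thesis unfolding H_def using DERIV_diff[OF 1 2] p by simp
    qed
    have "\<exists>c. \<forall>x\<in>{min a 0..max a 0}. H x = c"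
      by (rule has_field_derivative_zero_constant)
         (use dH in \<open>auto intro: has_field_derivative_at_within\<close>)
    then have "H a = H 0" by (metis atLeastAtMost_iff max.cobounded1 max.cobounded2 min.cobounded1 min.cobounded2)
    then show ?thesis using Feq[of a] Feq[of 0] by (simp add: H_def)
  qed
  moreover have "integral {0..2*pi} (\<lambda>\<theta>. f (\<theta> + a)) = F a"
  proof -
    have "integral {0..2*pi} (\<lambda>\<theta>. f (\<theta> + a)) = integral {0 + a..2*pi + a} f"
      using integral_shift[OF ci, of 0 "2*pi" a] by (simp add: o_def)
    then show ?thesis by (simp add: F_def add.commute)
  qed
  ultimately show ?thesis by (simp add: circle_mean_def F_def)
qed

lemma inner_cis: "w \<bullet> (complex_of_real r * cis \<theta>) = r * norm w * cos (\<theta> - Arg w)"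
proof -
  have "w = complex_of_real (norm w) * cis (Arg w)"
    by (cases "w = 0") (simp_all add: cis_Arg sgn_eq)
  then have "Re w = norm w * cos (Arg w)" "Im w = norm w * sin (Arg w)"
    by (metis Re_rcis rcis_def, metis Im_rcis rcis_def)
  then show ?thesis by (simp add: inner_complex_def cos_diff algebra_simps)
qed

text \<open>The mean of a plane wave over a circle is a value of \<open>J0\<close>. This is where the
  Bessel function enters.\<close>

lemma angle_mean_cos:
  "(\<integral>\<theta>. cos (w \<bullet> (complex_of_real r * cis \<theta>)) \<partial>angle) = J0 (r * norm w)"
proof -
  have "(\<integral>\<theta>. cos (w \<bullet> (complex_of_real r * cis \<theta>)) \<partial>angle)
     = circle_mean (\<lambda>\<theta>. cos (r * norm w * cos (\<theta> + - Arg w)))"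
    by (simp add: inner_cis) (rule integral_angle, intro continuous_intros)
  also have "\<dots> = J0 (r * norm w)"
    unfolding J0_def by (rule circle_mean_shift) (auto intro!: continuous_intros)
  finally show ?thesis .
qed

lemma Fubini_bounded:
  fixes f :: "'a \<Rightarrow> 'b \<Rightarrow> real"
  assumes M: "finite_measure M" and N: "finite_measure N"
    and m: "(\<lambda>(x, y). f x y) \<in> borel_measurable (M \<Otimes>\<^sub>M N)" and b: "\<And>x y. \<bar>f x y\<bar> \<le> B"
  shows "(\<integral>x. \<integral>y. f x y \<partial>N \<partial>M) = (\<integral>y. \<integral>x. f x y \<partial>M \<partial>N)"
proof -
  interpret M: finite_measure M by fact
  interpret N: finite_measure N by fact
  interpret P: pair_sigma_finite M N ..
  have "finite_measure (M \<Otimes>\<^sub>M N)" by (rule finite_measure_pair_measure[OF N M])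
  then interpret MN: finite_measure "M \<Otimes>\<^sub>M N" .
  have "integrable (M \<Otimes>\<^sub>M N) (\<lambda>(x, y). f x y)"
    by (rule MN.integrable_const_bound[where B = B]) (use m b in auto)
  then show ?thesis by (rule P.Fubini_integral[symmetric])
qed

section \<open>Positive definiteness of autocorrelations\<close>

definition corr :: "(complex \<Rightarrow> real) \<Rightarrow> complex \<Rightarrow> real" where
  "corr h z = (\<integral>x. h x * h (x + z) \<partial>lborel)"

text \<open>A bounded measurable function with bounded support. Integrals against it are taken with
  respect to Lebesgue measure on a ball, which is finite, so that bounded integrands are integrable and
  Fubini applies without further conditions.\<close>

locale test_function =
  fixes h :: "complex \<Rightarrow> real" and \<rho> :: real
  assumes h_measurable [measurable]: "h \<in> borel_measurable borel"
    and h_bound: "\<bar>h x\<bar> \<le> 1"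
    and h_support: "norm x > \<rho> \<Longrightarrow> h x = 0"
begin

definition N :: "complex measure" where
  "N = density lborel (\<lambda>x. ennreal (indicator (cball 0 \<rho>) x))"

lemma cball_borel [measurable]: "cball (0::complex) \<rho> \<in> sets borel" by simp

lemma sets_N [simp, measurable_cong]: "sets N = sets borel" by (simp add: N_def)

lemma finite_N: "finite_measure N"
proof
  have "emeasure N (space N) = emeasure lborel (cball (0::complex) \<rho>)"
    unfolding N_def by (subst emeasure_density) (auto simp: ennreal_indicator)
  then show "emeasure N (space N) \<noteq> \<infinity>"
    using emeasure_lborel_cball_finite[of "0::complex" \<rho>] by (metis less_irrefl)
qed

sublocale N: finite_measure N by (rule finite_N)
sublocale gauss: prob_space gauss by (rule prob_space_gauss)
sublocale angle: prob_space angle by (rule prob_space_angle)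

lemma integral_N:
  assumes [measurable]: "f \<in> borel_measurable borel"
  shows "(\<integral>x. h x * f x \<partial>lborel) = (\<integral>x. h x * f x \<partial>N)"
proof -
  have "(\<integral>x. h x * f x \<partial>N) = (\<integral>x. indicator (cball 0 \<rho>) x *\<^sub>R (h x * f x) \<partial>lborel)"
    unfolding N_def by (rule integral_density) auto
  also have "(\<lambda>x. indicator (cball 0 \<rho>) x *\<^sub>R (h x * f x)) = (\<lambda>x. h x * f x)"
    using h_support by (fastforce simp: indicator_def)
  finally show ?thesis by simp
qed

lemma integrable_N:
  assumes [measurable]: "f \<in> borel_measurable borel" and b: "\<And>x. \<bar>f x\<bar> \<le> B"
  shows "integrable N (\<lambda>x. h x * f x)"
proof (rule N.integrable_const_bound[where B = B])
  have "\<bar>h x\<bar> * \<bar>f x\<bar> \<le> 1 * B" for x using h_bound b by (intro mult_mono) auto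
  then show "AE x in N. norm (h x * f x) \<le> B" by (simp add: abs_mult)
qed simp

lemma integral_N_bound:
  assumes b: "\<And>x. \<bar>f x\<bar> \<le> B" and [measurable]: "f \<in> borel_measurable borel"
  shows "\<bar>\<integral>x. h x * f x \<partial>N\<bar> \<le> B * measure N UNIV"
proof -
  have "\<bar>h x * f x\<bar> \<le> B" for x
    using mult_mono[OF h_bound[of x] b[of x]] by (simp add: abs_mult)
  then have "norm (\<integral>x. h x * f x \<partial>N) \<le> (\<integral>x. B \<partial>N)"
    by (intro Bochner_Integration.integral_norm_bound_integral integrable_N[where B = B]) (use b in auto)
  then show ?thesis by (simp add: N_def mult.commute)
qed

definition cos_transform :: "complex \<Rightarrow> real" where "cos_transform \<eta> = (\<integral>x. h x * cos (x \<bullet> \<eta>) \<partial>N)"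
definition sin_transform :: "complex \<Rightarrow> real" where "sin_transform \<eta> = (\<integral>x. h x * sin (x \<bullet> \<eta>) \<partial>N)"

lemma cos_transform_measurable [measurable]: "cos_transform \<in> borel_measurable borel"
  and sin_transform_measurable [measurable]: "sin_transform \<in> borel_measurable borel"
  unfolding cos_transform_def[abs_def] sin_transform_def[abs_def] by measurable

lemma cos_transform_bound: "\<bar>cos_transform \<eta>\<bar> \<le> measure N UNIV" and sin_transform_bound: "\<bar>sin_transform \<eta>\<bar> \<le> measure N UNIV"
  unfolding cos_transform_def sin_transform_def
  by (rule order_trans[OF integral_N_bound[where B = 1]]; simp)+

lemma cos_transform_shift: "(\<integral>x. h x * cos (x \<bullet> \<eta> + b) \<partial>N) = cos b * cos_transform \<eta> - sin b * sin_transform \<eta>"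
proof -
  have "(\<integral>x. h x * cos (x \<bullet> \<eta> + b) \<partial>N)
      = (\<integral>x. cos b * (h x * cos (x \<bullet> \<eta>)) - sin b * (h x * sin (x \<bullet> \<eta>)) \<partial>N)"
    by (simp add: cos_add algebra_simps)
  also have "\<dots> = cos b * cos_transform \<eta> - sin b * sin_transform \<eta>"
    unfolding cos_transform_def sin_transform_def
    by (subst Bochner_Integration.integral_diff)
       (auto intro!: integrable_mult_right integrable_N[where B = 1])
  finally show ?thesis .
qed

lemma sin_transform_shift: "(\<integral>x. h x * sin (x \<bullet> \<eta> + b) \<partial>N) = cos b * sin_transform \<eta> + sin b * cos_transform \<eta>"
proof -
  have "(\<integral>x. h x * sin (x \<bullet> \<eta> + b) \<partial>N)
      = (\<integral>x. cos b * (h x * sin (x \<bullet> \<eta>)) + sin b * (h x * cos (x \<bullet> \<eta>)) \<partial>N)"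
    by (simp add: sin_add algebra_simps)
  also have "\<dots> = cos b * sin_transform \<eta> + sin b * cos_transform \<eta>"
    unfolding cos_transform_def sin_transform_def
    by (subst Bochner_Integration.integral_add)
       (auto intro!: integrable_mult_right integrable_N[where B = 1])
  finally show ?thesis .
qed

lemma corr_N: "corr h z = (\<integral>x. h x * h (x + z) \<partial>N)"
  unfolding corr_def by (rule integral_N) simp

lemma corr_measurable [measurable]: "corr h \<in> borel_measurable borel"
  unfolding corr_N[abs_def] by measurable

lemma corr_bound: "\<bar>corr h z\<bar> \<le> measure N UNIV"
  unfolding corr_N by (rule order_trans[OF integral_N_bound[where B = 1]]) (use h_bound in auto)

text \<open>Smoothing by a Gaussian of width \<open>\<sigma>\<close>, with the Gaussian kernel replaced
  by the Fourier integral that represents it.\<close>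

lemma gauss_convolution:
  assumes \<sigma>: "\<sigma> > 0"
  shows "(\<integral>w. h (a + \<sigma> *\<^sub>R w) \<partial>gauss)
    = (\<integral>y. h y * (\<integral>\<xi>. cos (\<xi> \<bullet> ((1/\<sigma>) *\<^sub>R (y - a))) \<partial>gauss) \<partial>N) / (2 * pi * \<sigma>\<^sup>2)"
proof -
  define k where "k y = h y * (exp (- (norm ((1/\<sigma>) *\<^sub>R (y - a)))\<^sup>2 / 2) / (2 * pi))" for y
  have [measurable]: "k \<in> borel_measurable borel" unfolding k_def[abs_def] by measurable
  have "(\<integral>y. k y \<partial>lborel) = (\<integral>y. k y \<partial>density (distr lborel borel (\<lambda>x. a + \<sigma> *\<^sub>R x)) (\<lambda>_. \<bar>\<sigma>\<bar>^DIM(complex)))"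
    using lborel_affine[of \<sigma> a] \<sigma> by simp
  also have "\<dots> = (\<integral>y. (\<bar>\<sigma>\<bar>^DIM(complex)) *\<^sub>R k y \<partial>distr lborel borel (\<lambda>x. a + \<sigma> *\<^sub>R x))"
    by (rule integral_density) auto
  also have "\<dots> = (\<integral>w. (\<bar>\<sigma>\<bar>^DIM(complex)) *\<^sub>R k (a + \<sigma> *\<^sub>R w) \<partial>lborel)"
    by (rule integral_distr) auto
  also have "\<dots> = \<sigma>\<^sup>2 * (\<integral>w. k (a + \<sigma> *\<^sub>R w) \<partial>lborel)" by simp
  also have "(\<integral>w. k (a + \<sigma> *\<^sub>R w) \<partial>lborel)
     = (\<integral>w. (exp (- (norm w)\<^sup>2 / 2) / (2 * pi)) *\<^sub>R h (a + \<sigma> *\<^sub>R w) \<partial>lborel)"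
    using \<sigma> by (simp add: k_def mult.commute)
  also have "\<dots> = (\<integral>w. h (a + \<sigma> *\<^sub>R w) \<partial>gauss)"
    unfolding gauss_density by (rule integral_density[symmetric]) auto
  finally have 1: "(\<integral>w. h (a + \<sigma> *\<^sub>R w) \<partial>gauss) = (\<integral>y. k y \<partial>lborel) / \<sigma>\<^sup>2"
    using \<sigma> by simp
  have "(\<integral>y. k y \<partial>lborel) = (\<integral>y. k y \<partial>N)"
    unfolding k_def by (rule integral_N) measurable
  also have "\<dots> = (\<integral>y. (h y * exp (- (norm ((1/\<sigma>) *\<^sub>R (y - a)))\<^sup>2 / 2)) / (2 * pi) \<partial>N)"
    by (simp add: k_def)
  also have "\<dots> = (\<integral>y. h y * exp (- (norm ((1/\<sigma>) *\<^sub>R (y - a)))\<^sup>2 / 2) \<partial>N) / (2 * pi)"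
    by (rule integral_divide_zero)
  finally show ?thesis unfolding 1 gauss_cos by simp
qed

text \<open>The smoothed autocorrelation is a superposition of plane waves with the nonnegative weights
  \<open>|h^|\<^sup>2\<close>, where \<open>h^\<close> is the Fourier transform of \<open>h\<close>,
  split into its cosine and sine parts. The Gaussian makes the frequency integral converge.\<close>

lemma smoothed_corr:
  assumes \<sigma>: "\<sigma> > 0"
  shows "(\<integral>w. corr h (z + \<sigma> *\<^sub>R w) \<partial>gauss)
    = (\<integral>\<xi>. cos (\<xi> \<bullet> z / \<sigma>) * ((cos_transform ((1/\<sigma>) *\<^sub>R \<xi>))\<^sup>2 + (sin_transform ((1/\<sigma>) *\<^sub>R \<xi>))\<^sup>2) \<partial>gauss) / (2 * pi * \<sigma>\<^sup>2)"
proof -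
  let ?m = "measure N UNIV"
  have m0: "?m \<ge> 0" by simp
  have prod_bound: "\<bar>u * v\<bar> \<le> B" if "\<bar>u\<bar> \<le> 1" "\<bar>v\<bar> \<le> B" for u v B :: real
    using mult_mono[OF that] by (simp add: abs_mult)
  have "(\<integral>w. corr h (z + \<sigma> *\<^sub>R w) \<partial>gauss) = (\<integral>w. \<integral>x. h x * h (x + (z + \<sigma> *\<^sub>R w)) \<partial>N \<partial>gauss)"
    by (simp add: corr_N)
  also have "\<dots> = (\<integral>x. \<integral>w. h x * h (x + (z + \<sigma> *\<^sub>R w)) \<partial>gauss \<partial>N)"
    by (rule Fubini_bounded[OF gauss.finite_measure_axioms finite_N, where B = 1])
       (measurable, intro prod_bound h_bound)
  also have "\<dots> = (\<integral>x. h x * (\<integral>w. h ((x + z) + \<sigma> *\<^sub>R w) \<partial>gauss) \<partial>N)"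
    by (simp add: add.assoc)
  also have "\<dots> = (\<integral>x. (h x * (\<integral>y. \<integral>\<xi>. h y * cos (\<xi> \<bullet> ((1/\<sigma>) *\<^sub>R (y - (x + z)))) \<partial>gauss \<partial>N)) / (2 * pi * \<sigma>\<^sup>2) \<partial>N)"
    by (simp add: gauss_convolution[OF \<sigma>])
  also have "\<dots> = (\<integral>x. h x * (\<integral>y. \<integral>\<xi>. h y * cos (\<xi> \<bullet> ((1/\<sigma>) *\<^sub>R (y - (x + z)))) \<partial>gauss \<partial>N) \<partial>N) / (2 * pi * \<sigma>\<^sup>2)"
    by (rule integral_divide_zero)
  also have "(\<integral>x. h x * (\<integral>y. \<integral>\<xi>. h y * cos (\<xi> \<bullet> ((1/\<sigma>) *\<^sub>R (y - (x + z)))) \<partial>gauss \<partial>N) \<partial>N)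
     = (\<integral>x. \<integral>\<xi>. h x * (\<integral>y. h y * cos (\<xi> \<bullet> ((1/\<sigma>) *\<^sub>R (y - (x + z)))) \<partial>N) \<partial>gauss \<partial>N)"
  proof (rule Bochner_Integration.integral_cong[OF refl])
    fix x
    have "(\<integral>y. \<integral>\<xi>. h y * cos (\<xi> \<bullet> ((1/\<sigma>) *\<^sub>R (y - (x + z)))) \<partial>gauss \<partial>N)
        = (\<integral>\<xi>. \<integral>y. h y * cos (\<xi> \<bullet> ((1/\<sigma>) *\<^sub>R (y - (x + z)))) \<partial>N \<partial>gauss)"
      by (rule Fubini_bounded[OF finite_N gauss.finite_measure_axioms, where B = 1])
         (measurable, intro prod_bound h_bound abs_cos_le_one)
    then show "h x * (\<integral>y. \<integral>\<xi>. h y * cos (\<xi> \<bullet> ((1/\<sigma>) *\<^sub>R (y - (x + z)))) \<partial>gauss \<partial>N)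
       = (\<integral>\<xi>. h x * (\<integral>y. h y * cos (\<xi> \<bullet> ((1/\<sigma>) *\<^sub>R (y - (x + z)))) \<partial>N) \<partial>gauss)"
      by simp
  qed
  also have "\<dots> = (\<integral>\<xi>. \<integral>x. h x * (\<integral>y. h y * cos (\<xi> \<bullet> ((1/\<sigma>) *\<^sub>R (y - (x + z)))) \<partial>N) \<partial>N \<partial>gauss)"
  proof (rule Fubini_bounded[OF finite_N gauss.finite_measure_axioms, where B = ?m])
    show "(\<lambda>(x, \<xi>). h x * (\<integral>y. h y * cos (\<xi> \<bullet> ((1/\<sigma>) *\<^sub>R (y - (x + z)))) \<partial>N)) \<in> borel_measurable (N \<Otimes>\<^sub>M gauss)"
      by measurable
    show "\<bar>h x * (\<integral>y. h y * cos (\<xi> \<bullet> ((1/\<sigma>) *\<^sub>R (y - (x + z)))) \<partial>N)\<bar> \<le> ?m" for x \<xi>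
      by (intro prod_bound h_bound order_trans[OF integral_N_bound[where B = 1]]) auto
  qed
  also have "\<dots> = (\<integral>\<xi>. cos (\<xi> \<bullet> z / \<sigma>) * ((cos_transform ((1/\<sigma>) *\<^sub>R \<xi>))\<^sup>2 + (sin_transform ((1/\<sigma>) *\<^sub>R \<xi>))\<^sup>2) \<partial>gauss)"
  proof (rule Bochner_Integration.integral_cong[OF refl])
    fix \<xi> :: complex
    define \<eta> where "\<eta> = (1/\<sigma>) *\<^sub>R \<xi>"
    have e: "\<xi> \<bullet> ((1/\<sigma>) *\<^sub>R (y - (x + z))) = y \<bullet> \<eta> + - (x \<bullet> \<eta> + z \<bullet> \<eta>)" for x y
      by (simp add: \<eta>_def inner_commute algebra_simps inner_diff_right)
    have "(\<integral>x. h x * (\<integral>y. h y * cos (\<xi> \<bullet> ((1/\<sigma>) *\<^sub>R (y - (x + z)))) \<partial>N) \<partial>N)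
      = (\<integral>x. cos_transform \<eta> * (h x * cos (x \<bullet> \<eta> + z \<bullet> \<eta>)) + sin_transform \<eta> * (h x * sin (x \<bullet> \<eta> + z \<bullet> \<eta>)) \<partial>N)"
      unfolding e cos_transform_shift cos_minus sin_minus by (simp add: algebra_simps)
    also have "\<dots> = cos_transform \<eta> * (\<integral>x. h x * cos (x \<bullet> \<eta> + z \<bullet> \<eta>) \<partial>N) + sin_transform \<eta> * (\<integral>x. h x * sin (x \<bullet> \<eta> + z \<bullet> \<eta>) \<partial>N)"
      by (subst Bochner_Integration.integral_add)
         (auto intro!: integrable_mult_right integrable_N[where B = 1])
    also have "\<dots> = cos (z \<bullet> \<eta>) * ((cos_transform \<eta>)\<^sup>2 + (sin_transform \<eta>)\<^sup>2)"
      unfolding cos_transform_shift sin_transform_shift by (simp add: algebra_simps power2_eq_square)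
    also have "z \<bullet> \<eta> = \<xi> \<bullet> z / \<sigma>" by (simp add: \<eta>_def inner_commute)
    finally show "(\<integral>x. h x * (\<integral>y. h y * cos (\<xi> \<bullet> ((1/\<sigma>) *\<^sub>R (y - (x + z)))) \<partial>N) \<partial>N)
       = cos (\<xi> \<bullet> z / \<sigma>) * ((cos_transform ((1/\<sigma>) *\<^sub>R \<xi>))\<^sup>2 + (sin_transform ((1/\<sigma>) *\<^sub>R \<xi>))\<^sup>2)"
      by (simp add: \<eta>_def)
  qed
  finally show ?thesis .
qed


text \<open>After smoothing, the combination of circle means is the integral of
  \<open>|h^|\<^sup>2\<close> times the given combination of Bessel functions, hence nonnegative.
  Continuity of the autocorrelation allows the width of the smoothing to tend to 0.\<close>

lemma positive_definite_circle_means: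
  fixes a r :: "'i \<Rightarrow> real"
  assumes fin: "finite I"
    and cont: "continuous_on UNIV (corr h)"
    and W: "\<And>t. t \<ge> 0 \<Longrightarrow> 0 \<le> (\<Sum>i\<in>I. a i * J0 (r i * t))"
  shows "0 \<le> (\<Sum>i\<in>I. a i * (\<integral>\<theta>. corr h (complex_of_real (r i) * cis \<theta>) \<partial>angle))"
proof -
  let ?m = "measure N UNIV"
  define A where "A \<sigma> \<rho> = (\<integral>\<theta>. \<integral>w. corr h (complex_of_real \<rho> * cis \<theta> + \<sigma> *\<^sub>R w) \<partial>gauss \<partial>angle)" for \<sigma> \<rho>
  define E where "E \<sigma> \<xi> = (cos_transform ((1/\<sigma>) *\<^sub>R \<xi>))\<^sup>2 + (sin_transform ((1/\<sigma>) *\<^sub>R \<xi>))\<^sup>2" for \<sigma> \<xi>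
  have E_meas [measurable]: "E \<sigma> \<in> borel_measurable borel" for \<sigma> unfolding E_def[abs_def] by measurable
  have E0: "0 \<le> E \<sigma> \<xi>" and E1: "E \<sigma> \<xi> \<le> 2 * ?m\<^sup>2" for \<sigma> \<xi>
  proof -
    show "0 \<le> E \<sigma> \<xi>" by (simp add: E_def)
    have "(cos_transform x)\<^sup>2 \<le> ?m\<^sup>2" "(sin_transform x)\<^sup>2 \<le> ?m\<^sup>2" for x
      using power_mono[OF cos_transform_bound[of x], of 2] power_mono[OF sin_transform_bound[of x], of 2] by simp_all
    then show "E \<sigma> \<xi> \<le> 2 * ?m\<^sup>2" unfolding E_def by (smt (verit))
  qed
  have cis_meas [measurable]: "cis \<in> borel_measurable borel"
    by (intro borel_measurable_continuous_onI continuous_intros)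
  have A_eq: "A \<sigma> \<rho> = (\<integral>\<xi>. J0 (\<rho> * norm ((1/\<sigma>) *\<^sub>R \<xi>)) * E \<sigma> \<xi> \<partial>gauss) / (2 * pi * \<sigma>\<^sup>2)" if \<sigma>: "\<sigma> > 0" for \<sigma> \<rho>
  proof -
    have "A \<sigma> \<rho> = (\<integral>\<theta>. (\<integral>\<xi>. cos (\<xi> \<bullet> (complex_of_real \<rho> * cis \<theta>) / \<sigma>) * E \<sigma> \<xi> \<partial>gauss) / (2 * pi * \<sigma>\<^sup>2) \<partial>angle)"
      unfolding A_def E_def smoothed_corr[OF \<sigma>] ..
    also have "\<dots> = (\<integral>\<theta>. \<integral>\<xi>. cos (\<xi> \<bullet> (complex_of_real \<rho> * cis \<theta>) / \<sigma>) * E \<sigma> \<xi> \<partial>gauss \<partial>angle) / (2 * pi * \<sigma>\<^sup>2)"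
      by (rule integral_divide_zero)
    also have "(\<integral>\<theta>. \<integral>\<xi>. cos (\<xi> \<bullet> (complex_of_real \<rho> * cis \<theta>) / \<sigma>) * E \<sigma> \<xi> \<partial>gauss \<partial>angle)
       = (\<integral>\<xi>. \<integral>\<theta>. cos (\<xi> \<bullet> (complex_of_real \<rho> * cis \<theta>) / \<sigma>) * E \<sigma> \<xi> \<partial>angle \<partial>gauss)"
    proof (rule Fubini_bounded[OF angle.finite_measure_axioms gauss.finite_measure_axioms, where B = "1 * (2 * ?m\<^sup>2)"])
      show "\<bar>cos (\<xi> \<bullet> (complex_of_real \<rho> * cis \<theta>) / \<sigma>) * E \<sigma> \<xi>\<bar> \<le> 1 * (2 * ?m\<^sup>2)" for \<theta> \<xi>
        unfolding abs_mult by (rule mult_mono) (use E0 E1 in auto)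
    qed measurable
    also have "\<dots> = (\<integral>\<xi>. J0 (\<rho> * norm ((1/\<sigma>) *\<^sub>R \<xi>)) * E \<sigma> \<xi> \<partial>gauss)"
    proof (rule Bochner_Integration.integral_cong[OF refl])
      fix \<xi> :: complex
      have "(\<integral>\<theta>. cos (\<xi> \<bullet> (complex_of_real \<rho> * cis \<theta>) / \<sigma>) * E \<sigma> \<xi> \<partial>angle)
         = (\<integral>\<theta>. cos (((1/\<sigma>) *\<^sub>R \<xi>) \<bullet> (complex_of_real \<rho> * cis \<theta>)) \<partial>angle) * E \<sigma> \<xi>"
        by simp
      then show "(\<integral>\<theta>. cos (\<xi> \<bullet> (complex_of_real \<rho> * cis \<theta>) / \<sigma>) * E \<sigma> \<xi> \<partial>angle)
         = J0 (\<rho> * norm ((1/\<sigma>) *\<^sub>R \<xi>)) * E \<sigma> \<xi>"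
        unfolding angle_mean_cos .
    qed
    finally show ?thesis .
  qed
  have J0_meas [measurable]: "J0 \<in> borel_measurable borel"
    by (intro borel_measurable_continuous_onI DERIV_continuous_on[OF DERIV_subset[OF J0_deriv]]) auto
  have J0_le: "\<bar>J0 x\<bar> \<le> 1" for x
  proof -
    have "\<bar>circle_mean (\<lambda>\<theta>. cos (x * cos \<theta>))\<bar> \<le> circle_mean (\<lambda>_. 1)"
      by (rule circle_mean_abs_le) (auto intro!: continuous_intros)
    then show ?thesis by (simp add: J0_def)
  qed
  have pos: "0 \<le> (\<Sum>i\<in>I. a i * A \<sigma> (r i))" if \<sigma>: "\<sigma> > 0" for \<sigma>
  proof -
    have int: "integrable gauss (\<lambda>\<xi>. a i * (J0 (r i * norm ((1/\<sigma>) *\<^sub>R \<xi>)) * E \<sigma> \<xi>))" for i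
    proof (rule integrable_mult_right, rule gauss.integrable_const_bound[where B = "1 * (2 * ?m\<^sup>2)"])
      show "AE \<xi> in gauss. norm (J0 (r i * norm ((1/\<sigma>) *\<^sub>R \<xi>)) * E \<sigma> \<xi>) \<le> 1 * (2 * ?m\<^sup>2)"
        unfolding real_norm_def abs_mult by (intro AE_I2 mult_mono J0_le) (use E0 E1 in auto)
    qed measurable
    have "(\<Sum>i\<in>I. a i * A \<sigma> (r i))
       = (\<Sum>i\<in>I. \<integral>\<xi>. a i * (J0 (r i * norm ((1/\<sigma>) *\<^sub>R \<xi>)) * E \<sigma> \<xi>) \<partial>gauss) / (2 * pi * \<sigma>\<^sup>2)"
      unfolding A_eq[OF \<sigma>] by (simp add: sum_divide_distrib)
    also have "(\<Sum>i\<in>I. \<integral>\<xi>. a i * (J0 (r i * norm ((1/\<sigma>) *\<^sub>R \<xi>)) * E \<sigma> \<xi>) \<partial>gauss)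
       = (\<integral>\<xi>. (\<Sum>i\<in>I. a i * (J0 (r i * norm ((1/\<sigma>) *\<^sub>R \<xi>)) * E \<sigma> \<xi>)) \<partial>gauss)"
      by (rule Bochner_Integration.integral_sum[symmetric, OF int])
    also have "\<dots> = (\<integral>\<xi>. (\<Sum>i\<in>I. a i * J0 (r i * norm ((1/\<sigma>) *\<^sub>R \<xi>))) * E \<sigma> \<xi> \<partial>gauss)"
      by (simp add: sum_distrib_right mult.assoc)
    finally have "(\<Sum>i\<in>I. a i * A \<sigma> (r i))
       = (\<integral>\<xi>. (\<Sum>i\<in>I. a i * J0 (r i * norm ((1/\<sigma>) *\<^sub>R \<xi>))) * E \<sigma> \<xi> \<partial>gauss) / (2 * pi * \<sigma>\<^sup>2)" .
    moreover have "0 \<le> (\<integral>\<xi>. (\<Sum>i\<in>I. a i * J0 (r i * norm ((1/\<sigma>) *\<^sub>R \<xi>))) * E \<sigma> \<xi> \<partial>gauss)"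
      by (intro Bochner_Integration.integral_nonneg mult_nonneg_nonneg W E0) simp
    ultimately show ?thesis by simp
  qed
  define s where "s n = 1 / real (Suc n)" for n
  have s0: "s n > 0" for n by (simp add: s_def)
  have slim: "s \<longlonglongrightarrow> 0" unfolding s_def[abs_def] by (rule LIMSEQ_Suc[OF lim_1_over_n])
  have lim: "(\<lambda>n. A (s n) \<rho>) \<longlonglongrightarrow> (\<integral>\<theta>. corr h (complex_of_real \<rho> * cis \<theta>) \<partial>angle)" for \<rho>
    unfolding A_def
  proof (rule integral_dominated_convergence[where w = "\<lambda>_. ?m"])
    show "AE \<theta> in angle. (\<lambda>n. \<integral>w. corr h (complex_of_real \<rho> * cis \<theta> + s n *\<^sub>R w) \<partial>gauss)
        \<longlonglongrightarrow> corr h (complex_of_real \<rho> * cis \<theta>)"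
    proof (rule AE_I2)
      fix \<theta>
      have "(\<lambda>n. \<integral>w. corr h (complex_of_real \<rho> * cis \<theta> + s n *\<^sub>R w) \<partial>gauss)
        \<longlonglongrightarrow> (\<integral>w. corr h (complex_of_real \<rho> * cis \<theta>) \<partial>gauss)"
      proof (rule integral_dominated_convergence[where w = "\<lambda>_. ?m"])
        show "AE w in gauss. (\<lambda>n. corr h (complex_of_real \<rho> * cis \<theta> + s n *\<^sub>R w)) \<longlonglongrightarrow> corr h (complex_of_real \<rho> * cis \<theta>)"
        proof (rule AE_I2)
          fix w :: complex
          have "(\<lambda>n. complex_of_real \<rho> * cis \<theta> + s n *\<^sub>R w) \<longlonglongrightarrow> complex_of_real \<rho> * cis \<theta> + 0 *\<^sub>R w"
            by (intro tendsto_intros slim)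
          then show "(\<lambda>n. corr h (complex_of_real \<rho> * cis \<theta> + s n *\<^sub>R w)) \<longlonglongrightarrow> corr h (complex_of_real \<rho> * cis \<theta>)"
            using continuous_on_tendsto_compose[OF cont, of _ "complex_of_real \<rho> * cis \<theta>" sequentially] by simp
        qed
      qed (use corr_bound in auto)
      then show "(\<lambda>n. \<integral>w. corr h (complex_of_real \<rho> * cis \<theta> + s n *\<^sub>R w) \<partial>gauss)
        \<longlonglongrightarrow> corr h (complex_of_real \<rho> * cis \<theta>)" by (simp add: gauss.prob_space[simplified])
    qed
    show "AE \<theta> in angle. norm (\<integral>w. corr h (complex_of_real \<rho> * cis \<theta> + s n *\<^sub>R w) \<partial>gauss) \<le> ?m" for n
    proof (rule AE_I2)
      fix \<theta>
      have "norm (\<integral>w. corr h (complex_of_real \<rho> * cis \<theta> + s n *\<^sub>R w) \<partial>gauss) \<le> (\<integral>w. ?m \<partial>gauss)"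
        by (intro Bochner_Integration.integral_norm_bound_integral gauss.integrable_const_bound[where B = ?m])
           (use corr_bound in auto)
      then show "norm (\<integral>w. corr h (complex_of_real \<rho> * cis \<theta> + s n *\<^sub>R w) \<partial>gauss) \<le> ?m"
        by (simp add: gauss.prob_space[simplified])
    qed
  qed (auto intro: angle.integrable_const)
  have "(\<lambda>n. \<Sum>i\<in>I. a i * A (s n) (r i)) \<longlonglongrightarrow> (\<Sum>i\<in>I. a i * (\<integral>\<theta>. corr h (complex_of_real (r i) * cis \<theta>) \<partial>angle))"
    by (intro tendsto_intros lim)
  then show ?thesis by (rule LIMSEQ_le_const) (use pos s0 in blast)
qed

end

section \<open>Polynomials that nearly solve the Bessel equation\<close>

fun coeffs_eval :: "int list \<Rightarrow> real \<Rightarrow> real" where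
  "coeffs_eval [] s = 0"
| "coeffs_eval (a # p) s = of_int a + s * coeffs_eval p s"

fun coeffs_add :: "int list \<Rightarrow> int list \<Rightarrow> int list" where
  "coeffs_add [] q = q"
| "coeffs_add (a # p) [] = a # p"
| "coeffs_add (a # p) (b # q) = (a + b) # coeffs_add p q"

fun coeffs_deriv :: "int list \<Rightarrow> int list" where
  "coeffs_deriv [] = []"
| "coeffs_deriv (a # p) = coeffs_add p (0 # coeffs_deriv p)"

fun coeffs_scale :: "int \<Rightarrow> int list \<Rightarrow> int list" where
  "coeffs_scale c [] = []"
| "coeffs_scale c (a # p) = (c * a) # coeffs_scale c p"

lemma coeffs_eval_add: "coeffs_eval (coeffs_add p q) s = coeffs_eval p s + coeffs_eval q s"
  by (induction p q rule: coeffs_add.induct) (auto simp: algebra_simps)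

lemma coeffs_eval_scale: "coeffs_eval (coeffs_scale c p) s = of_int c * coeffs_eval p s"
  by (induction p) (auto simp: algebra_simps)

lemma coeffs_eval_deriv: "(coeffs_eval p has_real_derivative coeffs_eval (coeffs_deriv p) s) (at s)"
proof (induction p)
  case Nil
  then show ?case by simp
next
  case (Cons a p)
  have "((\<lambda>s. of_int a + s * coeffs_eval p s) has_real_derivative 0 + (1 * coeffs_eval p s + coeffs_eval (coeffs_deriv p) s * s)) (at s)"
    by (intro DERIV_add DERIV_const DERIV_mult DERIV_ident Cons)
  then show ?case by (simp add: coeffs_eval_add mult.commute)
qed

definition bessel_residual_aux :: "int \<Rightarrow> int list \<Rightarrow> int list \<Rightarrow> int list" where
  "bessel_residual_aux c p' Q = coeffs_add (coeffs_scale c Q) (coeffs_add (0 # Q) p')"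

text \<open>Coefficients of \<open>(c + s) p'' + p' + (c + s) p\<close> as a polynomial in
  \<open>s\<close>: the Bessel operator in the variable \<open>x = c + s\<close>. The auxiliary function
  shares the polynomial \<open>p'' + p\<close> between its two occurrences during evaluation.\<close>

definition bessel_residual :: "int \<Rightarrow> int list \<Rightarrow> int list" where
  "bessel_residual c p = bessel_residual_aux c (coeffs_deriv p) (coeffs_add (coeffs_deriv (coeffs_deriv p)) p)"

lemma coeffs_eval_bessel_residual:
  "coeffs_eval (bessel_residual c p) s = (of_int c + s) * coeffs_eval (coeffs_deriv (coeffs_deriv p)) s + coeffs_eval (coeffs_deriv p) s + (of_int c + s) * coeffs_eval p s"
  by (simp add: bessel_residual_def bessel_residual_aux_def coeffs_eval_add coeffs_eval_scale algebra_simps)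

text \<open>An upper bound for the absolute value on \<open>[-1/2, 1/2]\<close>, rounded up so that it
  stays an integer.\<close>

fun half_norm :: "int list \<Rightarrow> int" where
  "half_norm [] = 0"
| "half_norm (a # p) = \<bar>a\<bar> + (half_norm p + 1) div 2"

lemma half_norm_nonneg: "0 \<le> half_norm p"
  by (induction p) auto

lemma abs_coeffs_eval_le:
  assumes s: "\<bar>s\<bar> \<le> 1/2"
  shows "\<bar>coeffs_eval p s\<bar> \<le> of_int (half_norm p)"
proof (induction p)
  case (Cons a p)
  have "\<bar>s * coeffs_eval p s\<bar> \<le> (1/2) * of_int (half_norm p)"
    unfolding abs_mult using s Cons by (intro mult_mono) auto
  moreover have "half_norm p \<le> 2 * ((half_norm p + 1) div 2)" by presburger
  then have "(1/2) * real_of_int (half_norm p) \<le> of_int ((half_norm p + 1) div 2)"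
    by linarith
  ultimately show ?case by simp
qed simp

text \<open>Horner evaluation at \<open>m / 8192\<close> with rounding after each multiplication.\<close>

fun fixed_point_eval :: "int \<Rightarrow> int list \<Rightarrow> int" where
  "fixed_point_eval m [] = 0"
| "fixed_point_eval m (a # p) = a + (m * fixed_point_eval m p) div 8192"

lemma fixed_point_eval_error:
  assumes m: "\<bar>m\<bar> \<le> 4096"
  shows "\<bar>of_int (fixed_point_eval m p) - coeffs_eval p (of_int m / 8192)\<bar> \<le> 2"
proof (induction p)
  case (Cons a p)
  let ?v = "fixed_point_eval m p" and ?w = "coeffs_eval p (of_int m / 8192)"
  have "real_of_int m / 8192 * of_int ?v - 1 \<le> of_int ((m * ?v) div 8192)"
       "of_int ((m * ?v) div 8192) \<le> real_of_int m / 8192 * of_int ?v"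
  proof -
    have "(m * ?v) div 8192 = \<lfloor>real_of_int (m * ?v) / real_of_int 8192\<rfloor>"
      by (rule floor_divide_of_int_eq[symmetric])
    then show "real_of_int m / 8192 * of_int ?v - 1 \<le> of_int ((m * ?v) div 8192)"
       "of_int ((m * ?v) div 8192) \<le> real_of_int m / 8192 * of_int ?v"
      by (simp_all, linarith+)
  qed
  moreover have "\<bar>real_of_int m / 8192 * (of_int ?v - ?w)\<bar> \<le> (1/2) * 2"
    unfolding abs_mult using m Cons by (intro mult_mono) auto
  then have "\<bar>real_of_int m / 8192 * of_int ?v - real_of_int m / 8192 * ?w\<bar> \<le> 1"
    by (simp add: right_diff_distrib)
  ultimately show ?case unfolding coeffs_eval.simps fixed_point_eval.simps of_int_add by linarith
qed simp

text \<open>The energy of the difference of \<open>J0\<close> and an approximating polynomial around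
  \<open>c\<close>. Polynomials have integer coefficients in units of
  \<open>10\<^sup>-\<^sup>9\<close>.\<close>

definition bessel_error :: "real \<Rightarrow> int list \<Rightarrow> real \<Rightarrow> real" where
  "bessel_error c p x = sqrt ((J0 x - coeffs_eval p (x - c) / 10^9)\<^sup>2 + (J0' x - coeffs_eval (coeffs_deriv p) (x - c) / 10^9)\<^sup>2)"

definition approximates :: "int \<Rightarrow> int list \<Rightarrow> int \<Rightarrow> bool" where
  "approximates c p e \<longleftrightarrow>
     (\<forall>x. 0 \<le> x \<and> of_int c - 1/2 \<le> x \<and> x \<le> of_int c + 1/2 \<longrightarrow> bessel_error (of_int c) p x \<le> of_int e / 10^9)"

lemma approximates_mono: "approximates c p e \<Longrightarrow> e \<le> e' \<Longrightarrow> approximates c p e'"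
  unfolding approximates_def by (smt (verit) divide_right_mono of_int_le_iff zero_le_power)

lemma approximatesD:
  assumes "approximates c p e" "0 \<le> x" "\<bar>x - of_int c\<bar> \<le> 1/2"
  shows "\<bar>J0 x - coeffs_eval p (x - of_int c) / 10^9\<bar> \<le> of_int e / 10^9"
    and "\<bar>J0' x - coeffs_eval (coeffs_deriv p) (x - of_int c) / 10^9\<bar> \<le> of_int e / 10^9"
proof -
  have "bessel_error (of_int c) p x \<le> of_int e / 10^9"
    using assms unfolding approximates_def by (smt (verit))
  then show "\<bar>J0 x - coeffs_eval p (x - of_int c) / 10^9\<bar> \<le> of_int e / 10^9"
    and "\<bar>J0' x - coeffs_eval (coeffs_deriv p) (x - of_int c) / 10^9\<bar> \<le> of_int e / 10^9"
    unfolding bessel_error_def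
    by (smt (verit) real_sqrt_sum_squares_ge1 real_sqrt_sum_squares_ge2 real_sqrt_abs real_sqrt_le_mono zero_le_power2)+
qed

lemma residual_growth:
  assumes a: "0 \<le> a" "a \<le> b"
    and res: "\<And>x. a < x \<Longrightarrow> x < b \<Longrightarrow> \<bar>coeffs_eval (bessel_residual c p) (x - of_int c)\<bar> \<le> k * x"
  shows "bessel_error (of_int c) p b \<le> bessel_error (of_int c) p a + k / 10^9 * (b - a)"
proof -
  define D where "D x = J0 x - coeffs_eval p (x - of_int c) / 10^9" for x
  define D' where "D' x = J0' x - coeffs_eval (coeffs_deriv p) (x - of_int c) / 10^9" for x
  define D'' where "D'' x = J0'' x - coeffs_eval (coeffs_deriv (coeffs_deriv p)) (x - of_int c) / 10^9" for x
  have sh: "((\<lambda>x. coeffs_eval q (x - of_int c) / 10^9) has_real_derivative coeffs_eval (coeffs_deriv q) (x - of_int c) / 10^9) (at x)" for q x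
  proof -
    have "((\<lambda>x. x - of_int c) has_real_derivative 1) (at x)" by (auto intro!: derivative_eq_intros)
    from DERIV_chain2[OF coeffs_eval_deriv this] have "((\<lambda>x. coeffs_eval q (x - of_int c)) has_real_derivative coeffs_eval (coeffs_deriv q) (x - of_int c) * 1) (at x)" .
    then show ?thesis by (intro DERIV_cdivide) simp
  qed
  have "sqrt ((D b)\<^sup>2 + (D' b)\<^sup>2) \<le> sqrt ((D a)\<^sup>2 + (D' a)\<^sup>2) + k / 10^9 * (b - a)"
  proof (rule sqrt_energy_growth[OF a(2) a(1)])
    show "(D has_real_derivative D' x) (at x)" for x
      unfolding D_def[abs_def] D'_def by (intro DERIV_diff J0_deriv sh)
    show "(D' has_real_derivative D'' x) (at x)" for x
      unfolding D'_def[abs_def] D''_def by (intro DERIV_diff J0'_deriv sh)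
    fix x assume x: "a < x" "x < b"
    have "x * D'' x + D' x + x * D x = - (coeffs_eval (bessel_residual c p) (x - of_int c) / 10^9)"
      unfolding D_def D'_def D''_def coeffs_eval_bessel_residual using Bessel_equation[of x]
      by (simp add: field_simps)
    then have "\<bar>x * D'' x + D' x + x * D x\<bar> = \<bar>coeffs_eval (bessel_residual c p) (x - of_int c)\<bar> / 10^9" by simp
    also have "\<dots> \<le> k * x / 10^9" using res[OF x] by (intro divide_right_mono) auto
    finally show "\<bar>x * D'' x + D' x + x * D x\<bar> \<le> k / 10^9 * x" by simp
  qed
  then show ?thesis by (simp add: bessel_error_def D_def D'_def)
qed

text \<open>Bound for the growth of the error from the interval around \<open>c - 1\<close> to that
  around \<open>c\<close>. The first two terms are the mismatches of value and derivative at the common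
  endpoint, 8 covers the rounding of the four evaluations, and the last term is the residual divided by
  the smallest \<open>x\<close> in the interval, rounded up.\<close>

definition step_error :: "int \<Rightarrow> int list \<Rightarrow> int list \<Rightarrow> int" where
  "step_error c p q = \<bar>fixed_point_eval 4096 p - fixed_point_eval (-4096) q\<bar> + \<bar>fixed_point_eval 4096 (coeffs_deriv p) - fixed_point_eval (-4096) (coeffs_deriv q)\<bar> + 8
     + ((2 * half_norm (bessel_residual c q)) div (2 * c - 1) + 1)"

lemma approximates_step:
  assumes ap: "approximates c p e" and c: "0 \<le> c"
  shows "approximates (c + 1) q (e + step_error (c + 1) p q)"
  unfolding approximates_def
proof (intro allI impI)
  let ?c = "real_of_int (c + 1)"
  fix x assume x: "0 \<le> x \<and> ?c - 1/2 \<le> x \<and> x \<le> ?c + 1/2"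
  define x0 where "x0 = real_of_int c + 1/2"
  define h where "h = half_norm (bessel_residual (c + 1) q)"
  have x0: "0 \<le> x0" "x0 \<le> x" "0 < x0" using c x by (auto simp: x0_def)
  have 1: "bessel_error (of_int c) p x0 \<le> of_int e / 10^9"
    using ap c unfolding approximates_def x0_def by auto
  have s: "x0 - of_int c = of_int 4096 / 8192" "x0 - ?c = of_int (-4096) / 8192" by (auto simp: x0_def)
  have gap: "\<bar>coeffs_eval p (x0 - of_int c) - coeffs_eval q (x0 - ?c)\<bar> \<le> \<bar>fixed_point_eval 4096 p - fixed_point_eval (-4096) q\<bar> + 4" for p q
    unfolding s using fixed_point_eval_error[of 4096 p] fixed_point_eval_error[of "-4096" q] by (simp add: abs_if split: if_splits; linarith)
  have "bessel_error ?c q x0 \<le> bessel_error (of_int c) p x0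
     + sqrt (((coeffs_eval p (x0 - of_int c) - coeffs_eval q (x0 - ?c)) / 10^9)\<^sup>2
           + ((coeffs_eval (coeffs_deriv p) (x0 - of_int c) - coeffs_eval (coeffs_deriv q) (x0 - ?c)) / 10^9)\<^sup>2)"
    unfolding bessel_error_def
    using real_sqrt_sum_squares_triangle_ineq[of "J0 x0 - coeffs_eval p (x0 - of_int c) / 10^9"
      "(coeffs_eval p (x0 - of_int c) - coeffs_eval q (x0 - ?c)) / 10^9" "J0' x0 - coeffs_eval (coeffs_deriv p) (x0 - of_int c) / 10^9"
      "(coeffs_eval (coeffs_deriv p) (x0 - of_int c) - coeffs_eval (coeffs_deriv q) (x0 - ?c)) / 10^9"]
    by (simp add: diff_divide_distrib)
  also have "sqrt (((coeffs_eval p (x0 - of_int c) - coeffs_eval q (x0 - ?c)) / 10^9)\<^sup>2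
           + ((coeffs_eval (coeffs_deriv p) (x0 - of_int c) - coeffs_eval (coeffs_deriv q) (x0 - ?c)) / 10^9)\<^sup>2)
       \<le> \<bar>(coeffs_eval p (x0 - of_int c) - coeffs_eval q (x0 - ?c)) / 10^9\<bar> + \<bar>(coeffs_eval (coeffs_deriv p) (x0 - of_int c) - coeffs_eval (coeffs_deriv q) (x0 - ?c)) / 10^9\<bar>"
    by (rule sqrt_sum_squares_le_sum_abs)
  also have "\<dots> \<le> (\<bar>fixed_point_eval 4096 p - fixed_point_eval (-4096) q\<bar> + \<bar>fixed_point_eval 4096 (coeffs_deriv p) - fixed_point_eval (-4096) (coeffs_deriv q)\<bar> + 8) / 10^9"
    using gap[of p q] gap[of "coeffs_deriv p" "coeffs_deriv q"] by (simp add: abs_divide field_simps)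
  finally have 2: "bessel_error ?c q x0 \<le> bessel_error (of_int c) p x0
      + (\<bar>fixed_point_eval 4096 p - fixed_point_eval (-4096) q\<bar> + \<bar>fixed_point_eval 4096 (coeffs_deriv p) - fixed_point_eval (-4096) (coeffs_deriv q)\<bar> + 8) / 10^9" by simp
  have h0: "0 \<le> h" by (simp add: h_def half_norm_nonneg)
  have "bessel_error ?c q x \<le> bessel_error ?c q x0 + (of_int h / x0) / 10^9 * (x - x0)"
  proof (rule residual_growth[OF x0(1,2)])
    fix y assume y: "x0 < y" "y < x"
    have "y - ?c \<le> 1/2" "- (y - ?c) \<le> 1/2" using y x unfolding x0_def by simp_all
    then have "\<bar>y - ?c\<bar> \<le> 1/2" by (rule abs_leI)
    then have "\<bar>coeffs_eval (bessel_residual (c + 1) q) (y - ?c)\<bar> \<le> of_int h" unfolding h_def by (rule abs_coeffs_eval_le)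
    also have "\<dots> = of_int h / x0 * x0" using x0 by simp
    also have "\<dots> \<le> of_int h / x0 * y" using y x0 h0 by (intro mult_left_mono) auto
    finally show "\<bar>coeffs_eval (bessel_residual (c + 1) q) (y - ?c)\<bar> \<le> of_int h / x0 * y" .
  qed
  also have "(of_int h / x0) / 10^9 * (x - x0) \<le> (of_int h / x0) / 10^9 * 1"
    using x x0 h0 by (intro mult_left_mono) (auto simp: x0_def)
  also have "of_int h / x0 \<le> of_int ((2 * h) div (2 * (c + 1) - 1) + 1)"
  proof -
    have "of_int h / x0 = real_of_int (2 * h) / real_of_int (2 * (c + 1) - 1)"
      using c by (simp add: x0_def field_simps)
    then show ?thesis using floor_divide_of_int_eq[of "2*h" "2*(c+1)-1", where 'a = real] by linarith
  qed
  finally show "bessel_error ?c q x \<le> of_int (e + step_error (c + 1) p q) / 10^9"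
    using 1 2 unfolding step_error_def h_def by (simp add: add_divide_distrib)
qed

lemma step_error_nonneg:
  assumes "0 < c"
  shows "0 \<le> step_error c p q"
  using assms half_norm_nonneg[of "bessel_residual c q"] unfolding step_error_def
  by (intro add_nonneg_nonneg) (auto intro!: pos_imp_zdiv_nonneg_iff[THEN iffD2])

section \<open>Enclosures of the Bessel function on a bounded interval\<close>

text \<open>The entry for \<open>c\<close> is the Taylor polynomial of \<open>J0\<close> of degree 9
  around \<open>c\<close> (of degree 8 for \<open>c = 0\<close>), multiplied by \<open>10\<^sup>9\<close>
  and rounded to integer coefficients. The errors, including those of rounding, are bounded afterwards.
  The table is cut into chunks of ten so that looking up one entry does not expand all of them.\<close>

definition bessel_chunk_0 :: "int list list" where "bessel_chunk_0 = [
  [1000000000, 0, -250000000, 0, 15625000, 0, -434027, 0, 6781],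
  [765197687, -440050586, -162573550, 54191183, 9575290, -2241114, -257954, 46480, 3956, -579],
  [223890779, -576724808, 32235812, 66717966, -3675354, -2671652, 123734, 54336, -2128, -668],
  [-260051955, -339058959, 186535804, 29504756, -13502535, -983492, 395446, 17595, -6339, -197],
  [-397149810, 66043328, 190319489, -26179227, -12327255, 1395419, 338356, -32353, -5194, 429],
  [-177596771, 327579138, 56040472, -56148693, -1707388, 2520212, 11202, -53795, 213, 678],
  [150645257, 276683858, -98379617, -39367498, 9276407, 1551351, -305971, -30038, 5227, 351],
  [300079271, 4682823, -150374123, 6396130, 11790129, -593149, -352849, 17226, 5661, -258],
  [171650807, -234636347, -71160632, 41460052, 4487301, -2076979, -105975, 47451, 1339, -624],
  [-90333611, -245311787, 58795238, 38202940, -5811776, -1720185, 211510, 36188, -3882, -446]]"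
definition bessel_chunk_1 :: "int list list" where "bessel_chunk_1 = [
  [-245935764, -43472746, 125141520, 3001619, -10291309, 47516, 329079, -4835, -5538, 102],
  [-171190300, 176785299, 77559455, -31570997, -5650002, 1636916, 159994, -39212, -2395, 536],
  [47689311, 223447104, -33154951, -36061594, 3465046, 1710222, -134096, -38016, 2622, 489],
  [206926102, 70318052, -106167592, -8928082, 8911624, 306333, -293798, -4244, 5111, 23],
  [171073476, -133375155, -80773340, 24038953, 6237210, -1269883, -189554, 31233, 3053, -440],
  [-14224473, -205104039, 13949038, 33722099, -1709058, -1641452, 73222, 37611, -1547, -498],
  [-174899074, -90397176, 90274449, 13126626, -7667363, -555071, 257142, 10850, -4566, -120],
  [-169854252, 97668493, 82054523, -17830669, -6529997, 957491, 205693, -24023, -3442, 346],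
  [-13355806, 187994885, 1455823, -31262735, 310949, 1545273, -24011, -36060, 649, 487],
  [146629440, 105701431, -76096336, -16233081, 6518538, 737443, -221149, -15750, 3981, 194]]"
definition bessel_chunk_2 :: "int list list" where "bessel_chunk_2 = [
  [167024664, -66833124, -81841504, 12475032, 6630783, -684379, -213302, 17542, 3653, -258],
  [36579071, -171120273, -14215243, 28681013, 839330, -1432179, -16671, 33828, 106, -463],
  [-120651476, -117177790, 62988869, 18534904, -5437089, -872189, 186191, 19397, -3388, -250],
  [-162412781, 39519322, 80347275, -7738556, -6586448, 441354, 214772, -11694, -3733, 177],
  [-56230274, 154038065, 24906011, -25974356, -1798657, 1306786, 50656, -31139, -742, 431],
  [96266783, 125350250, -50640397, -20183076, 4407691, 969388, -152325, -22056, 2800, 291],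
  [155999316, -15045731, -77710317, 3500198, 6423116, -223201, -211437, 6403, 3713, -103],
  [72741918, -136584725, -33841612, 23150692, 2598617, -1171861, -79033, 28119, 1275, -392],
  [-73157011, -130551488, 38909782, 21267616, -3423604, -1035045, 119606, 23894, -2222, -321],
  [-147848765, -6934205, 74043938, 303247, -6158245, 27058, 204149, -1622, -3613, 36]]"
definition bessel_chunk_3 :: "int list list" where "bessel_chunk_3 = [
  [-86367984, 118751063, 41204807, -20227684, -3257906, 1029587, 102472, -24856, -1718, 349],
  [51208145, 133024317, -27749626, -21849266, 2483488, 1073131, -88137, -25021, 1662, 339],
  [138079010, 26589028, -69454958, -3703688, 5805476, 148571, -193527, -2673, 3446, 25],
  [97270672, -100619649, -47110796, 17230409, 3788389, -881980, -121412, 21420, 2077, -302],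
  [-30421191, -132971181, 17166054, 21974398, -1589324, -1086568, 58066, 25520, -1123, -349],
  [-126845683, -43990942, 64051283, 6715826, -5376777, -304395, 180077, 6495, -3223, -80],
  [-105567382, 82329809, 51640221, -14189197, -4198322, 731033, 136160, -17871, -2360, 254],
  [10862370, 130580039, -7195780, -21682616, 745062, 1077745, -29575, -25455, 610, 350],
  [114332739, 59161890, -57944815, -9345199, 4883438, 440694, -164248, -9848, 2953, 128],
  [111357698, -64056104, -54857617, 11137867, 4494150, -578751, -146958, 14266, 2569, -204]]"
definition bessel_chunk_4 :: "int list list" where "bessel_chunk_4 = [
  [7366891, -126038318, -2107966, 21010824, 44291, -1048792, 2864, 24883, -127, -344],
  [-100745789, -72101262, 51252178, 11593044, -4336535, -557540, 146458, 12731, -2644, -169],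
  [-114739497, 45993888, 56822202, -8112272, -4681579, 427141, 154016, -10659, -2710, 154],
  [-24149288, 119540334, 10684640, -19995440, -773296, 1001735, 21863, -23858, -321, 331],
  [86306699, 82803359, -44094297, -13459384, 3747122, 654947, -127112, -15145, 2305, 204],
  [115818671, -28348854, -57594348, 5149101, 4766209, -278194, -157536, 7103, 2785, -105],
  [39364801, -111290837, -18472718, 18673567, 1436547, -938583, -44413, 22431, 731, -312],
  [-71248790, -91268764, 36595339, 14945033, -3126272, -732970, 106606, 17091, -1943, -232],
  [-114714878, 11328953, 57239429, -2284835, -4753920, 133849, 157727, -3645, -2800, 57],
  [-52900033, 101506128, 25414240, -17083528, -2029000, 861370, 64606, -20653, -1099, 288]]"
definition bessel_chunk_5 :: "int list list" where "bessel_chunk_5 = [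
  [55812328, 97511828, -28881282, -16052929, 2485048, 791767, -85329, -18572, 1566, 254],
  [111564658, 4862134, -55829997, -445142, 4651101, 4034, -154812, 334, 2757, -11],
  [64655028, -90413578, -31458153, 15265012, 2546238, -772175, -82285, 18576, 1422, -260],
  [-40240189, -101565548, 21078260, 16788997, -1834408, -831646, 63664, 19596, -1180, -269],
  [-106522706, -20030444, 53446820, 3007344, -4464759, -133710, 149032, 2787, -2662, -33],
  [-74548303, 78250038, 36562787, -13258954, -2984656, 673122, 97325, -16251, -1698, 229],
  [24773656, 103484563, -13310797, -17162696, 1185096, 853090, -41982, -20173, 793, 278],
  [99761814, 33996332, -50179121, -5370866, 4202560, 253577, -140652, -5678, 2519, 74],
  [82520532, -65259504, -40697684, 11107245, 3341609, -566369, -109633, 13733, 1925, -194],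
  [-9648358, -103346744, 5699999, 17187306, -547513, -856772, 20641, 20320, -411, -281]]"
definition bessel_chunk_6 :: "int list list" where "bessel_chunk_6 = [
  [-91471804, -46598384, 46124222, 7507994, -3872815, -362199, 129953, 8304, -2334, -111],
  [-88537146, 51690236, 43844883, -8852314, -3615515, 454094, 119151, -11075, -2102, 157],
  [-4909610, 101253665, 1638243, -16880028, -68420, 843563, 18, -20059, 40, 278],
  [81857686, 57696680, -41386753, -9394713, 3484420, 458336, -117239, -10635, 2111, 144],
  [92590012, -37791549, -45999760, 6536636, 3805920, -338468, -125861, 8329, 2228, -119],
  [18687343, -97330172, -8594978, 16261933, 653393, -814527, -19677, 19414, 314, -270],
  [-71137228, -67175478, 36077519, 11011133, -3046769, -540958, 102828, 12644, -1857, -172],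
  [-94698316, 23810383, 47171469, -4202197, -3913531, 221636, 129785, -5547, -2304, 81],
  [-31488517, 91723204, 15069823, -15357766, -1198837, 770912, 38042, -18415, -645, 256],
  [59538062, 74945300, -30312113, -12341824, 2569646, 609264, -87051, -14312, 1578, 196]]"
definition bessel_chunk_7 :: "int list list" where "bessel_chunk_7 = [
  [94908726, -9987789, -47383022, 1889925, 3940226, -105682, -130983, 2780, 2331, -42],
  [43136446, -84599983, -20972448, 14195662, 1697046, -714135, -54851, 17096, 948, -239],
  [-47294466, -80944456, 24209347, 13376060, -2063094, -662692, 70247, 15624, -1280, -215],
  [-93294907, -3444570, 46671047, 360877, -3889029, -7391, 129554, -77, -2311, 5],
  [-53476777, 76145678, 26223891, -12806754, -2141276, 645768, 69873, -15496, -1220, 217],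
  [34643914, 85139995, -17889557, -14107967, 1537276, 700927, -52760, -16574, 969, 228],
  [89956438, 16267814, -45085244, -2513091, 3764066, 115694, -125635, -2517, 2245, 32],
  [62379777, -66560642, -30757677, 11224719, 2525843, -567506, -82912, 13654, 1457, -192],
  [-21823492, -87528095, 11472823, 14536589, -1002331, -723904, 34933, 17158, -651, -237],
  [-85017196, -28279059, 42687579, 4532305, -3570496, -217476, 119398, 4959, -2138, -66]]"
definition bessel_chunk_8 :: "int list list" where "bessel_chunk_8 = [
  [-69742166, 56057297, 34520725, -9485259, -2846196, 481149, 93813, -11614, -1656, 163],
  [9066274, 88133904, -5077173, -14665851, 468220, 731802, -17101, -17381, 332, 241],
  [78623261, 39294383, -39551230, -6387312, 3314423, 311146, -111046, -7210, 1992, 97],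
  [75488480, -44856754, -37474019, 7625539, 3098966, -388572, -102460, 9421, 1814, -133],
  [3402264, -87010855, -1183210, 14504449, 55417, -725046, -410, 17251, -18, -239],
  [-70940395, -49151460, 35759324, 8050544, -3002790, -395301, 100811, 9236, -1812, -126],
  [-79571948, 33185261, 39593036, -5683590, -3282010, 291691, 108777, -7121, -1931, 101],
  [-15367713, 84239462, 7199721, -14065640, -559410, 704288, 17290, -16786, -284, 233],
  [62151161, 57711850, -31403489, -9498447, 2643259, 468736, -88950, -11009, 1603, 151],
  [81974846, -21270531, -40867926, 3697704, 3394416, -192437, -112730, 4759, 2005, -69]]"
definition bessel_chunk_9 :: "int list list" where "bessel_chunk_9 = [
  [26630017, -79925647, -12870977, 13366967, 1035195, -670400, -33250, 16005, 571, -223],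
  [-52451745, -64862857, 26582262, 10711800, -2244074, -530468, 75737, 12504, -1369, -172],
  [-82708366, 9338052, 41303433, -1705808, -3436505, 92726, 114328, -2384, -2037, 36],
  [-37006503, 74198629, 18104334, -12429898, -1474940, 624449, 48024, -14933, -837, 208],
  [42048541, 70518953, -21399371, -11675944, 1813923, 579742, -61463, -13702, 1115, 189],
  [81811968, 2392561, -40918576, -255142, 3409797, 5579, -113619, 38, 2028, -3],
  [46334607, -67208415, -22817260, 11279414, 1871659, -567684, -61377, 13600, 1078, -190],
  [-31154578, -74622728, 15961942, 12380947, -1361782, -616044, 46431, 14592, -847, -202],
  [-79352257, -13711101, 39746083, 2149755, -3316967, -100689, 110691, 2235, -1978, -29],
  [-54474235, 59122943, 26938517, -9943520, -2219313, 501505, 73104, -12040, -1289, 169]]"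
definition bessel_chunk_10 :: "int list list" where "bessel_chunk_10 = [
  [19985850, 77145352, -10378652, -12821677, 896762, 639099, -30944, -15165, 571, 210],
  [75421398, 24420115, -37831591, -3944763, 3161777, 190923, -105666, -4394, 1891, 59],
  [61309727, -50124946, -30409153, 8452731, 2512895, -427439, -83033, 10288, 1469, -144],
  [-8757620, -78086546, 4757871, 12997800, -427957, -648876, 15309, 15421, -292, -214],
  [-70135098, -34338014, 35232635, 5609548, -2948992, -274732, 98703, 6403, -1769, -87],
  [-66751382, 40408581, 33183269, -6839496, -2748489, 347114, 91033, -8385, -1615, 118],
  [-2319235, 77474058, 794174, -12913691, -35718, 645580, 176, -15364, 15, 213],
  [63630205, 43301878, -32017448, -7116607, 2684279, 350722, -89990, -8227, 1616, 113],
  [70736523, -30175891, -35228558, 5137614, 2923319, -262225, -97006, 6369, 1724, -90],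
  [13041760, -75362670, -6175180, 12578272, 485667, -629645, -15222, 15005, 255, -209]]"
definition bessel_chunk_11 :: "int list list" where "bessel_chunk_11 = [
  [-56061967, -51169911, 28263574, 8441966, -2374092, -417679, 79742, 9837, -1434, -135],
  [-73230081, 19633170, 36526603, -3381619, -3035774, 174507, 100898, -4283, -1796, 61],
  [-23218295, 71832737, 11288466, -12004765, -913763, 601726, 29555, -14359, -512, 200],
  [47600992, 57823505, -24056352, -9565533, 2025541, 474581, -68196, -11209, 1230, 154],
  [74224697, -8987296, -37072931, 1606168, 3085414, -85700, -102690, 2168, 1831, -32],
  [32671608, -66988306, -16044551, 11210379, 1312477, -562673, -42921, 13445, 752, -187],
  [-38429984, -63168876, 19487272, 10471366, -1646262, -520614, 55606, 12323, -1006, -170],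
  [-73740333, -1557908, 36876824, 154570, -3072950, -2476, 102405, -66, -1828, 3],
  [-41241739, 60954843, 20362586, -10215932, -1674998, 513524, 55093, -12289, -970, 172],
  [28740298, 67138250, -14652243, -11147876, 1244264, 555185, -42241, -13163, 768, 182]]"
definition bessel_chunk_12 :: "int list list" where "bessel_chunk_12 = [
  [71823416, 11805211, -35960896, -1867507, 3000215, 88358, -100102, -1984, 1789, 26],
  [48788505, -53876610, -24171622, 9045410, 1995340, -455475, -65866, 10919, 1164, -153],
  [-18728398, -69690572, 9649816, 11587949, -827786, -577924, 28374, 13722, -521, -190],
  [-68545521, -21567351, 34360433, 3501203, -2870106, -170360, 95876, 3944, -1715, -53],
  [-55193633, 45913748, 27411681, -7725481, -2268436, 389856, 75071, -9366, -1331, 131],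
  [8592254, 70811739, -4579374, -11788989, 405141, 588688, -14286, -13996, 269, 194],
  [64001635, 30670192, -32122525, -5026396, 2686512, 247010, -89854, -5778, 1610, 79],
  [60362465, -37239121, -30034622, 6284966, 2490204, -318110, -82569, 7664, 1466, -108],
  [1472222, -70514349, -460664, 11752874, 15432, -587560, 250, 13985, -18, -194],
  [-58308021, -38955603, 29305001, 6416487, -2454223, -316963, 82197, 7454, -1474, -102]]"
definition bessel_chunk_13 :: "int list list" where "bessel_chunk_13 = [
  [-64225231, 28034966, 32004789, -4754281, -2657608, 241759, 88256, -5851, -1570, 83],
  [-11274673, 68836987, 5374600, -11485838, -425914, 574842, 13463, -13697, -227, 190],
  [51599732, 46284019, -25975184, -7647966, 2178833, 379032, -73089, -8943, 1313, 123],
  [66737854, -18489436, -33299418, 3164856, 2768689, -162378, -92065, 3964, 1640, -56],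
  [20633631, -65843047, -10071133, 10998283, 818651, -551044, -26597, 13145, 463, -183],
  [-44027835, -52536628, 22208498, 8700788, -1866616, -432203, 62740, 10221, -1129, -141],
  [-67882291, 8793078, 33908818, -1548544, -2822583, 81564, 93966, -2040, -1676, 30],
  [-29379660, 61619131, 14464943, -10304502, -1186482, 516874, 38913, -12344, -683, 172],
  [35756367, 57617159, -18086941, -9558667, 1524401, 475649, -51377, -11269, 927, 156],
  [67666394, 864687, -33836307, -62965, 2819514, -908, -93963, 118, 1677, -3]]"
definition bessel_chunk_14 :: "int list list" where "bessel_chunk_14 = [
  [37358225, -56273053, -18478137, 9422359, 1522864, -473221, -50189, 11315, 886, -158],
  [-26959116, -61453237, 13697477, 10209309, -1159441, -508744, 39241, 12070, -711, -167],
  [-66123310, -10299000, 33097919, 1638720, -2760771, -78037, 92099, 1765, -1646, -23],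
  [-44432264, 49931489, 22041547, -8372887, -1821979, 421130, 60230, -10085, -1066, 141],
  [17816266, 63997284, -9130346, -10644565, 779267, 531069, -26585, -12615, 486, 175],
  [63310430, 19332884, -31721880, -3149070, 2648667, 153779, -88449, -3573, 1582, 48],
  [50484400, -42737317, -25095839, 7179848, 2078831, -361789, -68869, 8679, 1222, -121],
  [-8510967, -65226966, 4477344, 10860505, -391546, -542417, 13664, 12898, -255, -179],
  [-59307914, -27800363, 29747877, 4566183, -2486476, -224919, 83121, 5274, -1488, -72],
  [-55418761, 34846698, 27592445, -5869249, -2289316, 296495, 75965, -7131, -1350, 100]]"
definition bessel_chunk_15 :: "int list list" where "bessel_chunk_15 = [
  [-774090, 65145164, 169895, -10857422, 3937, 542793, -734, -12920, 24, 179],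
  [54216824, 35549342, -27226125, -5864529, 2278353, 290171, -76252, -6835, 1367, 94],
  [59162395, -26425963, -29494270, 4468817, 2450294, -226635, -81414, 5471, 1449, -77],
  [9860051, -63779490, -4721596, 10639748, 376049, -532411, -11953, 12685, 203, -176],
  [-48156890, -42444187, 24216251, 7021317, -2029248, -348387, 68007, 8230, -1221, -113],
  [-61666226, 17648353, 30776183, -3007455, -2559618, 153656, 85141, -3736, -1517, 53],
  [-18575151, 61181357, 9091481, -10215900, -741191, 511682, 24156, -12203, -421, 170],
  [41263984, 48367968, -20786030, -8016869, 1744793, 398573, -58573, -9435, 1053, 130],
  [62905581, -8690677, -31425288, 1514686, 2616168, -79036, -87108, 1960, 1554, -28],
  [26757794, -57424627, -13198316, 9598062, 1084683, -481210, -35646, 11487, 627, -160]]"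
definition bessel_chunk_16 :: "int list list" where "bessel_chunk_16 = [
  [-33687312, -53224334, 17009982, 8834938, -1431191, -439907, 48157, 10429, -868, -144],
  [-62880239, -270038, 31440958, -20090, -2619846, 4258, 87310, -179, -1559, 4],
  [-34259405, 52603856, 16967345, -8801887, -1400256, 441772, 46214, -10557, -817, 147],
  [25586420, 56938969, -12967869, -9462952, 1095087, 471751, -36980, -11198, 669, 155],
  [61614043, 9059872, -30834643, -1447250, 2571569, 69219, -85777, -1573, 1533, 21],
  [40946996, -46832190, -20331582, 7846152, 1682287, -394303, -55670, 9435, 987, -132],
  [-17128030, -59460629, 8743114, 9892189, -743437, -493660, 25273, 11730, -460, -163],
  [-59154067, -17511211, 29629462, 2859290, -2473225, -139988, 82569, 3262, -1477, -44]]"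
definition bessel_poly :: "int \<Rightarrow> int list" where
  "bessel_poly c = (if c < 10 then bessel_chunk_0 else if c < 20 then bessel_chunk_1 else if c < 30 then bessel_chunk_2 else if c < 40 then bessel_chunk_3 else if c < 50 then bessel_chunk_4 else if c < 60 then bessel_chunk_5 else if c < 70 then bessel_chunk_6 else if c < 80 then bessel_chunk_7 else if c < 90 then bessel_chunk_8 else if c < 100 then bessel_chunk_9 else if c < 110 then bessel_chunk_10 else if c < 120 then bessel_chunk_11 else if c < 130 then bessel_chunk_12 else if c < 140 then bessel_chunk_13 else if c < 150 then bessel_chunk_14 else if c < 160 then bessel_chunk_15 else bessel_chunk_16) ! nat (c mod 10)"
lemmas bessel_poly_simps = bessel_poly_def bessel_chunk_0_def bessel_chunk_1_def bessel_chunk_2_def bessel_chunk_3_def bessel_chunk_4_def bessel_chunk_5_def bessel_chunk_6_def bessel_chunk_7_def bessel_chunk_8_def bessel_chunk_9_def bessel_chunk_10_def bessel_chunk_11_def bessel_chunk_12_def bessel_chunk_13_def bessel_chunk_14_def bessel_chunk_15_def bessel_chunk_16_def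

text \<open>The polynomial around 0 needs a separate estimate: there the residual has to be divided by
  \<open>x\<close>, which is possible because it is odd.\<close>

lemma approximates_start: "approximates 0 (bessel_poly 0) 20"
  unfolding approximates_def
proof (intro allI impI)
  fix x :: real assume x: "0 \<le> x \<and> of_int 0 - 1/2 \<le> x \<and> x \<le> of_int 0 + 1/2"
  have bessel_poly: "bessel_poly 0 = [1000000000, 0, -250000000, 0, 15625000, 0, -434027, 0, 6781]" by (simp add: bessel_poly_simps)
  have res: "\<bar>coeffs_eval (bessel_residual 0 (bessel_poly 0)) (y - of_int 0)\<bar> \<le> 30 * y" if y: "0 < y" "y < x" for y
  proof -
    have y1: "0 \<le> y" "y \<le> 1/2" using y x by auto
    have r: "coeffs_eval (bessel_residual 0 (bessel_poly 0)) (y - of_int 0) = y * (y^4 * 28 + y^6 * (- 43) + y^8 * 6781)"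
      by (simp add: bessel_poly bessel_residual_def bessel_residual_aux_def algebra_simps eval_nat_numeral)
    have "\<bar>y^4 * 28 + y^6 * (- 43) + y^8 * 6781\<bar> \<le> \<bar>y^4 * 28\<bar> + \<bar>y^6 * (- 43)\<bar> + \<bar>y^8 * 6781\<bar>"
      by linarith
    also have "\<dots> \<le> (1/2)^4 * 28 + (1/2)^6 * 43 + (1/2)^8 * 6781"
      unfolding abs_mult power_abs using y1 by (intro add_mono mult_mono power_mono) auto
    also have "\<dots> \<le> 30" by (simp add: power_divide)
    finally show ?thesis unfolding r abs_mult using y1 by (simp add: mult.commute mult_left_mono)
  qed
  have "bessel_error (of_int 0) (bessel_poly 0) x \<le> bessel_error (of_int 0) (bessel_poly 0) 0 + 30 / 10^9 * (x - 0)"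
    by (rule residual_growth) (use x res in auto)
  also have "bessel_error (of_int 0) (bessel_poly 0) 0 = 0" by (simp add: bessel_error_def bessel_poly)
  finally show "bessel_error (of_int 0) (bessel_poly 0) x \<le> of_int 20 / 10^9" using x by simp
qed

fun chain :: "int \<Rightarrow> nat \<Rightarrow> int \<Rightarrow> int" where
  "chain c 0 e = e"
| "chain c (Suc n) e = chain (c + 1) n (e + step_error (c + 1) (bessel_poly c) (bessel_poly (c + 1)))"

lemma chain_ge: "0 \<le> c \<Longrightarrow> e \<le> chain c n e"
proof (induction n arbitrary: c e)
  case (Suc n)
  have "0 \<le> step_error (c + 1) (bessel_poly c) (bessel_poly (c + 1))" by (rule step_error_nonneg) (use Suc in simp)
  then show ?case using Suc.IH[of "c + 1" "e + step_error (c + 1) (bessel_poly c) (bessel_poly (c + 1))"] Suc.prems by simp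
qed simp

lemma approximates_chain:
  assumes "approximates c (bessel_poly c) e" "0 \<le> c" "c \<le> d" "d \<le> c + int n"
  shows "approximates d (bessel_poly d) (chain c n e)"
  using assms
proof (induction n arbitrary: c e)
  case (Suc n)
  show ?case
  proof (cases "d = c")
    case True
    then show ?thesis using approximates_mono[OF Suc.prems(1) chain_ge[OF Suc.prems(2), of e "Suc n"]] by simp
  next
    case False
    show ?thesis unfolding chain.simps
      by (rule Suc.IH) (use Suc.prems False approximates_step[of c "bessel_poly c" e "bessel_poly (c + 1)"] in auto)
  qed
qed simp

lemma chain_first: "chain 0 84 20 \<le> 2500"
  by code_simp

lemma chain_second: "chain 84 83 2500 \<le> 5000"
  by code_simp

lemma approximates_bessel_poly:
  assumes "0 \<le> c" "c \<le> 167"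
  shows "approximates c (bessel_poly c) 5000"
proof (cases "c \<le> 84")
  case True
  have "approximates c (bessel_poly c) (chain 0 84 20)"
    by (rule approximates_chain[OF approximates_start]) (use assms True in auto)
  then show ?thesis by (rule approximates_mono) (use chain_first in simp)
next
  case False
  have "approximates 84 (bessel_poly 84) (chain 0 84 20)"
    by (rule approximates_chain[OF approximates_start]) auto
  then have "approximates 84 (bessel_poly 84) 2500" by (rule approximates_mono) (rule chain_first)
  then have "approximates c (bessel_poly c) (chain 84 83 2500)"
    by (rule approximates_chain) (use assms False in auto)
  then show ?thesis by (rule approximates_mono) (rule chain_second)
qed

section \<open>The witness function is nonnegative\<close>

definition J0_table_at :: "int \<Rightarrow> int \<Rightarrow> int" where
  "J0_table_at n c = fixed_point_eval (n - 8192 * c) (bessel_poly c)"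

definition J0_table :: "int \<Rightarrow> int" where
  "J0_table n = J0_table_at n ((n + 4096) div 8192)"

lemma J0_table_error:
  assumes "0 \<le> n" "n \<le> 1368000"
  shows "\<bar>J0 (of_int n / 8192) - of_int (J0_table n) / 10^9\<bar> \<le> 6 / 10^6"
proof -
  define c where "c = (n + 4096) div 8192"
  define m where "m = n - 8192 * c"
  have c: "0 \<le> c" "c \<le> 167" and m: "\<bar>m\<bar> \<le> 4096" using assms unfolding c_def m_def by linarith+
  have s: "real_of_int n / 8192 - of_int c = of_int m / 8192" by (simp add: m_def field_simps)
  have "\<bar>J0 (of_int n / 8192) - coeffs_eval (bessel_poly c) (of_int n / 8192 - of_int c) / 10^9\<bar> \<le> of_int 5000 / 10^9"
    by (rule approximatesD(1)[OF approximates_bessel_poly[OF c]]) (use assms m in \<open>auto simp: s\<close>)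
  moreover have "\<bar>of_int (fixed_point_eval m (bessel_poly c)) - coeffs_eval (bessel_poly c) (of_int m / 8192)\<bar> \<le> 2" by (rule fixed_point_eval_error[OF m])
  moreover have "J0_table n = fixed_point_eval m (bessel_poly c)" by (simp add: J0_table_def J0_table_at_def c_def m_def)
  ultimately show ?thesis unfolding s by (simp add: abs_le_iff field_simps)
qed

text \<open>The pair \<open>(m, n)\<close> stands for the distance \<open>sqrt (m + n sqrt 3) /
  2\<close>; the second component is the coefficient of the corresponding Bessel function in the
  witness.\<close>

definition spectrum :: "((int \<times> int) \<times> int) list" where
  "spectrum = [((8, -4), -3), ((16, -8), 7), ((24, -12), -24), ((8, 0), -32), ((16, -4), 35),
     ((12, 0), 22), ((8, 4), 7), ((16, 4), 9), ((16, 8), 37), ((4, 0), 77)]"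

definition radius :: "int \<times> int \<Rightarrow> real" where
  "radius = (\<lambda>(m, n). sqrt ((of_int m + of_int n * sqrt 3) / 4))"

definition radii :: "(real \<times> int) list" where
  "radii = map (\<lambda>(k, a). (radius k, a)) spectrum"

definition witness :: "real \<Rightarrow> real" where
  "witness t = 461/20 + (\<Sum>(r, a)\<leftarrow>radii. of_int a * J0 (r * t))"

text \<open>The distances in units of \<open>2\<^sup>-\<^sup>2\<^sup>0\<close>, rounded down, in the
  order of \<open>spectrum\<close>.\<close>

definition radius_table :: "(int \<times> int) list" where
  "radius_table = [(542782, -3), (767610, 7), (940127, -24), (1482910, -32), (1579125, 35), (1816186, 22), (2025693, 7), (2510469, 9), (2864762, 37), (1048576, 77)]"

text \<open>Lower bound for the witness at \<open>T / 64\<close> in units of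
  \<open>10\<^sup>-\<^sup>9\<close>. The constant 22.99 instead of 23.05 absorbs all errors: each of the
  ten values is off by at most \<open>2 / 10\<^sup>4\<close>, and the absolute values of the coefficients
  sum to 253.\<close>

definition witness_low :: "int \<Rightarrow> int" where
  "witness_low T = 22990000000 + (\<Sum>(R, a)\<leftarrow>radius_table. a * J0_table ((R * T) div 8192))"

lemma sqrt3_bounds: "17320508 / 10^7 \<le> sqrt 3" "sqrt 3 \<le> 17320509 / 10^7"
  by (rule real_le_rsqrt, simp add: power2_eq_square) (rule real_le_lsqrt, simp_all add: power2_eq_square)

text \<open>The bound 2864762 is the largest entry of \<open>radius_table\<close>; it keeps all arguments
  inside the range of the polynomials.\<close>

definition enclosed :: "real \<times> int \<Rightarrow> int \<times> int \<Rightarrow> bool" where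
  "enclosed = (\<lambda>(r, a) (R, b). a = b \<and> 0 < R \<and> R \<le> 2864762 \<and> of_int R / 2^20 \<le> r \<and> r \<le> of_int (R + 1) / 2^20)"

lemma enclosed_radius:
  assumes "0 < R" "R \<le> 2864762" "(of_int R / 2^20)\<^sup>2 \<le> (of_int m + of_int n * sqrt 3) / 4"
    "(of_int m + of_int n * sqrt 3) / 4 \<le> (of_int (R + 1) / 2^20)\<^sup>2"
  shows "enclosed (radius (m, n), a) (R, a)"
proof -
  have "of_int R / 2^20 \<le> radius (m, n)"
    unfolding radius_def prod.case by (rule real_le_rsqrt[OF assms(3)])
  moreover have "radius (m, n) \<le> of_int (R + 1) / 2^20"
    unfolding radius_def prod.case by (rule real_le_lsqrt[OF _ assms(4)]) (use assms(1) in simp)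
  ultimately show ?thesis using assms(1,2) by (simp add: enclosed_def)
qed

lemma enclosures:
  "enclosed (radius (8, -4), -3) (542782, -3)"
  "enclosed (radius (16, -8), 7) (767610, 7)"
  "enclosed (radius (24, -12), -24) (940127, -24)"
  "enclosed (radius (8, 0), -32) (1482910, -32)"
  "enclosed (radius (16, -4), 35) (1579125, 35)"
  "enclosed (radius (12, 0), 22) (1816186, 22)"
  "enclosed (radius (8, 4), 7) (2025693, 7)"
  "enclosed (radius (16, 4), 9) (2510469, 9)"
  "enclosed (radius (16, 8), 37) (2864762, 37)"
  "enclosed (radius (4, 0), 77) (1048576, 77)"
  subgoal by (rule enclosed_radius; use sqrt3_bounds in \<open>simp add: power2_eq_square\<close>)
  subgoal by (rule enclosed_radius; use sqrt3_bounds in \<open>simp add: power2_eq_square\<close>)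
  subgoal by (rule enclosed_radius; use sqrt3_bounds in \<open>simp add: power2_eq_square\<close>)
  subgoal by (rule enclosed_radius; use sqrt3_bounds in \<open>simp add: power2_eq_square\<close>)
  subgoal by (rule enclosed_radius; use sqrt3_bounds in \<open>simp add: power2_eq_square\<close>)
  subgoal by (rule enclosed_radius; use sqrt3_bounds in \<open>simp add: power2_eq_square\<close>)
  subgoal by (rule enclosed_radius; use sqrt3_bounds in \<open>simp add: power2_eq_square\<close>)
  subgoal by (rule enclosed_radius; use sqrt3_bounds in \<open>simp add: power2_eq_square\<close>)
  subgoal by (rule enclosed_radius; use sqrt3_bounds in \<open>simp add: power2_eq_square\<close>)
  subgoal by (rule enclosed_radius; use sqrt3_bounds in \<open>simp add: power2_eq_square\<close>)
  done

lemma radii_enclosed: "list_all2 enclosed radii radius_table"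
  unfolding radii_def spectrum_def radius_table_def list.map prod.case
  by (intro list.rel_intros enclosures)

lemma J0_lipschitz: "\<bar>J0 x - J0 y\<bar> \<le> \<bar>x - y\<bar>"
proof -
  have "norm (J0 x - J0 y) \<le> 1 * norm (x - y)"
    by (rule field_differentiable_bound[of UNIV J0 J0'])
       (use abs_J0'_le J0_deriv in \<open>auto intro: has_field_derivative_at_within\<close>)
  then show ?thesis by simp
qed

lemma J0_table_radius:
  assumes "enclosed (r, a) (R, b)" "0 \<le> T" "T \<le> 3904"
  shows "\<bar>J0 (r * (of_int T / 64)) - of_int (J0_table ((R * T) div 8192)) / 10^9\<bar> \<le> 2 / 10^4"
proof -
  define n where "n = (R * T) div 8192"
  have R: "0 < R" "R \<le> 2864762" "of_int R / 2^20 \<le> r" "r \<le> of_int (R + 1) / 2^20"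
    using assms(1) by (auto simp: enclosed_def)
  have "R * T \<le> 2864762 * 3904" using R assms by (intro mult_mono) auto
  moreover have "0 \<le> R * T" using R assms by simp
  ultimately have n: "0 \<le> n" "n \<le> 1368000" unfolding n_def by linarith+
  have d: "real_of_int (R * T) / 8192 - 1 \<le> of_int n" "of_int n \<le> real_of_int (R * T) / 8192"
    using floor_divide_of_int_eq[of "R * T" 8192, where 'a = real] unfolding n_def by linarith+
  have t: "0 \<le> real_of_int T" "real_of_int T \<le> 3904" using assms by auto
  have "of_int R / 2^20 * (of_int T / 64) \<le> r * (of_int T / 64)"
    using R t by (intro mult_right_mono) auto
  moreover have "r * (of_int T / 64) \<le> of_int (R + 1) / 2^20 * (of_int T / 64)"
    using R t by (intro mult_right_mono) auto
  ultimately have "\<bar>r * (of_int T / 64) - of_int n / 8192\<bar> \<le> 1/8192 + 61 / 2^20"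
    using d t unfolding abs_le_iff of_int_mult of_int_add by (simp add: field_simps)
  then have "\<bar>J0 (r * (of_int T / 64)) - J0 (of_int n / 8192)\<bar> \<le> 1/8192 + 61 / 2^20"
    by (rule order_trans[OF J0_lipschitz])
  then show ?thesis using J0_table_error[OF n] unfolding n_def[symmetric] abs_le_iff by simp
qed

lemma witness_low_error_aux:
  assumes "list_all2 enclosed rs ws" "0 \<le> T" "T \<le> 3904"
  shows "\<bar>(\<Sum>(r, a)\<leftarrow>rs. of_int a * J0 (r * (of_int T / 64)))
      - of_int (\<Sum>(R, a)\<leftarrow>ws. a * J0_table ((R * T) div 8192)) / 10^9\<bar> \<le> 2 / 10^4 * (\<Sum>(r, a)\<leftarrow>rs. of_int \<bar>a\<bar>)"
  using assms(1)
proof (induction rule: list_all2_induct)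
  case (Cons p rs q ws)
  obtain r a R b where pq: "p = (r, a)" "q = (R, b)" by (cases p, cases q)
  have b: "b = a" using Cons(1) by (simp add: pq enclosed_def)
  let ?d = "J0 (r * (of_int T / 64)) - of_int (J0_table ((R * T) div 8192)) / 10^9"
  have "\<bar>real_of_int a * ?d\<bar> \<le> \<bar>real_of_int a\<bar> * (2 / 10^4)"
    unfolding abs_mult using J0_table_radius[OF Cons(1)[unfolded pq] assms(2,3)] by (intro mult_left_mono) auto
  then have "\<bar>real_of_int a * J0 (r * (of_int T / 64)) - of_int (a * J0_table ((R * T) div 8192)) / 10^9\<bar>
       \<le> \<bar>real_of_int a\<bar> * (2 / 10^4)"
    by (simp add: right_diff_distrib)
  moreover define X where "X = (\<Sum>(r, a)\<leftarrow>rs. real_of_int a * J0 (r * (of_int T / 64)))"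
  moreover define Y where "Y = (\<Sum>(R, a)\<leftarrow>ws. a * J0_table ((R * T) div 8192))"
  moreover define Z where "Z = (\<Sum>(r, a)\<leftarrow>rs. real_of_int \<bar>a\<bar>)"
  moreover have "\<bar>X - of_int Y / 10^9\<bar> \<le> 2 / 10^4 * Z"
    using Cons(3) unfolding X_def Y_def Z_def .
  ultimately have "\<bar>real_of_int a * J0 (r * (of_int T / 64)) + X
      - (of_int (a * J0_table ((R * T) div 8192)) / 10^9 + of_int Y / 10^9)\<bar> \<le> \<bar>real_of_int a\<bar> * (2 / 10^4) + 2 / 10^4 * Z"
    unfolding abs_le_iff by linarith
  then show ?case
    unfolding pq b list.map prod.case sum_list.Cons X_def[symmetric] Y_def[symmetric] Z_def[symmetric] of_int_add add_divide_distrib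
    by (simp add: distrib_left mult.commute)
qed simp

lemma witness_low:
  assumes "0 \<le> T" "T \<le> 3904"
  shows "of_int (witness_low T) / 10^9 \<le> witness (of_int T / 64)"
proof -
  have "(\<Sum>(r, a)\<leftarrow>radii. real_of_int \<bar>a\<bar>) = 253" by (simp add: radii_def spectrum_def)
  then show ?thesis using witness_low_error_aux[OF radii_enclosed assms]
    unfolding witness_def witness_low_def abs_le_iff by (simp add: add_divide_distrib)
qed

definition witness' :: "real \<Rightarrow> real" where "witness' t = (\<Sum>(r, a)\<leftarrow>radii. of_int a * (J0' (r * t) * r))"
definition witness'' :: "real \<Rightarrow> real" where "witness'' t = (\<Sum>(r, a)\<leftarrow>radii. of_int a * (J0'' (r * t) * r * r))"

lemma witness_deriv: "(witness has_real_derivative witness' t) (at t)"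
proof -
  have "((\<lambda>t. (\<Sum>(r, a)\<leftarrow>rs. of_int a * J0 (r * t))) has_real_derivative (\<Sum>(r, a)\<leftarrow>rs. of_int a * (J0' (r * t) * r))) (at t)"
    for rs :: "(real \<times> int) list"
  proof (induction rs)
    case (Cons p rs)
    obtain r a where p: "p = (r, a)" by (cases p)
    have "((\<lambda>t. J0 (r * t)) has_real_derivative J0' (r * t) * r) (at t)"
      by (rule DERIV_chain2[OF J0_deriv]) (rule DERIV_cmult_Id)
    from DERIV_add[OF DERIV_cmult[OF this, of "of_int a"] Cons] show ?case by (simp add: p)
  qed simp
  from DERIV_add[OF DERIV_const this] show ?thesis unfolding witness_def[abs_def] witness'_def by simp
qed

lemma witness'_deriv: "(witness' has_real_derivative witness'' t) (at t)"
proof -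
  have "((\<lambda>t. (\<Sum>(r, a)\<leftarrow>rs. of_int a * (J0' (r * t) * r))) has_real_derivative (\<Sum>(r, a)\<leftarrow>rs. of_int a * (J0'' (r * t) * r * r))) (at t)"
    for rs :: "(real \<times> int) list"
  proof (induction rs)
    case (Cons p rs)
    obtain r a where p: "p = (r, a)" by (cases p)
    have "((\<lambda>t. J0' (r * t)) has_real_derivative J0'' (r * t) * r) (at t)"
      by (rule DERIV_chain2[OF J0'_deriv]) (rule DERIV_cmult_Id)
    from DERIV_add[OF DERIV_cmult[OF DERIV_cmult_right[OF this, of r], of "of_int a"] Cons] show ?case by (simp add: p)
  qed simp
  then show ?thesis unfolding witness'_def[abs_def] witness''_def by simp
qed

lemma abs_witness''_le: "\<bar>witness'' t\<bar> \<le> 333"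
proof -
  have "\<bar>\<Sum>(r, a)\<leftarrow>rs. of_int a * (J0'' (r * t) * r * r)\<bar> \<le> (\<Sum>(r, a)\<leftarrow>rs. of_int \<bar>a\<bar> * (r\<^sup>2 / 2))"
    for rs :: "(real \<times> int) list"
  proof (induction rs)
    case (Cons p rs)
    obtain r a where p: "p = (r, a)" by (cases p)
    have "\<bar>J0'' (r * t)\<bar> * r\<^sup>2 \<le> 1/2 * r\<^sup>2" by (intro mult_right_mono abs_J0''_le) auto
    then have "\<bar>J0'' (r * t) * r * r\<bar> \<le> r\<^sup>2 / 2" by (simp add: abs_mult power2_eq_square mult.assoc)
    then have "\<bar>real_of_int a * (J0'' (r * t) * r * r)\<bar> \<le> \<bar>real_of_int a\<bar> * (r\<^sup>2 / 2)"
      unfolding abs_mult[of "real_of_int a"] by (intro mult_left_mono) auto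
    then show ?case using Cons by (simp add: p)
  qed simp
  also have "(\<Sum>(r, a)\<leftarrow>radii. of_int \<bar>a\<bar> * (r\<^sup>2 / 2)) \<le> 333"
  proof -
    have r: "0 \<le> real_of_int m + of_int n * sqrt 3 \<Longrightarrow> (radius (m, n))\<^sup>2 = (of_int m + of_int n * sqrt 3) / 4" for m n
      by (simp add: radius_def)
    have r1: "(radius (8, -4))\<^sup>2 = (8 + -4 * sqrt 3) / 4" using r[of "8" "-4"] sqrt3_bounds by simp
    have r2: "(radius (16, -8))\<^sup>2 = (16 + -8 * sqrt 3) / 4" using r[of "16" "-8"] sqrt3_bounds by simp
    have r3: "(radius (24, -12))\<^sup>2 = (24 + -12 * sqrt 3) / 4" using r[of "24" "-12"] sqrt3_bounds by simp
    have r4: "(radius (8, 0))\<^sup>2 = (8 + 0 * sqrt 3) / 4" using r[of "8" "0"] sqrt3_bounds by simp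
    have r5: "(radius (16, -4))\<^sup>2 = (16 + -4 * sqrt 3) / 4" using r[of "16" "-4"] sqrt3_bounds by simp
    have r6: "(radius (12, 0))\<^sup>2 = (12 + 0 * sqrt 3) / 4" using r[of "12" "0"] sqrt3_bounds by simp
    have r7: "(radius (8, 4))\<^sup>2 = (8 + 4 * sqrt 3) / 4" using r[of "8" "4"] sqrt3_bounds by simp
    have r8: "(radius (16, 4))\<^sup>2 = (16 + 4 * sqrt 3) / 4" using r[of "16" "4"] sqrt3_bounds by simp
    have r9: "(radius (16, 8))\<^sup>2 = (16 + 8 * sqrt 3) / 4" using r[of "16" "8"] sqrt3_bounds by simp
    have r10: "(radius (4, 0))\<^sup>2 = (4 + 0 * sqrt 3) / 4" using r[of "4" "0"] sqrt3_bounds by simp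
    have "(\<Sum>(r, a)\<leftarrow>radii. of_int \<bar>a\<bar> * (r\<^sup>2 / 2)) = 723/2 - 17 * sqrt 3"
      by (simp add: radii_def spectrum_def r1 r2 r3 r4 r5 r6 r7 r8 r9 r10 field_simps)
    then show ?thesis using sqrt3_bounds by simp
  qed
  finally show ?thesis unfolding witness''_def .
qed

text \<open>The function \<open>K/2 (x - A) (x - B) - f x\<close> is convex, hence at most its larger end
  value, while the quadratic term is at least \<open>- K (B - A)\<^sup>2 / 8\<close>.\<close>

lemma nonneg_between:
  fixes f f' f'' :: "real \<Rightarrow> real"
  assumes d: "\<And>x. (f has_real_derivative f' x) (at x)" "\<And>x. (f' has_real_derivative f'' x) (at x)"
    and K: "\<And>x. \<bar>f'' x\<bar> \<le> K" and AB: "A < B"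
    and A: "K * (B - A)\<^sup>2 / 8 \<le> f A" and B: "K * (B - A)\<^sup>2 / 8 \<le> f B"
    and x: "A \<le> x" "x \<le> B"
  shows "0 \<le> f x"
proof -
  define m where "m = K * (B - A)\<^sup>2 / 8"
  define g where "g x = K / 2 * (x - A) * (x - B) - f x" for x
  have "convex_on {A..B} g"
  proof (rule f''_ge0_imp_convex)
    show "(g has_real_derivative (K / 2 * ((x - A) + (x - B)) - f' x)) (at x)" for x
      unfolding g_def by (auto intro!: derivative_eq_intros d simp: field_simps)
    show "((\<lambda>x. K / 2 * ((x - A) + (x - B)) - f' x) has_real_derivative (K - f'' x)) (at x)" for x
      by (auto intro!: derivative_eq_intros d simp: field_simps)
    show "0 \<le> K - f'' x" for x using K[of x] by linarith
  qed simp
  then have "g x \<le> (g B - g A) / (B - A) * (x - A) + g A"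
    by (rule convex_onD_Icc') (use x AB in auto)
  also have "\<dots> = ((x - A) * g B + (B - x) * g A) / (B - A)" using AB by (simp add: field_simps)
  also have "\<dots> \<le> ((x - A) * (- m) + (B - x) * (- m)) / (B - A)"
    using A B x AB by (intro divide_right_mono add_mono mult_left_mono) (auto simp: g_def m_def)
  also have "\<dots> = - m" using AB by (simp add: field_simps)
  finally have "f x \<ge> m + K / 2 * (x - A) * (x - B)" by (simp add: g_def)
  moreover have "K / 2 * ((x - A) * (x - B)) \<ge> K / 2 * (- ((B - A)\<^sup>2 / 4))"
  proof (rule mult_left_mono)
    have "(x - A) * (x - B) + (B - A)\<^sup>2 / 4 = (x - (A + B) / 2)\<^sup>2"
      by (simp add: power2_eq_square field_simps)
    then show "- ((B - A)\<^sup>2 / 4) \<le> (x - A) * (x - B)" by (smt (verit) zero_le_power2)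
    show "0 \<le> K / 2" using K[of 0] by simp
  qed
  ultimately show ?thesis by (simp add: m_def mult.assoc)
qed

text \<open>Checks the hypothesis of \<open>nonneg_between\<close>, with \<open>K = 333\<close>, on
  consecutive grid points in units of 1/64. The second function exists so that each value of the witness
  is computed only once.\<close>

fun grid_check :: "int \<Rightarrow> int \<Rightarrow> int list \<Rightarrow> bool"
  and grid_step :: "int \<Rightarrow> int \<Rightarrow> int \<Rightarrow> int \<Rightarrow> int list \<Rightarrow> bool" where
  "grid_check T w [] = True"
| "grid_check T w (U # Us) = grid_step T w U (witness_low U) Us"
| "grid_step T w U v Us = (T < U \<and> U \<le> 3904 \<and> 333 * (U - T)^2 * 1000000000 \<le> 32768 * min w v \<and> grid_check U v Us)"

lemma grid_check_sound:
  assumes "grid_check T w Us" "w = witness_low T" "0 \<le> T" "T \<le> 3904"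
    "of_int T \<le> 64 * t" "64 * t \<le> of_int (last (T # Us))" "Us \<noteq> []"
  shows "0 \<le> witness t"
  using assms
proof (induction Us arbitrary: T w)
  case (Cons U Us)
  have c: "T < U" "U \<le> 3904" "333 * (U - T)^2 * 1000000000 \<le> 32768 * witness_low T"
      "333 * (U - T)^2 * 1000000000 \<le> 32768 * witness_low U" "grid_check U (witness_low U) Us"
    using Cons.prems by auto
  show ?case
  proof (cases "64 * t \<le> of_int U")
    case True
    have b: "333 * (real_of_int U / 64 - real_of_int T / 64)\<^sup>2 / 8 \<le> witness (of_int V / 64)"
      if "0 \<le> V" "V \<le> 3904" "333 * (U - T)^2 * 1000000000 \<le> 32768 * witness_low V" for V
    proof -
      have "real_of_int (333 * (U - T)^2 * 1000000000) \<le> real_of_int (32768 * witness_low V)"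
        using that(3) by (simp only: of_int_le_iff)
      then have "333 * (real_of_int U / 64 - real_of_int T / 64)\<^sup>2 / 8 \<le> of_int (witness_low V) / 10^9"
        by (simp add: power2_eq_square field_simps)
      then show ?thesis using witness_low[OF that(1,2)] by linarith
    qed
    show ?thesis
    proof (rule nonneg_between[OF witness_deriv witness'_deriv abs_witness''_le])
      show "real_of_int T / 64 < real_of_int U / 64" using c by simp
      show "333 * (real_of_int U / 64 - real_of_int T / 64)\<^sup>2 / 8 \<le> witness (of_int T / 64)"
        by (rule b) (use c Cons.prems in auto)
      show "333 * (real_of_int U / 64 - real_of_int T / 64)\<^sup>2 / 8 \<le> witness (of_int U / 64)"
        by (rule b) (use c Cons.prems in auto)
      show "real_of_int T / 64 \<le> t" "t \<le> real_of_int U / 64" using Cons.prems True by simp_all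
    qed
  next
    case False
    then have "Us \<noteq> []" using Cons.prems by auto
    then show ?thesis using Cons.IH[OF c(5) refl] c Cons.prems False by auto
  qed
qed simp

lemma grid_1: "grid_check 0 (witness_low 0) [73, 114, 155, 190, 211, 223, 230, 235, 240, 246, 255, 271, 299, 341, 381, 421, 479, 531, 569, 599, 620, 634, 643, 649, 654, 659, 665, 674, 690, 718]"
  by code_simp

lemma grid_2: "grid_check 718 (witness_low 718) [765, 823, 880, 924, 953, 974, 995, 1019, 1053, 1092, 1131, 1173, 1229, 1285, 1341, 1383, 1409, 1425, 1435, 1442, 1448, 1454, 1461, 1471, 1485, 1505, 1531, 1565, 1612, 1677]"
  by code_simp

lemma grid_3: "grid_check 1677 (witness_low 1677) [1723, 1758, 1788, 1816, 1844, 1875, 1915, 1961, 2004, 2047, 2100, 2155, 2202, 2237, 2259, 2273, 2283, 2294, 2305, 2321, 2347, 2389, 2444, 2502, 2551, 2586, 2617, 2648, 2683, 2724]"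
  by code_simp

lemma grid_4: "grid_check 2724 (witness_low 2724) [2767, 2815, 2866, 2917, 2970, 3016, 3055, 3090, 3122, 3154, 3186, 3226, 3280, 3332, 3378, 3419, 3455, 3491, 3532, 3581, 3625, 3669, 3718, 3766, 3812, 3856, 3895, 3904]"
  by code_simp

text \<open>The constant 0.64 is slightly above the limit \<open>2 / \<pi>\<close>.\<close>

lemma J0_decay_30:
  assumes "30 \<le> x"
  shows "x * (J0 x)\<^sup>2 \<le> 64/100"
proof -
  have p30: "bessel_poly 30 = [-86367984, 118751063, 41204807, -20227684, -3257906, 1029587, 102472, -24856, -1718, 349]" by code_simp
  have l: "coeffs_deriv (bessel_poly 30) = [118751063, 82409614, -60683052, -13031624, 5147935, 614832, -173992, -13744, 3141, 0]" unfolding p30 by code_simp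
  have "\<bar>J0 30 - (-86367984) / 10^9\<bar> \<le> 5 / 10^6" "\<bar>J0' 30 - (118751063) / 10^9\<bar> \<le> 5 / 10^6"
    using approximatesD[OF approximates_bessel_poly[of 30], of 30] unfolding l unfolding p30 by simp_all
  then have j: "- 8638/100000 \<le> J0 30" "J0 30 \<le> - 8636/100000" "11874/100000 \<le> J0' 30" "J0' 30 \<le> 11876/100000"
    unfolding abs_le_iff by simp_all
  have 1: "(J0 30)\<^sup>2 \<le> (8638/100000)\<^sup>2" using j by (intro power2_le_iff_abs_le[THEN iffD2]) auto
  have 2: "(J0' 30)\<^sup>2 \<le> (11876/100000)\<^sup>2" using j by (intro power2_le_iff_abs_le[THEN iffD2]) auto
  have "(8636/100000) * (11874/100000) \<le> (- J0 30) * J0' 30" using j by (intro mult_mono) auto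
  then have 3: "J0 30 * J0' 30 \<le> - ((8636/100000) * (11874/100000))" by simp
  have "x * (J0 x)\<^sup>2 \<le> 30 * ((J0 30)\<^sup>2 + (J0' 30)\<^sup>2) + J0 30 * J0' 30 + (J0 30)\<^sup>2 / (2 * 30)"
    by (rule J0_decay) (use assms in auto)
  then show ?thesis using 1 2 3 by (simp add: power2_eq_square)
qed

lemma witness_tail:
  assumes t: "61 \<le> t"
  shows "0 \<le> witness t"
proof -
  have J: "\<bar>J0 (r * t)\<bar> \<le> b" if "enclosed (r, a) (R, a')" "64/100 * 2^20 \<le> b\<^sup>2 * (61 * of_int R)" "0 \<le> b" "516000 \<le> R" for r b R a a'
  proof -
    have R: "of_int R / 2^20 \<le> r" using that(1) by (simp add: enclosed_def)
    have "of_int R / 2^20 * 61 \<le> r * t" using R t that(4) by (intro mult_mono) auto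
    moreover have "30 \<le> real_of_int R / 2^20 * 61" using that(4) by simp
    ultimately have rt: "30 \<le> r * t" "of_int R / 2^20 * 61 \<le> r * t" by linarith+
    have "of_int R / 2^20 * 61 * (J0 (r * t))\<^sup>2 \<le> r * t * (J0 (r * t))\<^sup>2"
      using rt by (intro mult_right_mono) auto
    also have "\<dots> \<le> 64/100" by (rule J0_decay_30[OF rt(1)])
    also have "\<dots> \<le> of_int R / 2^20 * 61 * b\<^sup>2" using that(2) by (simp add: field_simps)
    finally have "(J0 (r * t))\<^sup>2 \<le> b\<^sup>2" using that(4) by (simp add: mult_le_cancel_left)
    then show ?thesis using that(3) by (simp add: abs_le_square_iff[symmetric])
  qed
  have b1: "\<bar>J0 (radius (8, -4) * t)\<bar> \<le> 1425 / 10000"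
    by (rule J[OF enclosures(1)]) (simp_all add: power2_eq_square)
  have b2: "\<bar>J0 (radius (16, -8) * t)\<bar> \<le> 1198 / 10000"
    by (rule J[OF enclosures(2)]) (simp_all add: power2_eq_square)
  have b3: "\<bar>J0 (radius (24, -12) * t)\<bar> \<le> 1083 / 10000"
    by (rule J[OF enclosures(3)]) (simp_all add: power2_eq_square)
  have b4: "\<bar>J0 (radius (8, 0) * t)\<bar> \<le> 862 / 10000"
    by (rule J[OF enclosures(4)]) (simp_all add: power2_eq_square)
  have b5: "\<bar>J0 (radius (16, -4) * t)\<bar> \<le> 836 / 10000"
    by (rule J[OF enclosures(5)]) (simp_all add: power2_eq_square)
  have b6: "\<bar>J0 (radius (12, 0) * t)\<bar> \<le> 779 / 10000"
    by (rule J[OF enclosures(6)]) (simp_all add: power2_eq_square)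
  have b7: "\<bar>J0 (radius (8, 4) * t)\<bar> \<le> 738 / 10000"
    by (rule J[OF enclosures(7)]) (simp_all add: power2_eq_square)
  have b8: "\<bar>J0 (radius (16, 4) * t)\<bar> \<le> 663 / 10000"
    by (rule J[OF enclosures(8)]) (simp_all add: power2_eq_square)
  have b9: "\<bar>J0 (radius (16, 8) * t)\<bar> \<le> 621 / 10000"
    by (rule J[OF enclosures(9)]) (simp_all add: power2_eq_square)
  have b10: "\<bar>J0 (radius (4, 0) * t)\<bar> \<le> 1025 / 10000"
    by (rule J[OF enclosures(10)]) (simp_all add: power2_eq_square)
  show ?thesis unfolding witness_def radii_def spectrum_def
    using b1 b2 b3 b4 b5 b6 b7 b8 b9 b10 unfolding abs_le_iff by simp
qed

theorem witness_nonneg: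
  assumes "0 \<le> t"
  shows "0 \<le> witness t"
proof -
  \<comment> \<open>The grid is checked in four parts; 3904 = 64 * 61 is its last point.\<close>
  consider "64 * t \<le> 718" | "718 \<le> 64 * t" "64 * t \<le> 1677" | "1677 \<le> 64 * t" "64 * t \<le> 2724" | "2724 \<le> 64 * t" "64 * t \<le> 3904" | "61 \<le> t"
    by linarith
  then show ?thesis
  proof cases
    case 1 then show ?thesis using grid_check_sound[OF grid_1 refl, of t] assms by simp
  next
    case 2 then show ?thesis using grid_check_sound[OF grid_2 refl, of t] by simp
  next
    case 3 then show ?thesis using grid_check_sound[OF grid_3 refl, of t] by simp
  next
    case 4 then show ?thesis using grid_check_sound[OF grid_4 refl, of t] by simp
  next
    case 5 then show ?thesis by (rule witness_tail)
  qed
qed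

section \<open>Quadratic forms on independent sets\<close>

text \<open>A finite configuration as a list of vertices. A vertex consists of its position, in the
  integer coordinates of \<open>plane_point\<close>, its coefficient in the quadratic form, and the
  coefficients of its products with the later vertices; \<open>None\<close> marks a pair at distance
  1.\<close>

type_synonym block = "((int \<times> int \<times> int \<times> int) \<times> int \<times> int option list) list"

fun combine :: "int option \<Rightarrow> int option \<Rightarrow> int option" where
  "combine (Some a) (Some b) = Some (a + b)"
| "combine _ _ = None"

fun choose_vertex :: "int option list \<Rightarrow> (int option \<times> int option list) list \<Rightarrow> (int option \<times> int option list) list" where
  "choose_vertex [] r = r"
| "choose_vertex (e # es) [] = []"
| "choose_vertex (e # es) ((l, f) # r) = (combine e l, f) # choose_vertex es r"

lemma length_choose_vertex [simp]: "length (choose_vertex es r) = length r"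
  by (induction es r rule: choose_vertex.induct) auto

text \<open>Maximum of the quadratic form over independent sets by branching on the first vertex.
  Choosing a vertex adds its row to the linear coefficients of the later vertices; a linear coefficient
  \<open>None\<close> marks a vertex that is adjacent to a chosen one.\<close>

function max_form :: "(int option \<times> int option list) list \<Rightarrow> int" where
  "max_form [] = 0"
| "max_form ((None, es) # r) = max_form r"
| "max_form ((Some l, es) # r) = max (max_form r) (l + max_form (choose_vertex es r))"
  by pat_completeness auto
termination by (relation "Wellfounded.measure length") auto

fun weight :: "int option \<Rightarrow> int" where
  "weight None = 0" | "weight (Some a) = a"

fun row_qform :: "int option list \<Rightarrow> int list \<Rightarrow> int" where
  "row_qform (e # es) (x # xs) = weight e * x + row_qform es xs"
| "row_qform _ _ = 0"

fun qform :: "(int option \<times> int option list) list \<Rightarrow> int list \<Rightarrow> int" where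
  "qform ((l, es) # r) (x # xs) = weight l * x + x * row_qform es xs + qform r xs"
| "qform _ _ = 0"

fun row_ok :: "int option list \<Rightarrow> int list \<Rightarrow> bool" where
  "row_ok (e # es) (x # xs) = ((e = None \<longrightarrow> x = 0) \<and> row_ok es xs)"
| "row_ok _ _ = True"

fun independent_vector :: "(int option \<times> int option list) list \<Rightarrow> int list \<Rightarrow> bool" where
  "independent_vector [] xs = (xs = [])"
| "independent_vector ((l, es) # r) [] = False"
| "independent_vector ((l, es) # r) (x # xs) = ((x = 0 \<or> x = 1) \<and> (l = None \<longrightarrow> x = 0) \<and> (x = 1 \<longrightarrow> row_ok es xs) \<and> length es = length r \<and> independent_vector r xs)"

lemma choose_vertex_independent:
  "independent_vector r xs \<Longrightarrow> row_ok es xs \<Longrightarrow> length es = length r \<Longrightarrow> independent_vector (choose_vertex es r) xs"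
proof (induction es r arbitrary: xs rule: choose_vertex.induct)
  case (3 e es l f r)
  obtain x ys where xs: "xs = x # ys" using 3(2) by (cases xs) auto
  have "combine e l = None \<longrightarrow> x = 0" using 3(2,3) by (cases e; cases l) (auto simp: xs)
  then show ?case using 3 by (auto simp: xs)
qed auto

lemma choose_vertex_qform:
  "independent_vector r xs \<Longrightarrow> row_ok es xs \<Longrightarrow> length es = length r \<Longrightarrow> qform (choose_vertex es r) xs = row_qform es xs + qform r xs"
proof (induction es r arbitrary: xs rule: choose_vertex.induct)
  case (3 e es l f r)
  obtain x ys where xs: "xs = x # ys" using 3(2) by (cases xs) auto
  have "weight (combine e l) * x = weight e * x + weight l * x"
    using 3(2,3) by (cases e; cases l) (auto simp: xs algebra_simps)
  then show ?case using 3 by (auto simp: xs algebra_simps)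
qed auto

lemma qform_le_max_form: "independent_vector r xs \<Longrightarrow> qform r xs \<le> max_form r"
proof (induction r arbitrary: xs rule: max_form.induct)
  case (2 es r)
  then show ?case by (cases xs) auto
next
  case (3 l es r)
  obtain x ys where xs: "xs = x # ys" using 3(3) by (cases xs) auto
  show ?case
  proof (cases "x = 0")
    case True
    then show ?thesis using 3 by (auto simp: xs le_max_iff_disj)
  next
    case False
    then have x: "x = 1" and ok: "row_ok es ys" "length es = length r" "independent_vector r ys" using 3(3) by (auto simp: xs)
    have "qform (choose_vertex es r) ys \<le> max_form (choose_vertex es r)"
      by (rule 3(2)[OF choose_vertex_independent[OF ok(3,1,2)]])
    then show ?thesis using choose_vertex_qform[OF ok(3,1,2)] by (simp add: xs x le_max_iff_disj)
  qed
qed simp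

text \<open>The sum of the rhombus with vertices \<open>0, 1, \<omega>, 1 + \<omega>\<close>, where
  \<open>\<omega> = cis (\<pi>/3)\<close>, and its rotation by \<open>\<pi>/6\<close>.\<close>

definition rhombi :: block where
  "rhombi = [
   ((0, 0, 0, 0), -1, [None, None, Some 0, None, Some 4, Some (-3), Some 4, None, Some 4, Some (-3), Some 10, Some 0, Some 6, Some (-3), Some 0]),
   ((0, 1, 1, 0), -4, [None, None, Some (-1), None, Some 0, Some (-1), Some (-1), None, Some 0, Some 5, Some 5, Some 6, Some 12, Some 5]),
   ((0, 0, 2, 0), 0, [None, Some (-4), Some (-6), None, Some 4, Some (-4), Some (-6), None, Some 10, Some 9, Some 0, Some 6, Some 10]),
   ((0, 1, 3, 0), -2, [Some 1, Some 1, Some 1, None, Some 1, Some 1, Some 1, None, Some 0, Some 1, Some 1, Some 0]),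
   ((2, 0, 0, 0), 4, [None, None, Some 5, None, Some (-2), Some (-9), Some 3, None, Some 6, Some (-3), Some 11]),
   ((2, 1, 1, 0), 8, [None, None, Some 0, None, Some (-7), Some (-2), Some 0, None, Some 0, Some 5]),
   ((2, 0, 2, 0), 15, [None, Some (-7), Some (-7), None, Some (-2), Some 0, Some (-6), None, Some 5]),
   ((2, 1, 3, 0), 1, [Some 7, Some 0, Some 0, None, Some 0, Some (-5), Some (-5), None]),
   ((1, 0, 0, 1), 8, [None, None, Some 5, None, Some 0, Some (-9), Some 0]),
   ((1, 1, 1, 1), 8, [None, None, Some 5, None, Some 0, Some 0]),
   ((1, 0, 2, 1), 15, [None, Some 5, Some (-6), None, Some 0]),
   ((1, 1, 3, 1), -3, [Some 5, Some (-5), Some (-5), None]),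
   ((3, 0, 0, 1), -5, [None, None, Some 0]),
   ((3, 1, 1, 1), 5, [None, None]),
   ((3, 0, 2, 1), 8, [None]),
   ((3, 1, 3, 1), -5, [])]"

text \<open>An equilateral triangle with vertices \<open>x\<^sub>1, x\<^sub>2, x\<^sub>3\<close> and,
  first in the list, its centre \<open>x\<^sub>0\<close>. Up to the factor 8 the inequality is
  \<open>x\<^sub>0 (x\<^sub>1 + x\<^sub>2 + x\<^sub>3) \<le> x\<^sub>0 + x\<^sub>1 x\<^sub>2 + x\<^sub>1
  x\<^sub>3 + x\<^sub>2 x\<^sub>3\<close>, which holds for all 0-1 vectors.\<close>

definition triangle :: block where
  "triangle = [((-1, 0, 0, -1), -8, [Some 8, Some 8, Some 8]),
   ((0, -1, -1, 0), 0, [Some (-8), Some (-8)]),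
   ((0, 0, 2, -2), 0, [Some (-8)]),
   ((-3, 1, -1, -1), 0, [])]"

definition config :: "block \<Rightarrow> (int option \<times> int option list) list" where
  "config b = map (\<lambda>(p, u, es). (Some u, es)) b"

lemma max_form_rhombi: "max_form (config rhombi) = 16" by code_simp
lemma max_form_triangle: "max_form (config triangle) = 0" by code_simp

text \<open>Four times the squared distance is \<open>m + n sqrt 3\<close>, where \<open>(m, n)\<close>
  is the key.\<close>

fun dist_key :: "int \<times> int \<times> int \<times> int \<Rightarrow> int \<times> int \<times> int \<times> int \<Rightarrow> int \<times> int" where
  "dist_key (a, b, c, d) (a', b', c', d') =
     ((a - a')^2 + 3 * (b - b')^2 + (c - c')^2 + 3 * (d - d')^2, 2 * (a - a') * (b - b') + 2 * (c - c') * (d - d'))"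

fun row_terms :: "int \<times> int \<times> int \<times> int \<Rightarrow> int option list \<Rightarrow> block \<Rightarrow> ((int \<times> int) \<times> int) list" where
  "row_terms p (Some a # es) ((q, u, f) # r) = (if a = 0 then row_terms p es r else (dist_key p q, a) # row_terms p es r)"
| "row_terms p (None # es) ((q, u, f) # r) = row_terms p es r"
| "row_terms p _ _ = []"

fun pair_terms :: "block \<Rightarrow> ((int \<times> int) \<times> int) list" where
  "pair_terms [] = []"
| "pair_terms ((p, u, es) # r) = row_terms p es r @ pair_terms r"

fun row_unit :: "int \<times> int \<times> int \<times> int \<Rightarrow> int option list \<Rightarrow> block \<Rightarrow> bool" where
  "row_unit p (None # es) ((q, u, f) # r) = (dist_key p q = (4, 0) \<and> row_unit p es r)"
| "row_unit p (Some a # es) ((q, u, f) # r) = row_unit p es r"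
| "row_unit p [] [] = True"
| "row_unit p _ _ = False"

fun unit_edges :: "block \<Rightarrow> bool" where
  "unit_edges [] = True"
| "unit_edges ((p, u, es) # r) = (row_unit p es r \<and> unit_edges r)"

lemma unit_edges_rhombi: "unit_edges rhombi" and unit_edges_triangle: "unit_edges triangle"
  by code_simp+

fun coefficient_of :: "(int \<times> int) \<Rightarrow> ((int \<times> int) \<times> int) list \<Rightarrow> int" where
  "coefficient_of k [] = 0"
| "coefficient_of k ((k', a) # r) = (if k = k' then a + coefficient_of k r else coefficient_of k r)"

definition all_keys :: "(int \<times> int) list" where
  "all_keys = [(8, -4), (16, -8), (24, -12), (8, 0), (16, -4), (12, 0), (8, 4), (16, 4), (16, 8)]"

text \<open>Among the pairs with a nonzero coefficient, the two configurations together have exactly the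
  distances of the witness other than 1, with the coefficients listed in \<open>spectrum\<close>.\<close>

lemma pair_terms_blocks:
  "list_all (\<lambda>(k, a). k \<in> set all_keys) (pair_terms rhombi @ pair_terms triangle)"
  "map (\<lambda>k. coefficient_of k (pair_terms rhombi @ pair_terms triangle)) all_keys = [-3, 7, -24, -32, 35, 22, 7, 9, 37]"
  by code_simp+

lemma sum_by_key:
  assumes "list_all (\<lambda>(k, a). k \<in> set ks) l" "distinct ks"
  shows "(\<Sum>(k, a)\<leftarrow>l. of_int a * g k) = (\<Sum>k\<leftarrow>ks. of_int (coefficient_of k l) * (g k :: real))"
  using assms(1)
proof (induction l)
  case Nil
  then show ?case by simp
next
  case (Cons p l)
  obtain k a where p: "p = (k, a)" by (cases p)
  have k: "k \<in> set ks" using Cons by (simp add: p)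
  have "(\<Sum>k'\<leftarrow>ks. of_int (coefficient_of k' (p # l)) * g k')
     = (\<Sum>k'\<leftarrow>ks. (if k' = k then of_int a * g k else 0) + of_int (coefficient_of k' l) * g k')"
    by (intro arg_cong[where f = sum_list] map_cong) (auto simp: p algebra_simps)
  also have "\<dots> = (\<Sum>k'\<in>set ks. if k' = k then of_int a * g k else 0) + (\<Sum>k'\<leftarrow>ks. of_int (coefficient_of k' l) * g k')"
    by (simp add: sum_list_addf sum_list_distinct_conv_sum_set assms(2))
  also have "(\<Sum>k'\<in>set ks. if k' = k then of_int a * g k else 0) = of_int a * g k"
    using k by simp
  finally show ?case using Cons by (simp add: p)
qed

lemma sum_weights: "(\<Sum>(p, u, es)\<leftarrow>rhombi. u) = 52" "(\<Sum>(p, u, es)\<leftarrow>triangle. u) = - 8"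
  by (simp_all add: rhombi_def triangle_def)

section \<open>Overlaps of a set with its translates\<close>

definition overlap :: "complex set \<Rightarrow> complex set \<Rightarrow> complex \<Rightarrow> real" where
  "overlap K L z = measure lborel (K \<inter> (\<lambda>x. x + z) -` L)"

lemma shift_borel [measurable]: "L \<in> sets borel \<Longrightarrow> (\<lambda>x. x + z) -` L \<in> sets (borel :: complex measure)"
  using measurable_sets[of "\<lambda>x::complex. x + z" borel borel L] by simp

lemma emeasure_shift:
  assumes "L \<in> sets borel"
  shows "emeasure lborel ((\<lambda>x. x + z) -` L) = emeasure lborel (L :: complex set)"
proof -
  have "emeasure lborel L = emeasure (distr lborel borel ((+) z)) L" by (simp add: lborel_distr_plus)
  also have "\<dots> = emeasure lborel ((+) z -` L)" using assms by (subst emeasure_distr) auto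
  also have "(+) z = (\<lambda>x. x + z)" by (auto simp: add.commute)
  finally show ?thesis by simp
qed

lemma measure_shift: "L \<in> sets borel \<Longrightarrow> measure lborel ((\<lambda>x. x + z) -` L) = measure lborel (L :: complex set)"
  by (simp add: measure_def emeasure_shift)

lemma compact_borel_finite: "compact K \<Longrightarrow> K \<in> sets borel \<and> emeasure lborel (K :: complex set) < \<infinity>"
  using emeasure_compact_finite[of K] borel_compact[of K] by (auto simp: less_top)

lemma has_integral_overlap:
  assumes "K \<in> sets borel" "emeasure lborel (K :: complex set) < \<infinity>" "L \<in> sets borel"
  shows "has_bochner_integral lborel (\<lambda>x. indicator K x * indicator L (x + z)) (overlap K L z)"
proof -
  have m: "K \<inter> (\<lambda>x. x + z) -` L \<in> sets borel" using assms by simp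
  have "emeasure lborel (K \<inter> (\<lambda>x. x + z) -` L) \<le> emeasure lborel K" using assms by (intro emeasure_mono) auto
  then have "emeasure lborel (K \<inter> (\<lambda>x. x + z) -` L) < \<infinity>" using assms(2) by (meson le_less_trans)
  then have "has_bochner_integral lborel (indicator (K \<inter> (\<lambda>x. x + z) -` L)) (overlap K L z)"
    unfolding overlap_def using m by (intro has_bochner_integral_real_indicator) auto
  moreover have "indicator (K \<inter> (\<lambda>x. x + z) -` L) = (\<lambda>x. indicator K x * indicator L (x + z) :: real)"
    by (auto simp: indicator_def)
  ultimately show ?thesis by simp
qed

text \<open>The two translates of \<open>L\<close> differ only by a translate of the set on the
  right.\<close>

lemma overlap_diff_le:
  assumes K: "compact K" and L: "compact L"
  shows "overlap K L z - overlap K L z' \<le> measure lborel ((\<lambda>x. x + (z - z')) -` L - L)"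
proof -
  note [measurable] = compact_borel_finite[OF K, THEN conjunct1] compact_borel_finite[OF L, THEN conjunct1]
  let ?X = "(\<lambda>x. x + (z - z')) -` L - L"
  have [measurable]: "?X \<in> sets borel" by measurable
  have f: "emeasure lborel S < \<infinity> \<Longrightarrow> S \<in> fmeasurable lborel" if "S \<in> sets borel" for S :: "complex set"
    using that by (auto simp: fmeasurable_def)
  have fX: "(\<lambda>x. x + z') -` ?X \<in> fmeasurable lborel"
  proof (rule f)
    have "emeasure lborel ((\<lambda>x. x + z') -` ?X) = emeasure lborel ?X" by (rule emeasure_shift) measurable
    also have "\<dots> \<le> emeasure lborel ((\<lambda>x. x + (z - z')) -` L)" by (rule emeasure_mono) auto
    also have "\<dots> = emeasure lborel L" by (rule emeasure_shift) measurable
    also have "\<dots> < \<infinity>" using compact_borel_finite[OF L] by simp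
    finally show "emeasure lborel ((\<lambda>x. x + z') -` ?X) < \<infinity>" .
  qed measurable
  have fK: "K \<inter> (\<lambda>x. x + z') -` L \<in> fmeasurable lborel"
    by (rule fmeasurableI2[OF f]) (use compact_borel_finite[OF K] in auto)
  have "overlap K L z \<le> measure lborel ((K \<inter> (\<lambda>x. x + z') -` L) \<union> (\<lambda>x. x + z') -` ?X)"
    unfolding overlap_def by (rule measure_mono_fmeasurable) (use fK fX in \<open>auto simp: algebra_simps\<close>)
  also have "\<dots> \<le> overlap K L z' + measure lborel ((\<lambda>x. x + z') -` ?X)"
    unfolding overlap_def by (rule measure_Un_le) (use fK fX in auto)
  also have "measure lborel ((\<lambda>x. x + z') -` ?X) = measure lborel ?X" by (rule measure_shift) measurable
  finally show ?thesis by simp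
qed

text \<open>Enclose \<open>L\<close> in an open set \<open>U\<close> of almost the same measure. Small
  translates of \<open>L\<close> stay inside \<open>U\<close>.\<close>

lemma translation_continuity:
  fixes L :: "complex set"
  assumes L: "compact L" and e: "e > 0"
  obtains d where "d > 0" "\<And>w. norm w < d \<Longrightarrow> measure lborel ((\<lambda>x. x + w) -` L - L) < (e::real)"
proof -
  have Lb: "L \<in> sets borel" "emeasure lborel L < \<infinity>" using compact_borel_finite[OF L] by auto
  have "L \<in> lmeasurable" using L by (rule lmeasurable_compact)
  then obtain U where U: "open U" "L \<subseteq> U" "U - L \<in> lmeasurable" "emeasure lebesgue (U - L) < ennreal e"
    using sets_lebesgue_outer_open[OF _ e, of L] by (metis fmeasurableD)
  then have Ue: "measure lebesgue (U - L) < e"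
    using e by (simp add: emeasure_eq_measure2 ennreal_less_iff)
  obtain d where d: "d > 0" "(\<Union>x\<in>L. ball x d) \<subseteq> U"
    using compact_subset_open_imp_ball_epsilon_subset[OF L U(1,2)] by blast
  have "measure lborel ((\<lambda>x. x + w) -` L - L) < e" if w: "norm w < d" for w
  proof -
    have UL: "U - L \<in> sets borel" using U Lb by auto
    have sub: "(\<lambda>x. x + w) -` L - L \<subseteq> U - L"
    proof
      fix x assume x: "x \<in> (\<lambda>x. x + w) -` L - L"
      then have "x \<in> ball (x + w) d" using w by (simp add: dist_norm)
      then show "x \<in> U - L" using d x by blast
    qed
    have "measure lebesgue ((\<lambda>x. x + w) -` L - L) \<le> measure lebesgue (U - L)"
    proof (rule measure_mono_fmeasurable[OF sub _ U(3)])
      have "(\<lambda>x. x + w) -` L - L \<in> sets borel" using Lb by measurable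
      then show "(\<lambda>x. x + w) -` L - L \<in> sets lebesgue" by simp
    qed
    moreover have "(\<lambda>x. x + w) -` L - L \<in> sets lborel" using Lb by simp
    ultimately show ?thesis using Ue by (simp add: measure_completion)
  qed
  then show ?thesis using that d(1) by blast
qed

lemma overlap_continuous:
  assumes "compact K" "compact L"
  shows "continuous_on UNIV (overlap K L)"
  unfolding continuous_on_iff
proof (intro ballI allI impI)
  fix z :: complex and e :: real assume "e > 0"
  then obtain d where d: "d > 0" "\<And>w. norm w < d \<Longrightarrow> measure lborel ((\<lambda>x. x + w) -` L - L) < e"
    using translation_continuity[OF assms(2)] by blast
  show "\<exists>d>0. \<forall>z'\<in>UNIV. dist z' z < d \<longrightarrow> dist (overlap K L z') (overlap K L z) < e"
  proof (intro exI conjI ballI impI)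
    fix z' assume "dist z' z < d"
    then have "norm (z' - z) < d" "norm (z - z') < d" by (auto simp: dist_norm norm_minus_commute)
    then have "overlap K L z' - overlap K L z < e" "overlap K L z - overlap K L z' < e"
      using overlap_diff_le[OF assms, of z' z] overlap_diff_le[OF assms, of z z'] d(2) by (meson le_less_trans)+
    then show "dist (overlap K L z') (overlap K L z) < e" by (simp add: dist_real_def)
  qed (use d in auto)
qed

definition square :: "real \<Rightarrow> complex set" where
  "square R = cbox (Complex (-R) (-R)) (Complex R R)"

lemma square_iff: "z \<in> square R \<longleftrightarrow> \<bar>Re z\<bar> \<le> R \<and> \<bar>Im z\<bar> \<le> R"
  by (auto simp: square_def mem_box Basis_complex_def inner_complex_def)

lemma compact_square: "compact (square R)" by (simp add: square_def)

lemma measure_square: "0 \<le> R \<Longrightarrow> measure lborel (square R) = 4 * R\<^sup>2"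
  unfolding square_def
  by (subst measure_lborel_cbox_eq) (auto simp: Basis_complex_def inner_complex_def power2_eq_square)

text \<open>Every point that is lost lies in the frame of width 3 between two concentric squares, or in a
  translate of it.\<close>

lemma overlap_square_bounds:
  assumes K: "compact K" "K \<subseteq> square R" and R: "3 \<le> R" and z: "norm z \<le> 3"
  shows "measure lborel K - 24 * R \<le> overlap K (square R) z" "overlap K (square R) z \<le> measure lborel K"
    and "measure lborel K - 24 * R \<le> overlap (square R) K z" "overlap (square R) K z \<le> measure lborel K"
proof -
  let ?Q = "square R" and ?Q' = "square (R - 3)"
  note [measurable] = compact_borel_finite[OF K(1), THEN conjunct1] compact_borel_finite[OF compact_square, THEN conjunct1]
  have f: "S \<in> fmeasurable lborel" if "compact S" for S :: "complex set"
    using compact_borel_finite[OF that] by (auto simp: fmeasurable_def)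
  have fs: "(\<lambda>x. x + z) -` S \<in> fmeasurable lborel" if "compact S" for S :: "complex set"
    using compact_borel_finite[OF that] by (auto simp: fmeasurable_def emeasure_shift)
  have zc: "\<bar>Re z\<bar> \<le> 3" "\<bar>Im z\<bar> \<le> 3" using z abs_Re_le_cmod[of z] abs_Im_le_cmod[of z] by linarith+
  have gap: "measure lborel (?Q - ?Q') \<le> 24 * R"
  proof -
    have "measure lborel (?Q - ?Q') = measure lborel ?Q - measure lborel ?Q'"
      by (rule measurable_measure_Diff) (use f compact_square in \<open>auto simp: square_iff\<close>)
    also have "\<dots> \<le> 24 * R" using R by (simp add: measure_square power2_eq_square algebra_simps)
    finally show ?thesis .
  qed
  have fQ: "?Q - ?Q' \<in> fmeasurable lborel" using f compact_square by (auto intro: fmeasurable.Diff)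
  have fI: "S \<inter> T \<in> fmeasurable lborel" if "S \<in> fmeasurable lborel" "T \<in> fmeasurable lborel" for S T :: "complex set"
    using that by (auto intro: fmeasurable.Int)
  have "measure lborel K \<le> measure lborel ((K \<inter> (\<lambda>x. x + z) -` ?Q) \<union> (?Q - ?Q'))"
  proof (rule measure_mono_fmeasurable)
    show "K \<subseteq> (K \<inter> (\<lambda>x. x + z) -` ?Q) \<union> (?Q - ?Q')" using K(2) zc by (auto simp: square_iff)
  qed (use f[OF K(1)] fI[OF f[OF K(1)] fs[OF compact_square]] fQ in auto)
  also have "\<dots> \<le> overlap K ?Q z + measure lborel (?Q - ?Q')"
    unfolding overlap_def by (rule measure_Un_le) (use fI[OF f[OF K(1)] fs[OF compact_square]] fQ in auto)
  finally show "measure lborel K - 24 * R \<le> overlap K (square R) z" using gap by linarith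
  show "overlap K (square R) z \<le> measure lborel K"
    unfolding overlap_def by (rule measure_mono_fmeasurable) (use f[OF K(1)] in auto)
  have "measure lborel ((\<lambda>x. x + z) -` K) \<le> measure lborel ((?Q \<inter> (\<lambda>x. x + z) -` K) \<union> (\<lambda>x. x + z) -` (?Q - ?Q'))"
  proof (rule measure_mono_fmeasurable)
    show "(\<lambda>x. x + z) -` K \<subseteq> (?Q \<inter> (\<lambda>x. x + z) -` K) \<union> (\<lambda>x. x + z) -` (?Q - ?Q')"
    proof
      fix x assume x: "x \<in> (\<lambda>x. x + z) -` K"
      then have "x + z \<in> ?Q" using K(2) by auto
      moreover have "x + z \<in> ?Q' \<Longrightarrow> x \<in> ?Q" using zc by (auto simp: square_iff)
      ultimately show "x \<in> (?Q \<inter> (\<lambda>x. x + z) -` K) \<union> (\<lambda>x. x + z) -` (?Q - ?Q')" using x by auto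
    qed
    have e: "(\<lambda>x. x + z) -` (?Q - ?Q') = (\<lambda>x. x + z) -` ?Q - (\<lambda>x. x + z) -` ?Q'" by auto
    show "(?Q \<inter> (\<lambda>x. x + z) -` K) \<union> (\<lambda>x. x + z) -` (?Q - ?Q') \<in> fmeasurable lborel"
      unfolding e
      by (rule fmeasurable.Un[OF fI[OF f[OF compact_square] fs[OF K(1)]]
            fmeasurable.Diff[OF fs[OF compact_square] fs[OF compact_square]]])
  qed (use fs[OF K(1)] in auto)
  also have "\<dots> \<le> overlap ?Q K z + measure lborel ((\<lambda>x. x + z) -` (?Q - ?Q'))"
    unfolding overlap_def by (rule measure_Un_le) auto
  also have "measure lborel ((\<lambda>x. x + z) -` (?Q - ?Q')) = measure lborel (?Q - ?Q')"
    by (rule measure_shift) measurable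
  also have "measure lborel ((\<lambda>x. x + z) -` K) = measure lborel K" by (rule measure_shift) measurable
  finally show "measure lborel K - 24 * R \<le> overlap (square R) K z" using gap by linarith
  have "overlap (square R) K z \<le> measure lborel ((\<lambda>x. x + z) -` K)"
    unfolding overlap_def by (rule measure_mono_fmeasurable) (use fs[OF K(1)] in auto)
  then show "overlap (square R) K z \<le> measure lborel K" by (simp add: measure_shift)
qed

definition mean_overlap :: "complex set \<Rightarrow> real \<Rightarrow> real" where
  "mean_overlap B r = (\<integral>\<theta>. overlap B B (complex_of_real r * cis \<theta>) \<partial>angle)"

lemma integrable_angle:
  assumes "continuous_on UNIV (f :: complex \<Rightarrow> real)" "\<And>z. \<bar>f z\<bar> \<le> c"
  shows "integrable angle (\<lambda>\<theta>. f (w * cis \<theta>))"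
proof -
  interpret prob_space angle by (rule prob_space_angle)
  have "continuous_on UNIV (\<lambda>\<theta>. f (w * cis \<theta>))"
    by (rule continuous_on_compose2[OF assms(1)]) (auto intro!: continuous_intros)
  then have "(\<lambda>\<theta>. f (w * cis \<theta>)) \<in> borel_measurable angle"
    by (subst measurable_cong_sets[OF sets_angle refl]) (rule borel_measurable_continuous_onI)
  then show ?thesis using assms(2) by (intro integrable_const_bound[where B = c]) auto
qed

lemma overlap_nonneg: "0 \<le> overlap K L z" by (simp add: overlap_def)

lemma overlap_le: "compact K \<Longrightarrow> compact L \<Longrightarrow> overlap K L z \<le> measure lborel K"
proof -
  assume K: "compact K" and L: "compact L"
  note [measurable] = compact_borel_finite[OF K, THEN conjunct1] compact_borel_finite[OF L, THEN conjunct1]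
  show ?thesis unfolding overlap_def
    by (rule measure_mono_fmeasurable) (use compact_borel_finite[OF K] in \<open>auto simp: fmeasurable_def\<close>)
qed

text \<open>Positive definiteness applied to \<open>1\<^sub>B - d 1\<^sub>Q\<close>. For a short vector
  \<open>z\<close> the mixed terms of the autocorrelation are \<open>|B|\<close>, and the square term is
  \<open>|Q|\<close>, each up to \<open>24 R\<close>.\<close>

lemma positivity_of_mean_overlaps:
  fixes L :: "(real \<times> real) list"
  assumes B: "compact B" "B \<subseteq> square R" and R: "3 \<le> R" and d: "0 \<le> d" "d \<le> 1"
    and L: "\<And>r a. (r, a) \<in> set L \<Longrightarrow> 0 \<le> r \<and> r \<le> 3"
    and W: "\<And>t. 0 \<le> t \<Longrightarrow> 0 \<le> (\<Sum>(r, a)\<leftarrow>L. a * J0 (r * t))"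
  shows "0 \<le> (\<Sum>(r, a)\<leftarrow>L. a * (mean_overlap B r - 2 * d * measure lborel B + d\<^sup>2 * (4 * R\<^sup>2)) + \<bar>a\<bar> * (72 * R))"
proof -
  let ?Q = "square R"
  define h where "h x = indicator B x - d * indicator ?Q x" for x :: complex
  note Bf = compact_borel_finite[OF B(1)] and Qf = compact_borel_finite[OF compact_square, of R]
  note [measurable] = Bf[THEN conjunct1] Qf[THEN conjunct1]
  have ov: "corr h z = overlap B B z - d * overlap B ?Q z - d * overlap ?Q B z + d\<^sup>2 * overlap ?Q ?Q z" for z
  proof -
    have "has_bochner_integral lborel (\<lambda>x. indicator B x * indicator B (x + z) - d * (indicator B x * indicator ?Q (x + z))
       - d * (indicator ?Q x * indicator B (x + z)) + d\<^sup>2 * (indicator ?Q x * indicator ?Q (x + z)))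
       (overlap B B z - d * overlap B ?Q z - d * overlap ?Q B z + d\<^sup>2 * overlap ?Q ?Q z)"
      by (intro has_bochner_integral_add has_bochner_integral_diff has_bochner_integral_mult_right has_integral_overlap)
         (use Bf Qf in auto)
    moreover have "(\<lambda>x. indicator B x * indicator B (x + z) - d * (indicator B x * indicator ?Q (x + z))
       - d * (indicator ?Q x * indicator B (x + z)) + d\<^sup>2 * (indicator ?Q x * indicator ?Q (x + z))) = (\<lambda>x. h x * h (x + z))"
      by (auto simp: h_def algebra_simps power2_eq_square)
    ultimately show ?thesis unfolding corr_def by (simp add: has_bochner_integral_integral_eq)
  qed
  interpret test_function h "2 * R"
  proof
    show "h \<in> borel_measurable borel" unfolding h_def[abs_def] by measurable
    show "\<bar>h x\<bar> \<le> 1" for x using d by (auto simp: h_def indicator_def)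
    show "h x = 0" if "2 * R < norm x" for x
    proof -
      have "x \<notin> ?Q" using that cmod_le[of x] by (auto simp: square_iff)
      then show ?thesis using B(2) by (auto simp: h_def indicator_def)
    qed
  qed
  have cont: "continuous_on UNIV (corr h)"
    unfolding ov[abs_def] by (intro continuous_intros overlap_continuous B compact_square)
  have near: "\<bar>corr h z - (overlap B B z - 2 * d * measure lborel B + d\<^sup>2 * (4 * R\<^sup>2))\<bar> \<le> 72 * R" if z: "norm z \<le> 3" for z
  proof -
    note m1 = overlap_square_bounds[OF B R z] and m2 = overlap_square_bounds[OF compact_square order_refl R z]
    have 1: "\<bar>d * (overlap B ?Q z - measure lborel B)\<bar> \<le> 1 * (24 * R)"
      unfolding abs_mult by (intro mult_mono) (use m1 d R in auto)
    have 2: "\<bar>d * (overlap ?Q B z - measure lborel B)\<bar> \<le> 1 * (24 * R)"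
      unfolding abs_mult by (intro mult_mono) (use m1 d R in auto)
    have 3: "\<bar>d\<^sup>2 * (overlap ?Q ?Q z - 4 * R\<^sup>2)\<bar> \<le> 1 * (24 * R)"
      unfolding abs_mult by (intro mult_mono) (use m2 d R in \<open>auto simp: measure_square power_le_one\<close>)
    have "corr h z - (overlap B B z - 2 * d * measure lborel B + d\<^sup>2 * (4 * R\<^sup>2))
      = - (d * (overlap B ?Q z - measure lborel B)) - d * (overlap ?Q B z - measure lborel B) + d\<^sup>2 * (overlap ?Q ?Q z - 4 * R\<^sup>2)"
      by (simp add: ov algebra_simps)
    then show ?thesis using 1 2 3 unfolding abs_le_iff by linarith
  qed
  define M where "M r = (\<integral>\<theta>. corr h (complex_of_real r * cis \<theta>) \<partial>angle)" for r
  have Mnear: "\<bar>M r - (mean_overlap B r - 2 * d * measure lborel B + d\<^sup>2 * (4 * R\<^sup>2))\<bar> \<le> 72 * R" if r: "0 \<le> r" "r \<le> 3" for r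
  proof -
    let ?k = "- 2 * d * measure lborel B + d\<^sup>2 * (4 * R\<^sup>2)"
    have i1: "integrable angle (\<lambda>\<theta>. corr h (complex_of_real r * cis \<theta>))"
      by (rule integrable_angle[OF cont corr_bound])
    have i2: "integrable angle (\<lambda>\<theta>. overlap B B (complex_of_real r * cis \<theta>))"
      by (rule integrable_angle[OF overlap_continuous[OF B(1) B(1)], where c = "measure lborel B"])
         (use overlap_nonneg overlap_le[OF B(1) B(1)] in auto)
    have "M r - (mean_overlap B r + ?k) = (\<integral>\<theta>. corr h (complex_of_real r * cis \<theta>) - (overlap B B (complex_of_real r * cis \<theta>) + ?k) \<partial>angle)"
      unfolding M_def mean_overlap_def using i1 i2
      by (simp add: angle.prob_space[simplified])
    also have "\<bar>\<dots>\<bar> \<le> (\<integral>\<theta>. 72 * R \<partial>angle)"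
    proof -
      have "norm (\<integral>\<theta>. corr h (complex_of_real r * cis \<theta>) - (overlap B B (complex_of_real r * cis \<theta>) + ?k) \<partial>angle) \<le> (\<integral>\<theta>. 72 * R \<partial>angle)"
      proof (rule Bochner_Integration.integral_norm_bound_integral)
        show "norm (corr h (complex_of_real r * cis \<theta>) - (overlap B B (complex_of_real r * cis \<theta>) + ?k)) \<le> 72 * R" for \<theta>
          using near[of "complex_of_real r * cis \<theta>"] r by (simp add: norm_mult algebra_simps)
      qed (use i1 i2 in auto)
      then show ?thesis by simp
    qed
    finally show ?thesis by (simp add: angle.prob_space[simplified] algebra_simps)
  qed
  have "0 \<le> (\<Sum>i<length L. snd (L ! i) * M (fst (L ! i)))"
    unfolding M_def
    by (rule positive_definite_circle_means[OF _ cont])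
       (use W in \<open>auto simp: sum_list_sum_nth case_prod_unfold lessThan_atLeast0\<close>)
  also have "\<dots> = (\<Sum>(r, a)\<leftarrow>L. a * M r)"
    by (simp add: sum_list_sum_nth case_prod_unfold lessThan_atLeast0)
  also have "\<dots> \<le> (\<Sum>(r, a)\<leftarrow>L. a * (mean_overlap B r - 2 * d * measure lborel B + d\<^sup>2 * (4 * R\<^sup>2)) + \<bar>a\<bar> * (72 * R))"
  proof (rule sum_list_mono, clarify)
    fix r a assume "(r, a) \<in> set L"
    then have r: "0 \<le> r" "r \<le> 3" using L by auto
    let ?Y = "mean_overlap B r - 2 * d * measure lborel B + d\<^sup>2 * (4 * R\<^sup>2)"
    have "a * (M r - ?Y) \<le> \<bar>a * (M r - ?Y)\<bar>" by simp
    also have "\<dots> \<le> \<bar>a\<bar> * (72 * R)" unfolding abs_mult by (intro mult_left_mono Mnear r) auto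
    finally show "a * M r \<le> a * ?Y + \<bar>a\<bar> * (72 * R)" by (simp add: algebra_simps)
  qed
  finally show ?thesis .
qed

section \<open>Finite configurations\<close>

definition plane_point :: "int \<times> int \<times> int \<times> int \<Rightarrow> complex" where
  "plane_point = (\<lambda>(a, b, c, d). Complex ((of_int a + of_int b * sqrt 3) / 2) ((of_int c + of_int d * sqrt 3) / 2))"

lemma norm_plane_point_diff: "norm (plane_point p - plane_point q) = radius (dist_key p q)"
proof -
  obtain a b c d where p: "p = (a, b, c, d)" by (cases p)
  obtain a' b' c' d' where q: "q = (a', b', c', d')" by (cases q)
  have s: "sqrt 3 * sqrt 3 = (3::real)" by simp
  have s': "sqrt 3 * (sqrt 3 * x) = 3 * x" for x :: real by (simp add: mult.assoc[symmetric])
  show ?thesis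
    unfolding cmod_def p q plane_point_def radius_def dist_key.simps prod.case
    by (rule arg_cong[where f = sqrt]) (simp add: power2_eq_square field_simps s s')
qed

fun row_sum :: "('p \<Rightarrow> 'p \<Rightarrow> real) \<Rightarrow> 'p \<Rightarrow> int option list \<Rightarrow> ('p \<times> int \<times> int option list) list \<Rightarrow> real" where
  "row_sum g p (e # es) ((q, u, f) # r) = of_int (weight e) * g p q + row_sum g p es r"
| "row_sum g p _ _ = 0"

fun block_sum :: "('p \<Rightarrow> 'p \<Rightarrow> real) \<Rightarrow> ('p \<times> int \<times> int option list) list \<Rightarrow> real" where
  "block_sum g [] = 0"
| "block_sum g ((p, u, es) # r) = row_sum g p es r + block_sum g r"

lemma row_sum_integral:
  assumes "\<And>p q. has_bochner_integral M (\<lambda>x. g x p q) (G p q)"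
  shows "has_bochner_integral M (\<lambda>x. row_sum (g x) p es r) (row_sum G p es r)"
  using assms
  by (induction G p es r rule: row_sum.induct)
     (auto intro!: has_bochner_integral_add has_bochner_integral_mult_right)

lemma block_sum_integral:
  assumes "\<And>p q. has_bochner_integral M (\<lambda>x. g x p q) (G p q)"
  shows "has_bochner_integral M (\<lambda>x. block_sum (g x) b) (block_sum G b)"
  using assms
  by (induction G b rule: block_sum.induct)
     (auto intro!: has_bochner_integral_add row_sum_integral)

lemma row_sum_row_terms: "row_sum (\<lambda>p q. \<phi> (dist_key p q)) p es r = (\<Sum>(k, a)\<leftarrow>row_terms p es r. of_int a * \<phi> k)"
  by (induction p es r rule: row_terms.induct) auto

lemma block_sum_pair_terms: "block_sum (\<lambda>p q. \<phi> (dist_key p q)) b = (\<Sum>(k, a)\<leftarrow>pair_terms b. of_int a * \<phi> k)"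
  by (induction b rule: pair_terms.induct) (auto simp: row_sum_row_terms)

lemma row_sum_first: "row_sum (\<lambda>p' q. g p q) p es r = row_sum g p es r"
  by (induction g p es r rule: row_sum.induct) auto

lemma row_qform_row_sum:
  "of_int x * of_int (row_qform es (map (\<lambda>t. X (fst t)) r)) = row_sum (\<lambda>p q. of_int x * of_int (X q)) p es (r :: block)"
proof (induction es arbitrary: r)
  case (Cons e es)
  then show ?case by (cases r) (auto simp: algebra_simps)
qed simp

lemma qform_block_sum:
  "of_int (qform (config b) (map (\<lambda>t. X (fst t)) b))
    = (\<Sum>(p, u, es)\<leftarrow>b. of_int u * of_int (X p)) + block_sum (\<lambda>p q. of_int (X p) * of_int (X q)) b"
proof (induction b rule: pair_terms.induct)
  case (2 p u es r)
  show ?case using 2 row_qform_row_sum[of "X p" es X r p] row_sum_first[of "\<lambda>p q. of_int (X p) * of_int (X q)" p es r]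
    by (simp add: config_def algebra_simps)
qed (simp add: config_def)

lemma row_unit_length: "row_unit p es r \<Longrightarrow> length es = length r"
  by (induction p es r rule: row_unit.induct) auto

lemma row_unit_ok:
  "row_unit p es r \<Longrightarrow> (\<And>q. dist_key p q = (4, 0) \<Longrightarrow> X q = 0) \<Longrightarrow> row_ok es (map (\<lambda>t. X (fst t)) r)"
  by (induction p es r rule: row_unit.induct) auto

lemma independent_config:
  assumes "unit_edges b" "\<And>p. X p = 0 \<or> X p = 1" "\<And>p q. dist_key p q = (4, 0) \<Longrightarrow> X p = 1 \<Longrightarrow> X q = 0"
  shows "independent_vector (config b) (map (\<lambda>t. X (fst t)) b)"
  using assms(1)
proof (induction b rule: pair_terms.induct)
  case (2 p u es r)
  then show ?case using row_unit_length[of p es r] row_unit_ok[of p es r X] assms(2)[of p] assms(3)[of p]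
    by (auto simp: config_def)
qed (simp add: config_def)

lemma qform_zero: "(\<And>x. x \<in> set xs \<Longrightarrow> x = 0) \<Longrightarrow> qform c xs = 0"
proof (induction c xs rule: qform.induct)
  case (1 l es r x xs)
  have "x = 0" using 1(2) by simp
  moreover have "qform r xs = 0" by (rule 1(1)) (use 1(2) in simp)
  ultimately show ?case by simp
qed auto

text \<open>The argument of \<open>z\<close> only shifts the angle over which the mean is taken.\<close>

lemma mean_overlap_rotate:
  assumes B: "compact B"
  shows "has_bochner_integral angle (\<lambda>\<theta>. overlap B B (cis \<theta> * z)) (mean_overlap B (norm z))"
proof -
  let ?F = "overlap B B"
  have cF: "continuous_on UNIV ?F" by (rule overlap_continuous[OF B B])
  have c: "continuous_on UNIV (\<lambda>\<theta>. ?F (w * cis \<theta>))" for w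
    by (rule continuous_on_compose2[OF cF]) (auto intro!: continuous_intros)
  have "complex_of_real (norm z) * cis (\<theta> + Arg z) = z * cis \<theta>" for \<theta>
    by (cases "z = 0") (simp_all add: cis_mult[symmetric] cis_Arg sgn_eq)
  then have "(\<integral>\<theta>. ?F (z * cis \<theta>) \<partial>angle) = circle_mean (\<lambda>\<theta>. ?F (complex_of_real (norm z) * cis (\<theta> + Arg z)))"
    using integral_angle[OF c, of z] by simp
  also have "\<dots> = circle_mean (\<lambda>\<theta>. ?F (complex_of_real (norm z) * cis \<theta>))"
    by (rule circle_mean_shift[OF c]) (simp add: cis_mult[symmetric])
  also have "\<dots> = mean_overlap B (norm z)"
    unfolding mean_overlap_def by (rule integral_angle[OF c, symmetric])
  finally have "(\<integral>\<theta>. ?F (z * cis \<theta>) \<partial>angle) = mean_overlap B (norm z)" .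
  moreover have "integrable angle (\<lambda>\<theta>. ?F (z * cis \<theta>))"
    by (rule integrable_angle[OF cF, where c = "measure lborel B"]) (use overlap_nonneg overlap_le[OF B B] in auto)
  ultimately show ?thesis by (simp add: has_bochner_integral_iff mult.commute)
qed

lemma overlap_two_shifts:
  assumes B: "compact B"
  shows "has_bochner_integral lborel (\<lambda>x. indicator B (x + v) * indicator B (x + w)) (overlap B B (w - v))"
proof -
  note Bf = compact_borel_finite[OF B]
  have "has_bochner_integral lborel (\<lambda>x. indicator B x * indicator B (x + (w - v))) (overlap B B (w - v))"
    by (rule has_integral_overlap) (use Bf in auto)
  then have d: "has_bochner_integral (distr lborel borel ((+) v)) (\<lambda>x. indicator B x * indicator B (x + (w - v))) (overlap B B (w - v))"
    by (simp add: lborel_distr_plus)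
  have [measurable]: "B \<in> sets borel" using Bf by simp
  have "has_bochner_integral lborel (\<lambda>x. indicator B (v + x) * indicator B (v + x + (w - v))) (overlap B B (w - v))"
    using d unfolding has_bochner_integral_iff
    by (subst (asm) integrable_distr_eq, simp, measurable, subst (asm) integral_distr, simp, measurable)
  then show ?thesis by (simp add: algebra_simps)
qed

text \<open>For each rotation \<open>\<theta>\<close> and translation \<open>x\<close> the copy of the
  configuration meets \<open>B\<close> in an independent set, so the form is at most \<open>M\<close>; it
  vanishes unless \<open>x\<close> lies in the slightly larger square. Integration over \<open>x\<close>
  turns products of indicators into overlaps, and averaging over \<open>\<theta>\<close> turns overlaps
  into their circle means.\<close>

lemma block_inequality:
  assumes B: "compact B" "B \<subseteq> square R" and R: "0 \<le> R"
    and avoid: "\<And>x y. x \<in> B \<Longrightarrow> y \<in> B \<Longrightarrow> norm (x - y) \<noteq> 1"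
    and b: "unit_edges b" "max_form (config b) \<le> M" "0 \<le> M"
    and near: "\<And>p u es. (p, u, es) \<in> set b \<Longrightarrow> norm (plane_point p) \<le> 5"
  shows "of_int (\<Sum>(p, u, es)\<leftarrow>b. u) * measure lborel B + (\<Sum>(k, a)\<leftarrow>pair_terms b. of_int a * mean_overlap B (radius k))
     \<le> of_int M * (4 * (R + 5)\<^sup>2)"
proof -
  interpret prob_space angle by (rule prob_space_angle)
  note Bf = compact_borel_finite[OF B(1)]
  let ?U = "\<Sum>(p, u, es)\<leftarrow>b. u" and ?l = "measure lborel B"
  let ?G = "\<lambda>\<theta> p q. overlap B B (cis \<theta> * (plane_point q - plane_point p))"
  have fixed: "of_int ?U * ?l + block_sum (?G \<theta>) b \<le> of_int M * (4 * (R + 5)\<^sup>2)" for \<theta>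
  proof -
    define X where "X x p = (if x + cis \<theta> * plane_point p \<in> B then 1 else 0 :: int)" for x p
    have Xi: "of_int (X x p) = indicator B (x + cis \<theta> * plane_point p)" for x p by (simp add: X_def)
    let ?f = "\<lambda>x. real_of_int (qform (config b) (map (\<lambda>t. X x (fst t)) b))"
    have single: "has_bochner_integral lborel (\<lambda>x. of_int (X x p)) ?l" for p
    proof -
      have "has_bochner_integral lborel (\<lambda>x. indicator B (x + cis \<theta> * plane_point p) * indicator B (x + cis \<theta> * plane_point p)) (overlap B B 0)"
        using overlap_two_shifts[OF B(1), of "cis \<theta> * plane_point p" "cis \<theta> * plane_point p"] by simp
      moreover have "overlap B B 0 = ?l" by (simp add: overlap_def)
      moreover have "indicator B y * indicator B y = (indicator B y :: real)" for y :: complex by (simp add: indicator_def)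
      ultimately show ?thesis by (simp add: Xi)
    qed
    have singles: "has_bochner_integral lborel (\<lambda>x. \<Sum>(p, u, es)\<leftarrow>c. of_int u * of_int (X x p)) (of_int (\<Sum>(p, u, es)\<leftarrow>c. u) * ?l)"
      for c :: block
    proof (induction c)
      case (Cons t c)
      obtain p u es where t: "t = (p, u, es)" by (cases t)
      show ?case
        using has_bochner_integral_add[OF has_bochner_integral_mult_right[OF single, of "of_int u" p] Cons]
        by (simp add: t algebra_simps)
    qed (simp add: has_bochner_integral_zero)
    have pair: "has_bochner_integral lborel (\<lambda>x. of_int (X x p) * of_int (X x q)) (?G \<theta> p q)" for p q
      using overlap_two_shifts[OF B(1), of "cis \<theta> * plane_point p" "cis \<theta> * plane_point q"]
      by (simp add: Xi right_diff_distrib)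
    have int: "has_bochner_integral lborel ?f (of_int ?U * ?l + block_sum (?G \<theta>) b)"
      unfolding qform_block_sum by (intro has_bochner_integral_add singles block_sum_integral pair)
    have "emeasure lborel (square (R + 5)) < \<infinity>" "square (R + 5) \<in> sets lborel" using compact_borel_finite[OF compact_square] by auto
    then have int': "has_bochner_integral lborel (\<lambda>x. of_int M * indicator (square (R + 5)) x) (of_int M * measure lborel (square (R + 5)))"
      by (intro has_bochner_integral_mult_right has_bochner_integral_real_indicator) auto
    have "?f x \<le> of_int M * indicator (square (R + 5)) x" for x
    proof (cases "x \<in> square (R + 5)")
      case True
      have "qform (config b) (map (\<lambda>t. X x (fst t)) b) \<le> max_form (config b)"
      proof (rule qform_le_max_form, rule independent_config[OF b(1)])
        show "X x p = 0 \<or> X x p = 1" for p by (simp add: X_def)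
        show "X x q = 0" if "dist_key p q = (4, 0)" "X x p = 1" for p q
        proof -
          have "norm (plane_point p - plane_point q) = 1" by (simp add: norm_plane_point_diff that(1) radius_def)
          then have "norm ((x + cis \<theta> * plane_point p) - (x + cis \<theta> * plane_point q)) = 1"
            by (simp add: right_diff_distrib[symmetric] norm_mult)
          then have "x + cis \<theta> * plane_point p \<notin> B \<or> x + cis \<theta> * plane_point q \<notin> B" using avoid by blast
          then show ?thesis using that(2) by (auto simp: X_def split: if_splits)
        qed
      qed
      then show ?thesis using b(2) True by simp
    next
      case False
      have "qform (config b) (map (\<lambda>t. X x (fst t)) b) = 0"
      proof (rule qform_zero)
        fix y assume "y \<in> set (map (\<lambda>t. X x (fst t)) b)"
        then obtain p u es where p: "(p, u, es) \<in> set b" "y = X x p" by auto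
        have n: "norm (cis \<theta> * plane_point p) \<le> 5" using near[OF p(1)] by (simp add: norm_mult)
        have "x + cis \<theta> * plane_point p \<notin> B"
        proof
          assume "x + cis \<theta> * plane_point p \<in> B"
          then have "x + cis \<theta> * plane_point p \<in> square R" using B(2) by auto
          then have "x \<in> square (R + 5)"
            using n abs_Re_le_cmod[of "cis \<theta> * plane_point p"] abs_Im_le_cmod[of "cis \<theta> * plane_point p"]
            unfolding square_iff plus_complex.sel by linarith
          then show False using False by simp
        qed
        then show "y = 0" by (simp add: p X_def)
      qed
      then show ?thesis using False by simp
    qed
    then have "of_int ?U * ?l + block_sum (?G \<theta>) b \<le> of_int M * measure lborel (square (R + 5))"
      using integral_mono[OF int[unfolded has_bochner_integral_iff, THEN conjunct1] int'[unfolded has_bochner_integral_iff, THEN conjunct1]]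
      by (simp add: has_bochner_integral_integral_eq[OF int] has_bochner_integral_integral_eq[OF int'])
    then show ?thesis using R by (simp add: measure_square)
  qed
  have m: "has_bochner_integral angle (\<lambda>\<theta>. ?G \<theta> p q) (mean_overlap B (radius (dist_key p q)))" for p q
  proof -
    have "norm (plane_point q - plane_point p) = radius (dist_key p q)"
      by (subst norm_minus_commute) (rule norm_plane_point_diff)
    then show ?thesis using mean_overlap_rotate[OF B(1), of "plane_point q - plane_point p"] by simp
  qed
  have int: "has_bochner_integral angle (\<lambda>\<theta>. block_sum (?G \<theta>) b) (block_sum (\<lambda>p q. mean_overlap B (radius (dist_key p q))) b)"
    by (rule block_sum_integral[OF m])
  have "block_sum (\<lambda>p q. mean_overlap B (radius (dist_key p q))) b = (\<integral>\<theta>. block_sum (?G \<theta>) b \<partial>angle)"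
    using has_bochner_integral_integral_eq[OF int] by simp
  also have "\<dots> \<le> (\<integral>\<theta>. of_int M * (4 * (R + 5)\<^sup>2) - of_int ?U * ?l \<partial>angle)"
  proof (rule integral_mono)
    show "integrable angle (\<lambda>\<theta>. block_sum (?G \<theta>) b)" using int by (simp add: has_bochner_integral_iff)
    show "block_sum (?G \<theta>) b \<le> of_int M * (4 * (R + 5)\<^sup>2) - of_int ?U * ?l" for \<theta> using fixed[of \<theta>] by linarith
  qed simp
  also have "\<dots> = of_int M * (4 * (R + 5)\<^sup>2) - of_int ?U * ?l" by (simp add: prob_space[simplified])
  finally show ?thesis unfolding block_sum_pair_terms[of "\<lambda>k. mean_overlap B (radius k)"] by linarith
qed

section \<open>The bound for the density\<close>

lemma near_rhombi: "(p, u, es) \<in> set rhombi \<Longrightarrow> norm (plane_point p) \<le> 5"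
  and near_triangle: "(p, u, es) \<in> set triangle \<Longrightarrow> norm (plane_point p) \<le> 5"
proof -
  have n: "norm (plane_point (a, b, c, d)) \<le> 5"
    if "\<bar>of_int a + of_int b * sqrt 3\<bar> + \<bar>of_int c + of_int d * sqrt 3\<bar> \<le> 10" for a b c d
    using cmod_le[of "plane_point (a, b, c, d)"] that by (simp add: plane_point_def)
  show "(p, u, es) \<in> set rhombi \<Longrightarrow> norm (plane_point p) \<le> 5"
    using sqrt3_bounds by (auto simp: rhombi_def intro!: n)
  show "(p, u, es) \<in> set triangle \<Longrightarrow> norm (plane_point p) \<le> 5"
    using sqrt3_bounds by (auto simp: triangle_def intro!: n)
qed

lemma mean_overlap_0: "mean_overlap B 0 = measure lborel B"
proof -
  interpret prob_space angle by (rule prob_space_angle)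
  show ?thesis by (simp add: mean_overlap_def overlap_def prob_space[simplified])
qed

lemma mean_overlap_1:
  assumes "\<And>x y. x \<in> B \<Longrightarrow> y \<in> B \<Longrightarrow> norm (x - y) \<noteq> 1"
  shows "mean_overlap B 1 = 0"
proof -
  have "B \<inter> (\<lambda>x. x + cis \<theta>) -` B = {}" for \<theta>
    using assms[of "x + cis \<theta>" x for x] by (auto simp: norm_cis)
  then show ?thesis by (simp add: mean_overlap_def overlap_def)
qed

lemma combined_block_inequality:
  assumes B: "compact B" "B \<subseteq> square R" and R: "0 \<le> R"
    and avoid: "\<And>x y. x \<in> B \<Longrightarrow> y \<in> B \<Longrightarrow> norm (x - y) \<noteq> 1"
  shows "44 * measure lborel B + (\<Sum>(k, a)\<leftarrow>spectrum. of_int a * mean_overlap B (radius k)) \<le> 64 * (R + 5)\<^sup>2"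
proof -
  let ?g = "\<lambda>k. mean_overlap B (radius k)"
  have 1: "52 * measure lborel B + (\<Sum>(k, a)\<leftarrow>pair_terms rhombi. of_int a * ?g k) \<le> 16 * (4 * (R + 5)\<^sup>2)"
    using block_inequality[OF B R avoid unit_edges_rhombi, of 16] near_rhombi
    by (simp add: max_form_rhombi sum_weights)
  have 2: "- 8 * measure lborel B + (\<Sum>(k, a)\<leftarrow>pair_terms triangle. of_int a * ?g k) \<le> 0 * (4 * (R + 5)\<^sup>2)"
    using block_inequality[OF B R avoid unit_edges_triangle, of 0] near_triangle
    by (simp add: max_form_triangle sum_weights)
  have "(\<Sum>(k, a)\<leftarrow>pair_terms rhombi @ pair_terms triangle. of_int a * ?g k)
     = (\<Sum>k\<leftarrow>all_keys. of_int (coefficient_of k (pair_terms rhombi @ pair_terms triangle)) * ?g k)"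
    by (rule sum_by_key[OF pair_terms_blocks(1)]) (simp add: all_keys_def)
  also have "\<dots> = (\<Sum>(k, a)\<leftarrow>spectrum. of_int a * ?g k)"
  proof -
    have "?g (4, 0) = 0" using mean_overlap_1[OF avoid] by (simp add: radius_def)
    then show ?thesis using pair_terms_blocks(2) by (simp add: all_keys_def spectrum_def)
  qed
  finally show ?thesis using 1 2 by simp
qed

text \<open>The positivity of the witness bounds the combination of the mean overlaps from below, and the
  configurations bound it from above. The constant 3161/20 is the value of the witness at 0, and 419/20
  is 44 minus the constant term 461/20 of the witness.\<close>

lemma density_inequality:
  assumes B: "compact B" "B \<subseteq> square R" and R: "5 \<le> R"
    and avoid: "\<And>x y. x \<in> B \<Longrightarrow> y \<in> B \<Longrightarrow> norm (x - y) \<noteq> 1"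
  defines "\<beta> \<equiv> measure lborel B / (4 * R\<^sup>2)"
  shows "3161 / 20 * \<beta>\<^sup>2 + 419 / 20 * \<beta> \<le> 16 * ((R + 5) / R)\<^sup>2 + 5000 / R"
proof -
  let ?l = "measure lborel B"
  have q: "0 < 4 * R\<^sup>2" using R by simp
  have l: "?l = \<beta> * (4 * R\<^sup>2)" using q by (simp add: \<beta>_def)
  have le: "?l \<le> 4 * R\<^sup>2"
  proof -
    have "?l \<le> measure lborel (square R)"
      by (rule measure_mono_fmeasurable[OF B(2)])
         (use compact_borel_finite[OF B(1)] compact_borel_finite[OF compact_square] in \<open>auto simp: fmeasurable_def\<close>)
    then show ?thesis using R by (simp add: measure_square)
  qed
  have \<beta>: "0 \<le> \<beta>" "\<beta> \<le> 1" using le q by (auto simp: \<beta>_def)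
  define L :: "(real \<times> real) list" where "L = (0, 461/20) # map (\<lambda>(k, a). (radius k, of_int a)) spectrum"
  have enc: "0 \<le> radius k \<and> radius k \<le> 3" if "(k, a) \<in> set spectrum" for k a
  proof -
    have "(radius k, a) \<in> set radii" using that by (auto simp: radii_def)
    then obtain R' b where "enclosed (radius k, a) (R', b)"
      using radii_enclosed by (metis in_set_conv_nth list_all2_conv_all_nth surj_pair)
    then have e: "0 < R'" "R' \<le> 2864762" "of_int R' / 2^20 \<le> radius k" "radius k \<le> of_int (R' + 1) / 2^20"
      by (auto simp: enclosed_def)
    have "(0::real) \<le> of_int R' / 2^20" using e(1) by simp
    moreover have "real_of_int (R' + 1) / 2^20 \<le> 3" using e(2) by simp
    ultimately show ?thesis using e(3,4) by linarith
  qed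
  have "0 \<le> (\<Sum>(r, a)\<leftarrow>L. a * (mean_overlap B r - 2 * \<beta> * ?l + \<beta>\<^sup>2 * (4 * R\<^sup>2)) + \<bar>a\<bar> * (72 * R))"
  proof (rule positivity_of_mean_overlaps[OF B _ \<beta>])
    show "3 \<le> R" using R by simp
    show "0 \<le> r \<and> r \<le> 3" if "(r, a) \<in> set L" for r a
      using that enc by (auto simp: L_def)
    show "0 \<le> (\<Sum>(r, a)\<leftarrow>L. a * J0 (r * t))" if "0 \<le> t" for t
      using witness_nonneg[OF that] by (simp add: witness_def L_def radii_def o_def case_prod_unfold)
  qed
  also have "\<dots> = 461/20 * ?l + (\<Sum>(k, a)\<leftarrow>spectrum. of_int a * mean_overlap B (radius k))
     + 3161/20 * (- 2 * \<beta> * ?l + \<beta>\<^sup>2 * (4 * R\<^sup>2)) + 5521/20 * (72 * R)"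
    by (simp add: L_def spectrum_def mean_overlap_0 algebra_simps)
  also have "\<dots> \<le> 461/20 * ?l + (64 * (R + 5)\<^sup>2 - 44 * ?l) + 3161/20 * (- 2 * \<beta> * ?l + \<beta>\<^sup>2 * (4 * R\<^sup>2)) + 5521/20 * (72 * R)"
    using combined_block_inequality[OF B _ avoid] R by simp
  also have "\<dots> = (4 * R\<^sup>2) * (- (419/20) * \<beta> - 3161/20 * \<beta>\<^sup>2 + 16 * ((R + 5) / R)\<^sup>2 + 5521/20 * 18 / R)"
    unfolding l using R by (simp add: field_simps power2_eq_square)
  finally have "0 \<le> - (419/20) * \<beta> - 3161/20 * \<beta>\<^sup>2 + 16 * ((R + 5) / R)\<^sup>2 + 5521/20 * 18 / R"
    using q by (simp add: zero_le_mult_iff)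
  moreover have "5521/20 * 18 / R \<le> 5000 / R" using R by (intro divide_right_mono) auto
  ultimately show ?thesis by linarith
qed

text \<open>The lower bound for \<open>R\<close> makes the boundary terms smaller than the gap of 0.007
  left by the quadratic inequality at 0.258795.\<close>

lemma density_bound:
  assumes B: "compact B" "B \<subseteq> square R" and R: "10^7 \<le> R"
    and avoid: "\<And>x y. x \<in> B \<Longrightarrow> y \<in> B \<Longrightarrow> norm (x - y) \<noteq> 1"
  shows "measure lborel B \<le> 0.258795 * (4 * R\<^sup>2)"
proof (rule ccontr)
  assume n: "\<not> ?thesis"
  define \<beta> where "\<beta> = measure lborel B / (4 * R\<^sup>2)"
  have \<beta>: "0.258795 \<le> \<beta>" using n R by (simp add: \<beta>_def pos_le_divide_eq)
  have "3161 / 20 * \<beta>\<^sup>2 + 419 / 20 * \<beta> \<le> 16 * ((R + 5) / R)\<^sup>2 + 5000 / R"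
    unfolding \<beta>_def by (rule density_inequality[OF B _ avoid]) (use R in auto)
  moreover have "0.258795\<^sup>2 \<le> \<beta>\<^sup>2" using \<beta> by (intro power_mono) auto
  moreover have "((R + 5) / R)\<^sup>2 \<le> (1 + 5 / 10^7)\<^sup>2"
  proof (rule power_mono)
    have "(R + 5) / R = 1 + 5 / R" using R by (simp add: field_simps)
    also have "\<dots> \<le> 1 + 5 / 10^7" using R by (intro add_left_mono divide_left_mono) auto
    finally show "(R + 5) / R \<le> 1 + 5 / 10^7" .
  qed (use R in auto)
  moreover have "5000 / R \<le> 5000 / 10^7" using R by (intro divide_left_mono) auto
  ultimately show False using \<beta> by (simp add: power2_eq_square)
qed

definition to_complex :: "real ^ 2 \<Rightarrow> complex" where
  "to_complex v = Complex (v $ 1) (v $ 2)"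

lemma norm_to_complex_diff: "norm (to_complex x - to_complex y) = norm (x - y)"
  by (simp add: to_complex_def norm_vec_def L2_set_def sum_2 cmod_def)

lemma to_complex_continuous: "continuous_on S to_complex"
proof -
  have "dist (to_complex x) (to_complex y) = dist x y" for x y
    by (simp add: dist_norm norm_to_complex_diff)
  then show ?thesis unfolding continuous_on_iff by metis
qed

lemma lborel_to_complex: "(lborel :: complex measure) = distr (lborel :: (real ^ 2) measure) borel to_complex"
proof (rule lborel_eqI)
  fix l u :: complex assume lu: "\<And>b. b \<in> Basis \<Longrightarrow> l \<bullet> b \<le> u \<bullet> b"
  have le: "Re l \<le> Re u" "Im l \<le> Im u" using lu[of 1] lu[of \<i>] by (auto simp: Basis_complex_def inner_complex_def)
  have m: "to_complex \<in> measurable lborel borel"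
    using borel_measurable_continuous_onI[OF to_complex_continuous] by simp
  define l' u' :: "real ^ 2" where "l' = (\<chi> i. if i = 1 then Re l else Im l)" and "u' = (\<chi> i. if i = 1 then Re u else Im u)"
  have pre: "to_complex -` box l u = box l' u'"
  proof (rule set_eqI)
    fix x :: "real ^ 2"
    have "x \<in> box l' u' \<longleftrightarrow> Re l < x $ 1 \<and> x $ 1 < Re u \<and> Im l < x $ 2 \<and> x $ 2 < Im u"
      by (auto simp: mem_box_cart forall_2 l'_def u'_def)
    moreover have "to_complex x \<in> box l u \<longleftrightarrow> Re l < x $ 1 \<and> x $ 1 < Re u \<and> Im l < x $ 2 \<and> x $ 2 < Im u"
      by (auto simp: mem_box Basis_complex_def inner_complex_def to_complex_def)
    ultimately show "x \<in> to_complex -` box l u \<longleftrightarrow> x \<in> box l' u'" by simp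
  qed
  have "emeasure (distr lborel borel to_complex) (box l u) = emeasure lborel (box l' u')"
    by (subst emeasure_distr[OF m]) (auto simp: pre)
  also have "\<dots> = ennreal (\<Prod>b\<in>Basis. (u' - l') \<bullet> b)"
  proof (rule emeasure_lborel_box)
    fix b :: "real ^ 2" assume "b \<in> Basis"
    then show "l' \<bullet> b \<le> u' \<bullet> b" using le by (auto simp: Basis_vec_def inner_axis l'_def u'_def)
  qed
  also have "(\<Prod>b\<in>Basis. (u' - l') \<bullet> b) = (\<Prod>i\<in>UNIV. (u' - l') $ i)"
  proof -
    have "(Basis :: (real ^ 2) set) = (\<lambda>i. axis i 1) ` UNIV" by (auto simp: Basis_vec_def)
    then show ?thesis by (subst \<open>Basis = _\<close>, subst prod.reindex) (auto simp: inj_on_def axis_eq_axis inner_axis)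
  qed
  also have "\<dots> = (\<Prod>b\<in>Basis. (u - l) \<bullet> b)"
    by (simp add: UNIV_2 l'_def u'_def Basis_complex_def inner_complex_def)
  finally show "emeasure (distr lborel borel to_complex) (box l u) = ennreal (\<Prod>b\<in>Basis. (u - l) \<bullet> b)" .
qed simp

text \<open>A measurable set is exhausted from inside by compact sets, which inherit the avoidance of
  distance 1.\<close>

lemma measure_cube_le:
  fixes A :: "(real ^ 2) set"
  assumes A: "one_avoiding A" "A \<in> sets lebesgue" and r: "10^7 \<le> r"
  shows "measure lebesgue (A \<inter> cube 0 r) \<le> 0.258795 * measure lebesgue (cube (0 :: real ^ 2) r)"
proof (rule field_le_epsilon)
  fix e :: real assume e: "0 < e"
  let ?S = "A \<inter> cube 0 r"
  have S: "?S \<in> lmeasurable" using lmeasurable_cube A(2) by (metis fmeasurable_Int_fmeasurable inf_commute)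
  obtain T where T: "closed T" "T \<subseteq> ?S" "?S - T \<in> lmeasurable" "emeasure lebesgue (?S - T) < ennreal e"
    using sets_lebesgue_inner_closed[OF fmeasurableD[OF S] e] by blast
  have "bounded T" using bounded_subset[OF bounded_cbox T(2)[unfolded cube_def, THEN le_infE]] by blast
  then have cT: "compact T" using T(1) by (simp add: compact_eq_bounded_closed)
  define B where "B = to_complex ` T"
  have inj: "inj to_complex" by (rule injI) (metis norm_to_complex_diff eq_iff_diff_eq_0 norm_eq_zero)
  have cB: "compact B" unfolding B_def by (rule compact_continuous_image[OF to_complex_continuous cT])
  have "measure lborel B = measure lborel T"
  proof -
    have "emeasure lborel B = emeasure (distr lborel borel to_complex) B" by (subst lborel_to_complex) simp
    also have "\<dots> = emeasure lborel (to_complex -` B)"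
      using compact_borel_finite[OF cB] borel_measurable_continuous_onI[OF to_complex_continuous]
      by (subst emeasure_distr) auto
    also have "to_complex -` B = T" unfolding B_def by (rule inj_vimage_image_eq[OF inj])
    finally show ?thesis by (simp add: measure_def)
  qed
  moreover have "measure lborel B \<le> 0.258795 * (4 * r\<^sup>2)"
  proof (rule density_bound[OF cB _ r])
    show "B \<subseteq> square r"
      using T(2) by (auto simp: B_def square_iff to_complex_def cube_def mem_box_cart forall_2 abs_le_iff)
    show "norm (x - y) \<noteq> 1" if "x \<in> B" "y \<in> B" for x y
    proof -
      obtain x' y' where "x = to_complex x'" "y = to_complex y'" "x' \<in> A" "y' \<in> A"
        using \<open>x \<in> B\<close> \<open>y \<in> B\<close> T(2) unfolding B_def by blast
      then show ?thesis using A(1) by (simp add: norm_to_complex_diff one_avoiding_def)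
    qed
  qed
  moreover have "measure lebesgue (cube (0 :: real ^ 2) r) = 4 * r\<^sup>2"
    using r by (simp add: measure_cube power2_eq_square)
  moreover have "measure lebesgue ?S \<le> measure lborel T + e"
  proof -
    have Tb: "T \<in> sets borel" using T(1) by simp
    have Tl: "T \<in> lmeasurable" using cT by (rule lmeasurable_compact)
    have "measure lebesgue (?S - T) < e"
      using T(3,4) e by (simp add: emeasure_eq_measure2 ennreal_less_iff)
    moreover have "measure lebesgue ?S \<le> measure lebesgue T + measure lebesgue (?S - T)"
      using measure_Un_le[of T lebesgue "?S - T"] T(2,3) Tl by (simp add: Un_absorb1 fmeasurableD)
    moreover have "measure lebesgue T = measure lborel T" using Tb by (simp add: measure_completion)
    ultimately show ?thesis by linarith
  qed
  ultimately show "measure lebesgue (A \<inter> cube 0 r) \<le> 0.258795 * measure lebesgue (cube (0 :: real ^ 2) r) + e"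
    by simp
qed

theorem theorem3p1:
  shows "m1 TYPE(2) \<le> ereal 0.258795"
  unfolding m1_def
proof (rule SUP_least, clarify)
  fix A :: "(real ^ 2) set" assume A: "one_avoiding A" "A \<in> sets lebesgue"
  have "\<forall>\<^sub>F r in at_top. ereal (measure lebesgue (A \<inter> cube 0 r) / measure lebesgue (cube (0 :: real ^ 2) r)) \<le> ereal 0.258795"
    using eventually_ge_at_top[of "10^7 :: real"]
  proof eventually_elim
    case (elim r)
    then have "0 < measure lebesgue (cube (0 :: real ^ 2) r)" by (simp add: measure_cube)
    then show ?case using measure_cube_le[OF A elim] by (simp add: pos_divide_le_eq)
  qed
  then show "upper_density A \<le> ereal 0.258795"
    unfolding upper_density_def upper_density_at_def by (rule Limsup_bounded)
qed

end
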